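(* Let $f:\mathbb{R}^n\to\mathbb{R}$ be a locally Lipschitz tame function and let $x^*\in\mathbb{R}^n$ be a strict local minimum of $f$. Then $x^*$ is a stable point of $f$.
   Context: $\mathbb{N}=\{0,1,2,\ldots\}$. $\|\cdot\|$ is the norm induced by an inner product $\langle\cdot,\cdot\rangle$ on $\mathbb{R}^n$, and $B(a,r)$ is the closed ball of center $a$ and radius $r$. $\lfloor t\rfloor$ is the floor of $t$. A point $x^*$ is a strict local minimum of $f$ if there exists $\epsilon>0$ such that $f(x^* )<f(x)$ for all $x\in B(x^*,\epsilon)\setminus\{x^*\}$. For a locally Lipschitz $f:\mathbb{R}^n\to\mathbb{R}$, the Clarke subdifferential is $\partial f(x):=\{s\in\mathbb{R}^n: f^\circ(x,d)\geqslant\langle s,d\rangle\ \forall d\in\mathbb{R}^n\}$, where $f^\circ(x,d):=\limsup_{y\to x,\,t\searrow 0}\frac{f(y+td)-f(y)}{t}$. An o-minimal structure on the real field is a sequence $(S_k)_{k\in\mathbb{N}}$ such that for all $k$: (1) $S_k$ is a boolean algebra of subsets of $\mathbb{R}^k$ with $\mathbb{R}^k\in S_k$; (2) $S_k$ contains $\{x\in\mathbb{R}^k:x_i=x_j\}$ for $1\leqslant i<j\leqslant k$; (3) if $A\in S_k$, then $A\times\mathbb{R}$ and $\mathbb{R}\times A$ belong to $S_{k+1}$; (4) if $A\in S_{k+1}$ and $\pi:\mathbb{R}^{k+1}\to\mathbb{R}^k$ is the projection onto the first $k$ coordinates, then $\pi(A)\in S_k$; (5) $S_3$ contains the graphs of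 addition and multiplication; (6) $S_1$ consists exactly of the finite unions of open intervals and singletons. An arbitrary o-minimal structure on the real field is fixed. A set $C\subset\mathbb{R}^n$ is tame if $C\cap B(x,r)\in S_n$ for all $x\in\mathbb{R}^n$ and $r>0$; a function is tame if its graph is tame. Iterative method (with constant step size): a mapping $\mathcal{M}$ which, to an objective function $f:\mathbb{R}^n\to\mathbb{R}$, a step size $\alpha\in(0,\infty)$, a set $X_0\subset\mathbb{R}^n$ and $k_0\in\mathbb{N}$, associates the set $\mathcal{M}(f,\alpha,X_0,k_0)$ of all sequences in $\mathbb{R}^n$ generated by the method on $f$ with step size $\alpha$ whose $k_0$-th term lies in $X_0$; that is, for each $(f,\alpha)$ there is a set $\mathcal{S}(f,\alpha)\subset(\mathbb{R}^n)^{\mathbb{N}}$ such that $\mathcal{M}(f,\alpha,X_0,k_0)=\{(x_k)_{k\in\mathbb{N}}\in\mathcal{S}(f,\alpha):x_{k_0}\in X_0\}$ for all $X_0,k_0$. Write $\mathcal{M}(f,\alpha,X_0):=\mathcal{M}(f,\alpha,X_0,0)$ and $\mathcal{M}(f,(0,\bar\alpha],X_0):=\bigcup_{\alpha\in(0,\bar\alpha]}\mathcal{M}(f,\alpha,X_0)$. $\mathcal{M}$ is approximated by subgradient trajectories of a locally Lipschitz $f$ if there exists $c>0$ such that for any compact sets $X_0,X_1\subset\mathbb{R}^n$ and any $\epsilon,T>0$, there exists $\bar\alpha>0$ such that for all $\alpha\in(0,\bar\alpha]$, $k_0\in\mathbb{N}$ and $(x_k)_{k\in\mathbb{N}}\in\mathcal{M}(f,\alpha,X_0,k_0)$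 with $x_0,\ldots,x_{k_0}\in X_1$, there exists an absolutely continuous $x:[0,T]\to\mathbb{R}^n$ with $x'(t)\in-c\,\partial f(x(t))$ for almost every $t\in[0,T]$, $x(0)\in X_0$, and $\|x_k-x((k-k_0)\alpha)\|\leqslant\epsilon$ for $k=k_0,\ldots,k_0+\lfloor T/\alpha\rfloor$. $x^*\in\mathbb{R}^n$ is an $\mathcal{M}$-stable point of $f$ if for all $\epsilon>0$ there exist $\delta>0$ and $\bar\alpha>0$ such that every $(x_k)_{k\in\mathbb{N}}\in\mathcal{M}(f,(0,\bar\alpha],B(x^*,\delta))$ satisfies $\{x_k\}_{k\in\mathbb{N}}\subset B(x^*,\epsilon)$. $x^*$ is a stable point of $f$ if it is an $\mathcal{M}$-stable point of $f$ for every iterative method $\mathcal{M}$ approximated by subgradient trajectories of $f$. *)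

theory Defs
  imports "HOL-Analysis.Analysis"
begin

text \<open>
  The norm on $\mathbb{R}^n$ is induced by an arbitrary inner product, not necessarily the
  Euclidean one of the type \<open>real^'n\<close>, so inner products are passed as parameters. Notions that
  do not depend on the choice of a norm on a finite-dimensional space (compactness, limits,
  derivatives, local Lipschitz and absolute continuity) are expressed with the library topology
  and metric.
\<close>

definition is_inner_product :: "('v::real_vector \<Rightarrow> 'v \<Rightarrow> real) \<Rightarrow> bool" where
  "is_inner_product ip \<longleftrightarrow>
     bilinear ip \<and> (\<forall>x y. ip x y = ip y x) \<and> (\<forall>x. x \<noteq> 0 \<longrightarrow> ip x x > 0)"

definition ip_norm :: "('v::real_vector \<Rightarrow> 'v \<Rightarrow> real) \<Rightarrow> 'v \<Rightarrow> real" where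
  "ip_norm ip x = sqrt (ip x x)"

definition ip_cball :: "('v::real_vector \<Rightarrow> 'v \<Rightarrow> real) \<Rightarrow> 'v \<Rightarrow> real \<Rightarrow> 'v set" where
  "ip_cball ip a r = {x. ip_norm ip (x - a) \<le> r}"

definition strict_local_min ::
    "('v::real_vector \<Rightarrow> 'v \<Rightarrow> real) \<Rightarrow> ('v \<Rightarrow> real) \<Rightarrow> 'v \<Rightarrow> bool" where
  "strict_local_min ip f a \<longleftrightarrow> (\<exists>\<epsilon>>0. \<forall>x \<in> ip_cball ip a \<epsilon> - {a}. f a < f x)"

definition locally_lipschitz :: "('a::metric_space \<Rightarrow> 'b::metric_space) \<Rightarrow> bool" where
  "locally_lipschitz f \<longleftrightarrow> (\<forall>x. \<exists>r>0. \<exists>L. L-lipschitz_on (cball x r) f)"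


text \<open>
  O-minimal structures on the real field; $\mathbb{R}^k$ is the set of real lists of length $k$.
  Open intervals may be unbounded (\<open>einterval\<close> has extended real endpoints), as is forced by
  $\mathbb{R} \in S_1$.
\<close>

definition o_minimal :: "(nat \<Rightarrow> real list set set) \<Rightarrow> bool" where
  "o_minimal S \<longleftrightarrow>
     (\<forall>k. algebra {xs. length xs = k} (S k)) \<and>
     (\<forall>k i j. i < j \<and> j < k \<longrightarrow> {xs. length xs = k \<and> xs ! i = xs ! j} \<in> S k) \<and>
     (\<forall>k. \<forall>A \<in> S k. {xs @ [t] | xs t. xs \<in> A} \<in> S (Suc k) \<and>
                    {t # xs | xs t. xs \<in> A} \<in> S (Suc k)) \<and>
     (\<forall>k. \<forall>A \<in> S (Suc k). take k ` A \<in> S k) \<and>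
     {[x, y, x + y] | x y. True} \<in> S 3 \<and>
     {[x, y, x * y] | x y. True} \<in> S 3 \<and>
     S 1 = {(\<lambda>t. [t]) ` \<Union>\<I> | \<I>. finite \<I> \<and>
              (\<forall>I \<in> \<I>. (\<exists>a b. I = einterval a b) \<or> (\<exists>a. I = {a}))}"

text \<open>
  The type \<open>'n\<close> has no intrinsic order, so the identification of \<open>real^'n\<close> with $\mathbb{R}^n$
  uses a list enumerating \<open>'n\<close> without repetition.
\<close>

definition coords :: "'n::finite list \<Rightarrow> real^'n \<Rightarrow> real list" where
  "coords idx x = map (\<lambda>i. x $ i) idx"

text \<open>In \<open>tame_set\<close>, \<open>\<kappa>\<close> is a linear bijection from the ambient space onto $\mathbb{R}^k$.\<close>

definition tame_set :: "(nat \<Rightarrow> real list set set) \<Rightarrow> nat \<Rightarrow> ('v::real_vector \<Rightarrow> real list) \<Rightarrow>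
    ('v \<Rightarrow> 'v \<Rightarrow> real) \<Rightarrow> 'v set \<Rightarrow> bool" where
  "tame_set S k \<kappa> ip C \<longleftrightarrow> (\<forall>x r. r > 0 \<longrightarrow> \<kappa> ` (C \<inter> ip_cball ip x r) \<in> S k)"

text \<open>The graph lives in $\mathbb{R}^{n+1}$, here \<open>(real^'n) \<times> real\<close>, with inner product \<open>ipg\<close>.\<close>

definition tame_fun :: "(nat \<Rightarrow> real list set set) \<Rightarrow> 'n::finite list \<Rightarrow>
    ((real^'n) \<times> real \<Rightarrow> (real^'n) \<times> real \<Rightarrow> real) \<Rightarrow> (real^'n \<Rightarrow> real) \<Rightarrow> bool" where
  "tame_fun S idx ipg f \<longleftrightarrow>
     tame_set S (CARD('n) + 1) (\<lambda>(x, y). coords idx x @ [y]) ipg {(x, f x) | x. True}"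


text \<open>
  In the limit superior $y \to x$ allows $y = x$, as is usual for the Clarke directional
  derivative.
\<close>

definition clarke_dd :: "('v::real_normed_vector \<Rightarrow> real) \<Rightarrow> 'v \<Rightarrow> 'v \<Rightarrow> ereal" where
  "clarke_dd f x d =
     Limsup (nhds x \<times>\<^sub>F at_right 0) (\<lambda>(y, t). ereal ((f (y + t *\<^sub>R d) - f y) / t))"

definition clarke_subdiff ::
    "('v::real_normed_vector \<Rightarrow> 'v \<Rightarrow> real) \<Rightarrow> ('v \<Rightarrow> real) \<Rightarrow> 'v \<Rightarrow> 'v set" where
  "clarke_subdiff ip f x = {s. \<forall>d. clarke_dd f x d \<ge> ereal (ip s d)}"

definition abs_continuous_on :: "real \<Rightarrow> real \<Rightarrow> (real \<Rightarrow> 'v::real_normed_vector) \<Rightarrow> bool" where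
  "abs_continuous_on a b g \<longleftrightarrow>
     (\<forall>\<epsilon>>0. \<exists>\<delta>>0. \<forall>P. finite P \<and> (\<forall>(u, v) \<in> P. a \<le> u \<and> u < v \<and> v \<le> b) \<and>
        disjoint_family_on (\<lambda>(u, v). {u<..<v}) P \<and> (\<Sum>(u, v) \<in> P. v - u) < \<delta> \<longrightarrow>
        (\<Sum>(u, v) \<in> P. norm (g v - g u)) < \<epsilon>)"

definition subgradient_trajectory :: "('v::real_normed_vector \<Rightarrow> 'v \<Rightarrow> real) \<Rightarrow> ('v \<Rightarrow> real) \<Rightarrow>
    real \<Rightarrow> real \<Rightarrow> (real \<Rightarrow> 'v) \<Rightarrow> bool" where
  "subgradient_trajectory ip f c T g \<longleftrightarrow>
     abs_continuous_on 0 T g \<and>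
     (AE t in lebesgue. t \<in> {0..T} \<longrightarrow>
        (\<exists>v. (g has_vector_derivative v) (at t within {0..T}) \<and>
             v \<in> (\<lambda>s. (- c) *\<^sub>R s) ` clarke_subdiff ip f (g t)))"


type_synonym 'v method_map = "('v \<Rightarrow> real) \<Rightarrow> real \<Rightarrow> 'v set \<Rightarrow> nat \<Rightarrow> (nat \<Rightarrow> 'v) set"

definition iterative_method :: "'v method_map \<Rightarrow> bool" where
  "iterative_method M \<longleftrightarrow>
     (\<exists>\<S> :: ('v \<Rightarrow> real) \<Rightarrow> real \<Rightarrow> (nat \<Rightarrow> 'v) set.
        \<forall>f \<alpha> X0 k0. \<alpha> > 0 \<longrightarrow> M f \<alpha> X0 k0 = {x \<in> \<S> f \<alpha>. x k0 \<in> X0})"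

definition approximated_by_subgradient_trajectories ::
    "('v::real_normed_vector \<Rightarrow> 'v \<Rightarrow> real) \<Rightarrow> 'v method_map \<Rightarrow> ('v \<Rightarrow> real) \<Rightarrow> bool" where
  "approximated_by_subgradient_trajectories ip M f \<longleftrightarrow>
     (\<exists>c>0. \<forall>X0 X1 \<epsilon> T. compact X0 \<and> compact X1 \<and> \<epsilon> > 0 \<and> T > 0 \<longrightarrow>
        (\<exists>\<alpha>'>0. \<forall>\<alpha> \<in> {0<..\<alpha>'}. \<forall>k0. \<forall>x \<in> M f \<alpha> X0 k0. (\<forall>k\<le>k0. x k \<in> X1) \<longrightarrow>
           (\<exists>g. subgradient_trajectory ip f c T g \<and> g 0 \<in> X0 \<and>
              (\<forall>k \<in> {k0..k0 + nat \<lfloor>T / \<alpha>\<rfloor>}. ip_norm ip (x k - g (real (k - k0) * \<alpha>)) \<le> \<epsilon>))))"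

definition method_stable_point ::
    "('v::real_vector \<Rightarrow> 'v \<Rightarrow> real) \<Rightarrow> 'v method_map \<Rightarrow> ('v \<Rightarrow> real) \<Rightarrow> 'v \<Rightarrow> bool" where
  "method_stable_point ip M f a \<longleftrightarrow>
     (\<forall>\<epsilon>>0. \<exists>\<delta>>0. \<exists>\<alpha>'>0. \<forall>x \<in> (\<Union>\<alpha> \<in> {0<..\<alpha>'}. M f \<alpha> (ip_cball ip a \<delta>) 0).
        range x \<subseteq> ip_cball ip a \<epsilon>)"

definition stable_point ::
    "('v::real_normed_vector \<Rightarrow> 'v \<Rightarrow> real) \<Rightarrow> ('v \<Rightarrow> real) \<Rightarrow> 'v \<Rightarrow> bool" where
  "stable_point ip f a \<longleftrightarrow>
     (\<forall>M. iterative_method M \<and> approximated_by_subgradient_trajectories ip M f \<longrightarrow>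
          method_stable_point ip M f a)"

end

theory Submission
  imports Defs
begin

text \<open>
  Near the minimum, \<open>f\<close> agrees with a globally Lipschitz function \<open>F\<close> that is definable. Definable
  functions of one real variable are monotone near each one-sided limit point; on the real field
  this follows from a Baire argument, an interval being a countable union of definable sets one of
  which then contains an interval. Together with definable selection it gives semismoothness: if
  \<open>F\<close> is steep in direction \<open>d\<close> at points approaching \<open>x\<close> from the direction \<open>d\<close>, it is
  equally steep on the half-line from \<open>x\<close>.

  Semismoothness replaces stratification in two places. First, all but countably many times of a
  differentiable curve \<open>g\<close> with \<open>g' \<in> - c \<partial>F(g)\<close> are two-sided limits of times with nearly the same
  subgradient, so \<open>F \<circ> g\<close> has slope \<open>- c |v|\<^sup>2\<close> with \<open>v \<in> \<partial>F(g)\<close> almost everywhere. Second, a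
  definable curve of critical points parametrised by the critical value would have infinite speed
  everywhere, which is impossible for monotone coordinates; hence critical values are locally finite.

  So there are arbitrarily small levels above the minimum that carry no critical point, the
  corresponding sublevel set is mapped strictly into itself by the trajectories after a fixed time,
  and iterates that follow trajectories with small error return to it after each period.
\<close>

section \<open>Predicates and functions definable in an o-minimal structure\<close>

text \<open>For a merely Lipschitz \<open>F\<close>, a curve with velocity in
  \<open>- c \<partial>F\<close> need not decrease \<open>F\<close>: the Clarke subdifferential can
  contain vectors unrelated to the variation of \<open>F\<close> along the curve. Definability has
  to exclude this, and it does so through one mechanism, used repeatedly: a definable function of
  one variable is monotone near 0, so a bound on its size there controls its increments, and an
  inequality found along a sequence of parameters extends to all small parameters.

  Decrease of \<open>F\<close> along trajectories is still not enough for the iterates. In each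
  period they follow a new trajectory with a fixed error, and such errors could add up over
  infinitely many periods. At a noncritical level the subgradients are bounded away from 0, so a
  trajectory drops by a fixed amount per period unless it is already well below the level; this drop
  absorbs the error. Strictness of the minimum supplies the barrier that keeps the sublevel set away
  from the boundary of the ball.\<close>

locale o_minimal_structure =
  fixes S :: "nat \<Rightarrow> real list set set"
  assumes o_minimal: "o_minimal S"
begin

lemmas axioms = o_minimal[unfolded o_minimal_def]
lemmas algebra = axioms[THEN conjunct1, rule_format]
lemmas diagonal_in = axioms[THEN conjunct2, THEN conjunct1, rule_format, OF conjI]
lemmas times_in = axioms[THEN conjunct2, THEN conjunct2, THEN conjunct1, rule_format]
lemmas take_in = axioms[THEN conjunct2, THEN conjunct2, THEN conjunct2, THEN conjunct1, rule_format]
lemmas add_mult_in = axioms[THEN conjunct2, THEN conjunct2, THEN conjunct2, THEN conjunct2]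
lemmas S_1 = add_mult_in[THEN conjunct2, THEN conjunct2]

text \<open>Formulas are predicates on environments \<open>nat \<Rightarrow> real\<close>, whose variables are the natural numbers;
  variable \<open>0\<close> is the one bound by the innermost quantifier. The first conjunct of \<open>cyl\<close> makes
  the junk values \<open>xs ! i\<close> for \<open>i \<ge> k\<close> irrelevant.\<close>

definition cyl :: "nat \<Rightarrow> ((nat \<Rightarrow> real) \<Rightarrow> bool) \<Rightarrow> bool" where
  "cyl k P \<longleftrightarrow> (\<forall>e e'. (\<forall>i<k. e i = e' i) \<longrightarrow> P e = P e') \<and>
     {xs. length xs = k \<and> P (\<lambda>i. xs ! i)} \<in> S k"

lemma cylD: "cyl k P \<Longrightarrow> (\<And>i. i < k \<Longrightarrow> e i = e' i) \<Longrightarrow> P e \<longleftrightarrow> P e'"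
  unfolding cyl_def by simp

lemma cyl_conj: assumes "cyl k P" "cyl k Q" shows "cyl k (\<lambda>e. P e \<and> Q e)"
proof -
  interpret algebra "{xs. length xs = k}" "S k" by (rule algebra)
  have "{xs. length xs = k \<and> P (\<lambda>i. xs ! i) \<and> Q (\<lambda>i. xs ! i)} =
    {xs. length xs = k \<and> P (\<lambda>i. xs ! i)} \<inter> {xs. length xs = k \<and> Q (\<lambda>i. xs ! i)}" by auto
  then show ?thesis using assms unfolding cyl_def by (metis (no_types, lifting) Int)
qed

lemma cyl_not: assumes "cyl k P" shows "cyl k (\<lambda>e. \<not> P e)"
proof -
  interpret algebra "{xs. length xs = k}" "S k" by (rule algebra)
  have "{xs. length xs = k \<and> \<not> P (\<lambda>i. xs ! i)} =
    {xs. length xs = k} - {xs. length xs = k \<and> P (\<lambda>i. xs ! i)}" by auto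
  then show ?thesis using assms unfolding cyl_def by (metis (no_types, lifting) compl_sets)
qed

lemma cyl_True: "cyl k (\<lambda>e. True)"
proof -
  interpret algebra "{xs. length xs = k}" "S k" by (rule algebra)
  show ?thesis using top unfolding cyl_def by simp
qed

lemma cyl_Suc: assumes "cyl k P" shows "cyl (Suc k) P"
proof -
  have *: "P (\<lambda>i. (xs @ [t]) ! i) \<longleftrightarrow> P (\<lambda>i. xs ! i)" if "length xs = k" for xs t
    using that by (intro cylD[OF assms]) (simp add: nth_append)
  have "{xs. length xs = Suc k \<and> P (\<lambda>i. xs ! i)} =
    {xs @ [t] | xs t. xs \<in> {xs. length xs = k \<and> P (\<lambda>i. xs ! i)}}" (is "?A = ?B")
  proof (intro equalityI subsetI)
    fix x assume "x \<in> ?A"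
    then show "x \<in> ?B"
      by (cases x rule: rev_cases) (use * in auto)
  next
    fix x assume "x \<in> ?B"
    then show "x \<in> ?A" using * by auto
  qed
  moreover have "?B \<in> S (Suc k)"
    using assms unfolding cyl_def by (elim conjE) (rule times_in[THEN conjunct1])
  ultimately have "{xs. length xs = Suc k \<and> P (\<lambda>i. xs ! i)} \<in> S (Suc k)" by simp
  with assms show ?thesis unfolding cyl_def by simp
qed

lemma cyl_shift: assumes "cyl k P" shows "cyl (Suc k) (\<lambda>e. P (\<lambda>i. e (Suc i)))"
proof -
  have "{xs. length xs = Suc k \<and> P (\<lambda>i. xs ! Suc i)} =
    {t # xs | xs t. xs \<in> {xs. length xs = k \<and> P (\<lambda>i. xs ! i)}}" (is "?A = ?B")
  proof (intro equalityI subsetI)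
    fix x assume "x \<in> ?A"
    then show "x \<in> ?B" by (cases x) auto
  qed auto
  moreover have "?B \<in> S (Suc k)"
    using assms unfolding cyl_def by (elim conjE) (rule times_in[THEN conjunct2])
  ultimately have "{xs. length xs = Suc k \<and> P (\<lambda>i. xs ! Suc i)} \<in> S (Suc k)" by simp
  moreover have "P (\<lambda>i. e (Suc i)) = P (\<lambda>i. e' (Suc i))" if "\<forall>i<Suc k. e i = e' i" for e e'
    using that by (intro cylD[OF assms]) simp
  ultimately show ?thesis unfolding cyl_def by simp
qed

lemma cyl_mono: "cyl k P \<Longrightarrow> k \<le> l \<Longrightarrow> cyl l P"
  by (induction l rule: nat_induct) (auto simp: le_Suc_eq intro: cyl_Suc)

lemma cyl_shifts: "cyl m P \<Longrightarrow> cyl (k + m) (\<lambda>e. P (\<lambda>i. e (k + i)))"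
proof (induction k)
  case (Suc k)
  then show ?case using cyl_shift[of "k + m" "\<lambda>e. P (\<lambda>i. e (k + i))"] by simp
qed simp

text \<open>The projection axiom forgets the last coordinate, so the bound variable is
  \<open>k\<close> here; \<open>pred_ex\<close> later moves it to 0.\<close>

lemma cyl_ex_last: assumes "cyl (Suc k) P" shows "cyl k (\<lambda>e. \<exists>x. P (e(k := x)))"
proof -
  have 1: "P (e(k := x)) \<longleftrightarrow> P (e'(k := x))" if "\<forall>i<k. e i = e' i" for e e' x
    using that by (intro cylD[OF assms]) (auto simp: less_Suc_eq)
  have 2: "P ((\<lambda>i. xs ! i)(k := x)) \<longleftrightarrow> P (\<lambda>i. (xs @ [x]) ! i)" if "length xs = k" for xs x
    using that by (intro cylD[OF assms]) (auto simp: less_Suc_eq nth_append)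
  have "{xs. length xs = k \<and> (\<exists>x. P ((\<lambda>i. xs ! i)(k := x)))} =
    take k ` {xs. length xs = Suc k \<and> P (\<lambda>i. xs ! i)}" (is "?A = ?B")
  proof (intro equalityI subsetI)
    fix xs assume "xs \<in> ?A"
    then obtain x where "length xs = k" "P (\<lambda>i. (xs @ [x]) ! i)" using 2 by auto
    then have "xs = take k (xs @ [x])" "xs @ [x] \<in> {xs. length xs = Suc k \<and> P (\<lambda>i. xs ! i)}"
      by auto
    then show "xs \<in> ?B" by blast
  next
    fix ys assume "ys \<in> ?B"
    then obtain xs where xs: "length xs = Suc k" "P (\<lambda>i. xs ! i)" "ys = take k xs" by auto
    then obtain zs z where "xs = zs @ [z]" by (cases xs rule: rev_cases) auto
    with xs have "length zs = k" "ys = zs" "P ((\<lambda>i. zs ! i)(k := z))" using 2[of zs z] by auto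
    then show "ys \<in> ?A" by blast
  qed
  moreover have "take k ` A \<in> S k" if "A \<in> S (Suc k)" for A
    using take_in[OF that] by simp
  ultimately have "{xs. length xs = k \<and> (\<exists>x. P ((\<lambda>i. xs ! i)(k := x)))} \<in> S k"
    using assms unfolding cyl_def by simp
  with 1 show ?thesis unfolding cyl_def by (metis (no_types, lifting))
qed

text \<open>Only the values of \<open>z\<close> from index \<open>k\<close> to
  \<open>k + m - 1\<close> matter, so one quantifier over sequences stands for \<open>m\<close> real
  quantifiers.\<close>

lemma cyl_ex_block:
  "cyl (k + m) P \<Longrightarrow> cyl k (\<lambda>e. \<exists>z. P (\<lambda>i. if i < k then e i else z i))"
proof (induction m arbitrary: P)
  case 0
  have "P (\<lambda>i. if i < k then e i else z i) \<longleftrightarrow> P e" for e z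
    using 0 by (intro cylD[of k]) auto
  with 0 show ?case by simp
next
  case (Suc m)
  let ?Q = "\<lambda>e. \<exists>x. P (e(k + m := x))"
  have "cyl k (\<lambda>e. \<exists>z. ?Q (\<lambda>i. if i < k then e i else z i))"
    using Suc.IH[of ?Q] cyl_ex_last[of "k + m" P] Suc.prems by simp
  moreover have "(\<exists>z. ?Q (\<lambda>i. if i < k then e i else z i)) \<longleftrightarrow>
      (\<exists>z. P (\<lambda>i. if i < k then e i else z i))" for e
  proof
    assume "\<exists>z. ?Q (\<lambda>i. if i < k then e i else z i)"
    then obtain z x where "P ((\<lambda>i. if i < k then e i else z i)(k + m := x))" by blast
    moreover have "(\<lambda>i. if i < k then e i else z i)(k + m := x) =
      (\<lambda>i. if i < k then e i else (z(k + m := x)) i)" by auto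
    ultimately show "\<exists>z. P (\<lambda>i. if i < k then e i else z i)" by metis
  next
    assume "\<exists>z. P (\<lambda>i. if i < k then e i else z i)"
    then obtain z where "P (\<lambda>i. if i < k then e i else z i)" by blast
    moreover have "(\<lambda>i. if i < k then e i else z i)(k + m := z (k + m)) =
      (\<lambda>i. if i < k then e i else z i)" by auto
    ultimately show "\<exists>z. ?Q (\<lambda>i. if i < k then e i else z i)" by metis
  qed
  ultimately show ?case by simp
qed

lemma cyl_eq: assumes "i < j" "j < k" shows "cyl k (\<lambda>e. e i = e j)"
proof -
  have "{xs. length xs = k \<and> xs ! i = xs ! j} \<in> S k"
    using diagonal_in assms by blast
  with assms show ?thesis unfolding cyl_def by auto
qed

lemma cyl_all_less: "(\<And>i. i < m \<Longrightarrow> cyl k (P i)) \<Longrightarrow> cyl k (\<lambda>e. \<forall>i<m::nat. P i e)"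
proof (induction m)
  case (Suc m)
  then have "cyl k (\<lambda>e. P m e \<and> (\<forall>i<m. P i e))" by (intro cyl_conj) auto
  moreover have "(\<forall>i<Suc m. P i e) \<longleftrightarrow> P m e \<and> (\<forall>i<m. P i e)" for e by (auto simp: less_Suc_eq)
  ultimately show ?case by simp
qed (simp add: cyl_True)

text \<open>The axioms contain no permutation of coordinates. The arguments of \<open>P\<close> are
  placed in \<open>m\<close> fresh coordinates after the first \<open>k\<close>, equated with the
  coordinates \<open>\<sigma> i\<close>, and projected away; \<open>\<sigma>\<close> may repeat or
  omit indices.\<close>

lemma cyl_rename:
  assumes P: "cyl m P" and s: "\<And>i. i < m \<Longrightarrow> \<sigma> i < k"
  shows "cyl k (\<lambda>e. P (\<lambda>i. e (\<sigma> i)))"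
proof -
  let ?Q = "\<lambda>e. P (\<lambda>i. e (k + i)) \<and> (\<forall>i<m. e (\<sigma> i) = e (k + i))"
  have "cyl (k + m) ?Q"
    using s by (intro cyl_conj cyl_shifts P cyl_all_less cyl_eq) (auto simp: trans_less_add1)
  then have "cyl k (\<lambda>e. \<exists>z. ?Q (\<lambda>i. if i < k then e i else z i))" by (rule cyl_ex_block)
  moreover have "(\<exists>z. ?Q (\<lambda>i. if i < k then e i else z i)) \<longleftrightarrow> P (\<lambda>i. e (\<sigma> i))" for e
  proof
    assume "\<exists>z. ?Q (\<lambda>i. if i < k then e i else z i)"
    then obtain z where z: "P (\<lambda>i. z (k + i))" "\<forall>i<m. e (\<sigma> i) = z (k + i)" using s by auto
    then show "P (\<lambda>i. e (\<sigma> i))" using cylD[OF P, of "\<lambda>i. e (\<sigma> i)" "\<lambda>i. z (k + i)"] by simp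
  next
    assume "P (\<lambda>i. e (\<sigma> i))"
    then show "\<exists>z. ?Q (\<lambda>i. if i < k then e i else z i)" using s
      by (intro exI[of _ "\<lambda>i. e (\<sigma> (i - k))"]) simp
  qed
  ultimately show ?thesis by simp
qed

section \<open>Formulas with an unspecified finite number of variables\<close>

definition definable_pred :: "((nat \<Rightarrow> real) \<Rightarrow> bool) \<Rightarrow> bool" where
  "definable_pred P \<longleftrightarrow> (\<exists>k. cyl k P)"

lemma pred_not: "definable_pred P \<Longrightarrow> definable_pred (\<lambda>e. \<not> P e)"
  unfolding definable_pred_def using cyl_not by blast

lemma pred_conj: assumes "definable_pred P" "definable_pred Q" shows "definable_pred (\<lambda>e. P e \<and> Q e)"
proof -
  obtain k l where "cyl k P" "cyl l Q" using assms unfolding definable_pred_def by blast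
  then have "cyl (max k l) (\<lambda>e. P e \<and> Q e)" by (intro cyl_conj) (auto intro: cyl_mono)
  then show ?thesis unfolding definable_pred_def by blast
qed

lemma pred_const: "definable_pred (\<lambda>e. b)"
  unfolding definable_pred_def using cyl_True[of 0] cyl_not[OF cyl_True, of 0] by (cases b) auto

lemma pred_disj: "definable_pred P \<Longrightarrow> definable_pred Q \<Longrightarrow> definable_pred (\<lambda>e. P e \<or> Q e)"
  using pred_not[OF pred_conj[OF pred_not pred_not], of P Q] by simp

lemma pred_imp: "definable_pred P \<Longrightarrow> definable_pred Q \<Longrightarrow> definable_pred (\<lambda>e. P e \<longrightarrow> Q e)"
  using pred_not[OF pred_conj[OF _ pred_not], of P Q] by simp

lemma pred_rename: assumes "definable_pred P" shows "definable_pred (\<lambda>e. P (\<lambda>i. e (\<sigma> i)))"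
proof -
  obtain m where m: "cyl m P" using assms unfolding definable_pred_def by blast
  \<comment> \<open>For \<open>m = 0\<close> the \<open>Max\<close> is an unspecified number, which
    is harmless because no index lies below \<open>m\<close>.\<close>
  have "\<sigma> i < Suc (Max (\<sigma> ` {..<m}))" if "i < m" for i
    using that by (simp add: le_imp_less_Suc)
  then show ?thesis unfolding definable_pred_def using cyl_rename[OF m, of \<sigma>] by blast
qed

text \<open>De Bruijn convention: the bound variable is 0 and the free ones are shifted. A cyclic
  renaming takes 0 to the last coordinate, where the projection axiom applies. Writing
  \<open>P\<close> with two arguments lets the rule resolve against any quantified formula.\<close>

lemma pred_ex:
  assumes "definable_pred (\<lambda>e. P (\<lambda>i. e (Suc i)) (e 0))"
  shows "definable_pred (\<lambda>e. \<exists>x. P e x)"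
proof -
  obtain k where "cyl k (\<lambda>e. P (\<lambda>i. e (Suc i)) (e 0))" using assms unfolding definable_pred_def by blast
  moreover define Q where "Q = (\<lambda>e. P (\<lambda>i. e (Suc i)) (e (0::nat)))"
  ultimately have Q: "cyl (Suc k) Q" by (simp add: cyl_Suc)
  have "cyl (Suc k) (\<lambda>e. Q (\<lambda>i. e (if i = 0 then k else i - 1)))"
    using Q by (rule cyl_rename) auto
  then have "cyl k (\<lambda>e. \<exists>x. Q (\<lambda>i. (e(k := x)) (if i = 0 then k else i - 1)))"
    by (rule cyl_ex_last)
  moreover have "Q (\<lambda>i. (e(k := x)) (if i = 0 then k else i - 1)) \<longleftrightarrow> P e x" for e x
  proof -
    have "Q (\<lambda>i. (e(k := x)) (if i = 0 then k else i - 1)) \<longleftrightarrow> Q (case_nat x e)"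
      by (rule cylD[OF Q]) (auto split: nat.split)
    then show ?thesis by (simp add: Q_def)
  qed
  ultimately show ?thesis unfolding definable_pred_def by auto
qed

lemma pred_all:
  assumes "definable_pred (\<lambda>e. P (\<lambda>i. e (Suc i)) (e 0))"
  shows "definable_pred (\<lambda>e. \<forall>x. P e x)"
  using pred_not[OF pred_ex[of "\<lambda>e x. \<not> P e x"]] pred_not[OF assms] by simp

text \<open>The formula may be a cylinder over many coordinates; renaming all of them to 0 restricts
  it to the diagonal and brings it into \<open>S 1\<close>, which the axioms describe
  explicitly.\<close>

lemma pred_set:
  assumes "definable_pred (\<lambda>e. P (e 0))"
  obtains \<I> where "finite \<I>" "{t. P t} = \<Union>\<I>"
    "\<And>I. I \<in> \<I> \<Longrightarrow> (\<exists>a b. I = einterval a b) \<or> (\<exists>a. I = {a})"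
proof -
  obtain k where "cyl k (\<lambda>e. P (e 0))" using assms unfolding definable_pred_def by blast
  then have "cyl 1 (\<lambda>e. P (e 0))" using cyl_rename[of k _ "\<lambda>_. 0" 1] by simp
  moreover have "{xs. length xs = 1 \<and> P (xs ! 0)} = (\<lambda>t. [t]) ` {t. P t}"
    by (auto simp: length_Suc_conv)
  ultimately have "(\<lambda>t. [t]) ` {t. P t} \<in> S 1" unfolding cyl_def by simp
  then obtain \<I> :: "real set set" where I: "finite \<I>" "(\<lambda>t. [t]) ` {t. P t} = (\<lambda>t. [t]) ` \<Union>\<I>"
    "\<forall>I \<in> \<I>. (\<exists>a b. I = einterval a b) \<or> (\<exists>a. I = {a})"
    unfolding S_1 mem_Collect_eq by (elim exE conjE) simp
  have "inj (\<lambda>t::real. [t])" by (simp add: inj_def)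
  then have "{t. P t} = \<Union>\<I>" using I(2) by (simp add: inj_image_eq_iff)
  then show ?thesis using I by (intro that[of \<I>]) simp_all
qed

section \<open>Definable terms and substitution\<close>

definition definable_term :: "((nat \<Rightarrow> real) \<Rightarrow> real) \<Rightarrow> bool" where
  "definable_term h \<longleftrightarrow> definable_pred (\<lambda>e. e 0 = h (\<lambda>i. e (Suc i)))"

lemma term_var: "definable_term (\<lambda>e. e i)"
  unfolding definable_term_def definable_pred_def using cyl_eq[of 0 "Suc i" "Suc (Suc i)"] by auto

lemma pred_subst_head:
  assumes "definable_pred P" "definable_term h"
  shows "definable_pred (\<lambda>e. P (case_nat (h e) e))"
proof -
  have "definable_pred (\<lambda>e. \<exists>x. x = h e \<and> P (case_nat x e))"
  proof (rule pred_ex, rule pred_conj)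
    show "definable_pred (\<lambda>e. e 0 = h (\<lambda>i. e (Suc i)))" using assms unfolding definable_term_def by simp
    have "case_nat (e 0) (\<lambda>i. e (Suc i)) = e" for e :: "nat \<Rightarrow> real"
      by (auto simp: fun_eq_iff split: nat.split)
    then show "definable_pred (\<lambda>e. P (case_nat (e 0) (\<lambda>i. e (Suc i))))" using assms by simp
  qed
  then show ?thesis by simp
qed

lemma term_rename: "definable_term h \<Longrightarrow> definable_term (\<lambda>e. h (\<lambda>i. e (\<sigma> i)))"
  unfolding definable_term_def
  by (drule pred_rename[of _ "\<lambda>i. case i of 0 \<Rightarrow> 0 | Suc j \<Rightarrow> Suc (\<sigma> j)"]) simp

lemma pred_subst_block:
  assumes "definable_pred P" "\<And>i. i < m \<Longrightarrow> definable_term (h i)"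
  shows "definable_pred (\<lambda>e. P (\<lambda>i. if i < m then h i e else e (i - m)))"
  using assms
proof (induction m arbitrary: P)
  case (Suc m)
  let ?h = "\<lambda>e. h m (\<lambda>i. e (m + i))"
  text \<open>Free the last of the \<open>Suc m\<close> slots first: it is renamed to the head, and substituted
    by \<open>h m\<close> read off the unshifted part of the environment.\<close>
  let ?s = "\<lambda>i. if i < m then Suc i else if i = m then 0 else i"
  have "definable_pred (\<lambda>e. P (\<lambda>i. case_nat (?h e) e (?s i)))"
    using pred_subst_head[OF pred_rename[OF Suc.prems(1), of ?s] term_rename[OF Suc.prems(2)[of m], of "\<lambda>i. m + i"]]
    by simp
  then have "definable_pred (\<lambda>e. P (\<lambda>i. case_nat (?h (\<lambda>i. if i < m then h i e else e (i - m)))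
      (\<lambda>i. if i < m then h i e else e (i - m)) (?s i)))"
    by (rule Suc.IH[of "\<lambda>e. P (\<lambda>i. case_nat (?h e) e (?s i))"]) (use Suc.prems in auto)
  moreover have "case_nat (?h (\<lambda>i. if i < m then h i e else e (i - m)))
      (\<lambda>i. if i < m then h i e else e (i - m)) (?s i) = (if i < Suc m then h i e else e (i - Suc m))"
    for e i
  proof -
    consider "i < m" | "i = m" | n where "i = Suc m + n"
      by (metis less_iff_Suc_add linorder_neqE_nat add_Suc)
    then show ?thesis by cases auto
  qed
  ultimately show ?case by simp
qed simp

text \<open>\<open>P\<close> reads finitely many variables, so infinitely many substitutions reduce
  to a finite block.\<close>

lemma pred_subst:
  assumes P: "definable_pred P" and h: "\<And>i. definable_term (h i)"
  shows "definable_pred (\<lambda>e. P (\<lambda>i. h i e))"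
proof -
  obtain m where m: "cyl m P" using P unfolding definable_pred_def by blast
  have "P (\<lambda>i. if i < m then h i e else e (i - m)) = P (\<lambda>i. h i e)" for e
    by (intro cylD[OF m]) simp
  then show ?thesis using pred_subst_block[OF P, of m h] h by simp
qed

lemma term_subst:
  assumes g: "definable_term g" and h: "\<And>i. definable_term (h i)"
  shows "definable_term (\<lambda>e. g (\<lambda>i. h i e))"
proof -
  define h' where "h' = (\<lambda>i e. case i of 0 \<Rightarrow> e 0 | Suc j \<Rightarrow> h j (\<lambda>i. e (Suc i)))"
  have "definable_term (h' i)" for i
    unfolding h'_def by (cases i) (auto intro: term_var term_rename h)
  from pred_subst[OF g[unfolded definable_term_def], of h', OF this] show ?thesis
    unfolding definable_term_def by (simp add: h'_def)
qed

lemma pred_eq: assumes "definable_term g" "definable_term h" shows "definable_pred (\<lambda>e. g e = h e)"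
proof -
  have "definable_pred (\<lambda>e. e 0 = e 1)" using cyl_eq[of 0 1 2] unfolding definable_pred_def by auto
  from pred_subst[OF this, of "\<lambda>i. if i = 0 then g else h"] assms show ?thesis by simp
qed

text \<open>All singletons belong to \<open>S 1\<close>, so definability is definability with
  arbitrary real parameters. This allows fixed points, directions and tolerances to occur in
  formulas.\<close>

lemma term_const: "definable_term (\<lambda>e. c)"
proof -
  have "(\<lambda>t. [t]) ` \<Union>{{c}} \<in> S 1" unfolding S_1 by blast
  moreover have "{xs. length xs = 1 \<and> xs ! 0 = c} = (\<lambda>t. [t]) ` \<Union>{{c}}"
    by (auto simp: length_Suc_conv)
  ultimately have "cyl 1 (\<lambda>e. e 0 = c)" unfolding cyl_def by simp
  then show ?thesis unfolding definable_term_def definable_pred_def by blast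
qed

lemma pred_ternary:
  assumes "A \<in> S 3" "A = {[x, y, F x y] | x y. True}"
  shows "definable_pred (\<lambda>e. F (e 0) (e 1) = e 2)"
proof -
  have "{xs. length xs = 3 \<and> F (xs ! 0) (xs ! 1) = xs ! 2} = A"
    unfolding assms(2) by (auto simp: numeral_eq_Suc length_Suc_conv)
  with assms(1) have "cyl 3 (\<lambda>e. F (e 0) (e 1) = e 2)" unfolding cyl_def by simp
  then show ?thesis unfolding definable_pred_def by blast
qed

lemma term_binary:
  assumes "definable_pred (\<lambda>e. F (e 0) (e 1) = e 2)" "definable_term g" "definable_term h"
  shows "definable_term (\<lambda>e. F (g e) (h e))"
  using pred_subst[OF assms(1), of "\<lambda>i. if i = 0 then \<lambda>e. g (\<lambda>i. e (Suc i)) else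
      if i = 1 then \<lambda>e. h (\<lambda>i. e (Suc i)) else (\<lambda>e. e 0)"]
    term_rename[OF assms(2), of Suc] term_rename[OF assms(3), of Suc] term_var[of 0]
  by (simp add: definable_term_def eq_commute)

lemma term_add: "definable_term g \<Longrightarrow> definable_term h \<Longrightarrow> definable_term (\<lambda>e. g e + h e)"
  using term_binary[OF pred_ternary[OF add_mult_in[THEN conjunct1] refl]] .

lemma term_mult: "definable_term g \<Longrightarrow> definable_term h \<Longrightarrow> definable_term (\<lambda>e. g e * h e)"
  using term_binary[OF pred_ternary[OF add_mult_in[THEN conjunct2, THEN conjunct1] refl]] .

lemma term_uminus: "definable_term g \<Longrightarrow> definable_term (\<lambda>e. - g e)"
  using term_mult[OF term_const[of "-1"], of g] by simp

lemma term_diff: "definable_term g \<Longrightarrow> definable_term h \<Longrightarrow> definable_term (\<lambda>e. g e - h e)"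
  using term_add[of g "\<lambda>e. - h e"] term_uminus[of h] by simp

text \<open>The order is recovered from the field operations: the nonnegative reals are the
  squares.\<close>

lemma pred_le: assumes "definable_term g" "definable_term h" shows "definable_pred (\<lambda>e. g e \<le> h e)"
proof -
  have "definable_pred (\<lambda>e. \<exists>z. h e = g e + z * z)"
    by (intro pred_ex pred_eq term_add term_mult term_var term_rename[of _ Suc] assms)
  moreover have "(\<exists>z. b = a + z * z) \<longleftrightarrow> a \<le> b" for a b :: real
  proof
    assume "a \<le> b"
    then have "b = a + sqrt (b - a) * sqrt (b - a)" by simp
    then show "\<exists>z. b = a + z * z" ..
  qed auto
  ultimately show ?thesis by simp
qed

lemma pred_less: "definable_term g \<Longrightarrow> definable_term h \<Longrightarrow> definable_pred (\<lambda>e. g e < h e)"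
  using pred_not[OF pred_le, of h g] by (simp add: not_le)

lemma term_if:
  assumes "definable_pred P" "definable_term g" "definable_term h" shows "definable_term (\<lambda>e. if P e then g e else h e)"
proof -
  have "definable_pred (\<lambda>e. (P (\<lambda>i. e (Suc i)) \<longrightarrow> e 0 = g (\<lambda>i. e (Suc i))) \<and>
      (\<not> P (\<lambda>i. e (Suc i)) \<longrightarrow> e 0 = h (\<lambda>i. e (Suc i))))"
    using assms unfolding definable_term_def by (intro pred_conj pred_imp pred_not pred_rename[of P Suc])
  then show ?thesis unfolding definable_term_def by (simp add: if_split)
qed

lemma term_abs: assumes "definable_term g" shows "definable_term (\<lambda>e. \<bar>g e\<bar>)"
  unfolding abs_if by (intro term_if pred_less term_uminus term_const assms)

lemma pred_all_finite: "finite A \<Longrightarrow> (\<And>a. a \<in> A \<Longrightarrow> definable_pred (P a)) \<Longrightarrow> definable_pred (\<lambda>e. \<forall>a\<in>A. P a e)"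
  by (induction A rule: finite_induct) (auto intro: pred_const pred_conj)

end

section \<open>Definability of vector quantifiers, and sets of reals\<close>

text \<open>Lays a vector out on the variables below \<open>CARD('n)\<close>. The enumeration is
  unrelated to the list \<open>idx\<close> of the theorem; \<open>definable_extension\<close>
  mediates between the two.\<close>

definition coord_index :: "'n::finite \<Rightarrow> nat" where
  "coord_index = (SOME f. bij_betw f UNIV {..<CARD('n)})"

lemma bij_coord_index: "bij_betw (coord_index :: 'n::finite \<Rightarrow> nat) UNIV {..<CARD('n)}"
proof -
  have "\<exists>f. bij_betw f (UNIV :: 'n set) {..<CARD('n)}"
    by (rule finite_same_card_bij) auto
  then show ?thesis unfolding coord_index_def by (rule someI_ex)
qed

lemma coord_index_less: "coord_index (j :: 'n::finite) < CARD('n)"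
  using bij_coord_index[where 'n = 'n] by (auto simp: bij_betw_def)

lemma inv_coord_index: "inv coord_index (coord_index j) = j"
  using bij_coord_index by (intro inv_f_f) (auto simp: bij_betw_def)

context o_minimal_structure
begin

lemma pred_ex_block: "definable_pred Q \<Longrightarrow> definable_pred (\<lambda>e. \<exists>z. Q (\<lambda>i. if i < n then z i else e (i - n)))"
proof (induction n arbitrary: Q)
  case (Suc n)
  have "case_nat (e 0) (\<lambda>i. e (Suc i)) = e" for e :: "nat \<Rightarrow> real"
    by (auto simp: fun_eq_iff split: nat.split)
  then have "definable_pred (\<lambda>e. \<exists>x. Q (case_nat x e))" by (intro pred_ex) (simp add: Suc.prems)
  from Suc.IH[OF this]
  have "definable_pred (\<lambda>e. \<exists>z x. Q (case_nat x (\<lambda>i. if i < n then z i else e (i - n))))" .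
  moreover have "(\<exists>z x. Q (case_nat x (\<lambda>i. if i < n then z i else e (i - n)))) \<longleftrightarrow>
      (\<exists>z. Q (\<lambda>i. if i < Suc n then z i else e (i - Suc n)))" for e
  proof -
    have eq: "case_nat x (\<lambda>i. if i < n then z i else e (i - n)) =
        (\<lambda>i. if i < Suc n then case_nat x z i else e (i - Suc n))" for x z
      by (auto simp: fun_eq_iff split: nat.split)
    have "\<exists>x y. z = case_nat x y" for z :: "nat \<Rightarrow> real"
      by (rule exI[of _ "z 0"], rule exI[of _ "\<lambda>i. z (Suc i)"])
        (auto simp: fun_eq_iff split: nat.split)
    then show ?thesis unfolding eq by metis
  qed
  ultimately show ?case by simp
qed simp

section \<open>Vectors as blocks of environment variables\<close>

definition definable_vec :: "((nat \<Rightarrow> real) \<Rightarrow> real^'n::finite) \<Rightarrow> bool" where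
  "definable_vec h \<longleftrightarrow> (\<forall>j. definable_term (\<lambda>e. h e $ j))"

lemma vec_lambda: "(\<And>j. definable_term (\<lambda>e. h e j)) \<Longrightarrow> definable_vec (\<lambda>e. \<chi> j. h e j)"
  unfolding definable_vec_def by simp

lemma term_nth: "definable_vec h \<Longrightarrow> definable_term (\<lambda>e. h e $ j)"
  unfolding definable_vec_def by simp

lemma vec_const: "definable_vec (\<lambda>e. c)"
  unfolding definable_vec_def by (simp add: term_const)

lemma vec_add: "definable_vec g \<Longrightarrow> definable_vec h \<Longrightarrow> definable_vec (\<lambda>e. g e + h e)"
  unfolding definable_vec_def by (simp add: term_add)

lemma vec_diff: "definable_vec g \<Longrightarrow> definable_vec h \<Longrightarrow> definable_vec (\<lambda>e. g e - h e)"
  unfolding definable_vec_def by (simp add: term_diff)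

lemma vec_scaleR: "definable_term g \<Longrightarrow> definable_vec h \<Longrightarrow> definable_vec (\<lambda>e. g e *\<^sub>R h e)"
  unfolding definable_vec_def by (simp add: term_mult)

text \<open>A vector quantifier binds \<open>CARD('n)\<close> variables at once, hence the shift of
  the outer variables by \<open>CARD('n)\<close>.\<close>

lemma pred_ex_vec:
  fixes P :: "(nat \<Rightarrow> real) \<Rightarrow> real^'n::finite \<Rightarrow> bool"
  assumes "definable_pred (\<lambda>e. P (\<lambda>i. e (i + CARD('n))) (\<chi> j. e (coord_index j)))"
  shows "definable_pred (\<lambda>e. \<exists>v. P e v)"
proof -
  have "(\<exists>z. P e (\<chi> j. z (coord_index j))) \<longleftrightarrow> (\<exists>v. P e v)" for e
  proof
    assume "\<exists>v. P e v"
    then obtain v where "P e v" ..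
    then show "\<exists>z. P e (\<chi> j. z (coord_index j))"
      by (intro exI[of _ "\<lambda>i. v $ inv coord_index i"]) (simp add: inv_coord_index)
  qed blast
  then show ?thesis using pred_ex_block[OF assms, of "CARD('n)"] by (simp add: coord_index_less)
qed

lemma pred_all_vec:
  fixes P :: "(nat \<Rightarrow> real) \<Rightarrow> real^'n::finite \<Rightarrow> bool"
  assumes "definable_pred (\<lambda>e. P (\<lambda>i. e (i + CARD('n))) (\<chi> j. e (coord_index j)))"
  shows "definable_pred (\<lambda>e. \<forall>v. P e v)"
  using pred_not[OF pred_ex_vec[of "\<lambda>e v. \<not> P e v"]] pred_not[OF assms] by simp

lemma pred_all_index: "(\<And>j. definable_pred (P j)) \<Longrightarrow> definable_pred (\<lambda>e. \<forall>j::'n::finite. P j e)"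
  using pred_all_finite[of "UNIV :: 'n set" P] by simp

definition definable_fun :: "(real^'n::finite \<Rightarrow> real) \<Rightarrow> bool" where
  "definable_fun F \<longleftrightarrow> definable_term (\<lambda>e. F (\<chi> j. e (coord_index j)))"

lemma term_app: assumes "definable_fun F" "definable_vec h" shows "definable_term (\<lambda>e. F (h e))"
  using term_subst[OF assms(1)[unfolded definable_fun_def], of "\<lambda>i e. h e $ inv coord_index i"] assms(2)
  by (simp add: definable_vec_def inv_coord_index)

definition definable_real_fun :: "(real \<Rightarrow> real) \<Rightarrow> bool" where
  "definable_real_fun u \<longleftrightarrow> definable_term (\<lambda>e. u (e 0))"

lemma term_app1: "definable_real_fun u \<Longrightarrow> definable_term h \<Longrightarrow> definable_term (\<lambda>e. u (h e))"
  unfolding definable_real_fun_def using term_subst[of "\<lambda>e. u (e 0)" "\<lambda>_. h"] by simp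

lemmas definable_intros = pred_not pred_conj pred_disj pred_imp pred_const pred_eq pred_le pred_less pred_ex pred_all
  pred_ex_vec pred_all_vec pred_all_index
  term_var term_const term_add term_diff term_mult term_uminus term_abs term_nth
  vec_lambda vec_const vec_add vec_diff vec_scaleR

section \<open>Definable sets of reals and their germs at 0\<close>

lemma infinite_interval:
  assumes "definable_pred (\<lambda>e. P (e 0))" "infinite {t. P t}"
  obtains a b where "a < b" "\<And>t. a < t \<Longrightarrow> t < b \<Longrightarrow> P t"
proof -
  obtain \<I> where I: "finite \<I>" "{t. P t} = \<Union>\<I>"
    "\<And>I. I \<in> \<I> \<Longrightarrow> (\<exists>a b. I = einterval a b) \<or> (\<exists>a. I = {a})"
    using pred_set[OF assms(1)] by metis
  have "\<exists>I\<in>\<I>. infinite I" using I(1,2) assms(2) by auto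
  then obtain I where I': "I \<in> \<I>" "infinite I" ..
  then obtain a b where "I = einterval a b" using I(3) by (metis finite.emptyI finite_insert)
  then have "open I" "I \<noteq> {}" using I' by (auto simp: open_einterval)
  then obtain x e where "x \<in> I" "e > 0" "ball x e \<subseteq> I" by (metis ex_in_conv open_contains_ball)
  moreover have "I \<subseteq> {t. P t}" using I(2) I'(1) by blast
  ultimately show ?thesis
    by (intro that[of x "x + e"]) (auto simp: subset_eq dist_real_def)
qed

text \<open>A zero-one law: each of the finitely many pieces of the set either contains or avoids a
  right neighbourhood of 0. Hence truth at arbitrarily small \<open>t\<close> already implies truth
  at all small \<open>t\<close>.\<close>

lemma germ:
  assumes "definable_pred (\<lambda>e. P (e 0))"
  shows "(\<forall>\<^sub>F t in at_right 0. P t) \<or> (\<forall>\<^sub>F t in at_right 0. \<not> P t)"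
proof -
  obtain \<I> where I: "finite \<I>" "{t. P t} = \<Union>\<I>"
    "\<And>I. I \<in> \<I> \<Longrightarrow> (\<exists>a b. I = einterval a b) \<or> (\<exists>a. I = {a})"
    using pred_set[OF assms] by metis
  have one: "(\<forall>\<^sub>F t in at_right 0. t \<in> I) \<or> (\<forall>\<^sub>F t in at_right 0. t \<notin> I)" if I_in: "I \<in> \<I>" for I
  proof -
    consider a b where "I = einterval a b" | a where "I = {a}" using I(3)[OF I_in] by blast
    then show ?thesis
    proof cases
      case 1
      have lim: "((\<lambda>t::real. ereal t) \<longlongrightarrow> ereal 0) (at_right 0)" by (intro tendsto_intros)
      have pos: "\<forall>\<^sub>F t::real in at_right 0. t > 0" by (simp add: eventually_at_right_less)
      have a: "(\<forall>\<^sub>F t::real in at_right 0. a < ereal t) \<or> (\<forall>\<^sub>F t::real in at_right 0. \<not> a < ereal t)"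
      proof (cases "a \<le> 0")
        case True
        from pos have "\<forall>\<^sub>F t::real in at_right 0. a < ereal t"
          by eventually_elim (use True in \<open>auto intro: le_less_trans simp: zero_ereal_def\<close>)
        then show ?thesis ..
      next
        case False
        then have "\<forall>\<^sub>F t::real in at_right 0. ereal t < a"
          using order_tendstoD(2)[OF lim, of a] by (simp add: zero_ereal_def)
        then have "\<forall>\<^sub>F t::real in at_right 0. \<not> a < ereal t" by eventually_elim auto
        then show ?thesis ..
      qed
      have b: "(\<forall>\<^sub>F t::real in at_right 0. ereal t < b) \<or> (\<forall>\<^sub>F t::real in at_right 0. \<not> ereal t < b)"
      proof (cases "b > 0")
        case True
        then show ?thesis
          using order_tendstoD(2)[OF lim, of b] by (simp add: zero_ereal_def)
      next
        case False
        from pos have "\<forall>\<^sub>F t::real in at_right 0. \<not> ereal t < b"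
          by eventually_elim (use False in \<open>auto simp: not_less zero_ereal_def intro: order_trans less_imp_le\<close>)
        then show ?thesis ..
      qed
      show ?thesis
      proof (cases "(\<forall>\<^sub>F t::real in at_right 0. a < ereal t) \<and> (\<forall>\<^sub>F t::real in at_right 0. ereal t < b)")
        case True
        then show ?thesis unfolding 1 einterval_def by (simp add: eventually_conj_iff)
      next
        case False
        with a b have "(\<forall>\<^sub>F t::real in at_right 0. \<not> a < ereal t) \<or> (\<forall>\<^sub>F t::real in at_right 0. \<not> ereal t < b)"
          by blast
        then have "\<forall>\<^sub>F t in at_right 0. t \<notin> I"
          unfolding 1 einterval_def by (elim disjE) (auto elim!: eventually_mono)
        then show ?thesis ..
      qed
    next
      case 2
      have "\<forall>\<^sub>F t in at_right 0. t \<noteq> a"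
        by (cases "a > 0") (auto simp: eventually_at_right_field intro: exI[of _ a] exI[of _ 1])
      then show ?thesis unfolding 2 by simp
    qed
  qed
  show ?thesis
  proof (cases "\<exists>I\<in>\<I>. \<forall>\<^sub>F t in at_right 0. t \<in> I")
    case True
    then show ?thesis using I(2) by (auto elim!: eventually_mono)
  next
    case False
    then have "\<forall>\<^sub>F t in at_right 0. \<forall>I\<in>\<I>. t \<notin> I"
      using one I(1) by (auto simp: eventually_ball_finite_distrib)
    moreover have "P t \<longleftrightarrow> t \<in> \<Union>\<I>" for t using I(2) by blast
    ultimately show ?thesis by simp
  qed
qed

text \<open>The set \<open>A n\<close> collects the points where the radius
  \<open>1 / (n + 1)\<close> works. Uncountability of the interval can replace category here,
  because an infinite definable set already contains an interval.\<close>

lemma uniform_germ: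
  assumes Q: "definable_pred (\<lambda>e. Q (e 0) (e (Suc 0)))" and "a < b"
    and ev: "\<And>t. a < t \<Longrightarrow> t < b \<Longrightarrow> \<forall>\<^sub>F \<sigma> in at_right 0. Q t \<sigma>"
  obtains c d r where "a \<le> c" "c < d" "d \<le> b" "r > 0"
    "\<And>t \<sigma>. c < t \<Longrightarrow> t < d \<Longrightarrow> 0 < \<sigma> \<Longrightarrow> \<sigma> < r \<Longrightarrow> Q t \<sigma>"
proof -
  define A where "A n t \<longleftrightarrow> a < t \<and> t < b \<and> (\<forall>\<sigma>. 0 < \<sigma> \<and> \<sigma> < 1 / real (Suc n) \<longrightarrow> Q t \<sigma>)" for n t
  have "{a<..<b} \<subseteq> (\<Union>n. {t. A n t})"
  proof
    fix t assume t: "t \<in> {a<..<b}"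
    then obtain r where r: "r > 0" "\<And>\<sigma>. 0 < \<sigma> \<Longrightarrow> \<sigma> < r \<Longrightarrow> Q t \<sigma>"
      using ev[of t] by (auto simp: eventually_at_right_field)
    obtain n where "inverse (real (Suc n)) < r" using reals_Archimedean[OF r(1)] by blast
    then have "A n t" using t r(2) by (auto simp: A_def inverse_eq_divide)
    then show "t \<in> (\<Union>n. {t. A n t})" by blast
  qed
  then have "\<not> countable (\<Union>n. {t. A n t})"
    using \<open>a < b\<close> countable_subset uncountable_open_interval by blast
  then obtain n where "infinite {t. A n t}"
    by (metis UNIV_I countable_UN countable_finite countableI_type)
  moreover have "definable_pred (\<lambda>e. Q (e (Suc 0)) (e 0))"
    using pred_rename[OF Q, of "\<lambda>i. if i = 0 then Suc 0 else 0"] by simp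
  then have "definable_pred (\<lambda>e. A n (e 0))"
    unfolding A_def by (intro definable_intros)
  ultimately obtain c d where cd: "c < d" "\<And>t. c < t \<Longrightarrow> t < d \<Longrightarrow> A n t"
    using infinite_interval[of "A n"] by metis
  have "a \<le> c"
  proof (rule ccontr)
    assume "\<not> a \<le> c"
    then have "A n ((c + min a d) / 2)" using cd by (intro cd(2)) auto
    then show False using \<open>\<not> a \<le> c\<close> by (auto simp: A_def min_def field_simps split: if_splits)
  qed
  moreover have "d \<le> b"
  proof (rule ccontr)
    assume "\<not> d \<le> b"
    then have "A n ((d + max b c) / 2)" using cd by (intro cd(2)) auto
    then show False using \<open>\<not> d \<le> b\<close> by (auto simp: A_def max_def field_simps split: if_splits)
  qed
  ultimately show ?thesis using cd by (intro that[of c d "1 / real (Suc n)"]) (auto simp: A_def)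
qed

end

section \<open>Monotonicity and definable selection\<close>

context o_minimal_structure
begin

section \<open>Monotonicity of definable functions of one variable\<close>

lemma real_fun_uminus: "definable_real_fun u \<Longrightarrow> definable_real_fun (\<lambda>t. - u t)"
  unfolding definable_real_fun_def by (rule term_uminus)

lemma mono_subinterval_if:
  assumes u: "definable_real_fun u" and inf: "infinite {t. a < t \<and> t < b \<and> (\<forall>\<^sub>F \<sigma> in at_right 0. u t \<le> u (t + \<sigma>))}"
  obtains c d where "a \<le> c" "c < d" "d \<le> b" "mono_on {c<..<d} u"
proof -
  have "definable_pred (\<lambda>e. a < e 0 \<and> e 0 < b \<and> (\<exists>r>0. \<forall>\<sigma>>0. \<sigma> < r \<longrightarrow> u (e 0) \<le> u (e 0 + \<sigma>)))"
    by (intro definable_intros term_app1[OF u])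
  moreover have "infinite {t. a < t \<and> t < b \<and> (\<exists>r>0. \<forall>\<sigma>>0. \<sigma> < r \<longrightarrow> u t \<le> u (t + \<sigma>))}"
    using inf by (simp add: eventually_at_right_field)
  ultimately obtain c d where cd: "c < d"
    "\<And>t. c < t \<Longrightarrow> t < d \<Longrightarrow> a < t \<and> t < b \<and> (\<exists>r>0. \<forall>\<sigma>>0. \<sigma> < r \<longrightarrow> u t \<le> u (t + \<sigma>))"
    by (rule infinite_interval) blast
  have "a \<le> c" using cd(2) by (intro dense_ge_bounded[OF cd(1)]) (simp add: less_imp_le)
  moreover have "d \<le> b" using cd(2) by (intro dense_le_bounded[OF cd(1)]) (simp add: less_imp_le)
  ultimately have ac: "a \<le> c" "d \<le> b" by simp_all
  have "definable_pred (\<lambda>e. u (e 0) \<le> u (e 0 + e (Suc 0)))"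
    by (intro definable_intros term_app1[OF u])
  then obtain c' d' r where r: "c \<le> c'" "c' < d'" "d' \<le> d" "r > 0"
    "\<And>t \<sigma>. c' < t \<Longrightarrow> t < d' \<Longrightarrow> 0 < \<sigma> \<Longrightarrow> \<sigma> < r \<Longrightarrow> u t \<le> u (t + \<sigma>)"
    using cd(2) by (elim uniform_germ[OF _ cd(1)]) (auto simp: eventually_at_right_field)
  \<comment> \<open>On an interval of length at most \<open>r\<close> the uniform radius compares
    any two points directly.\<close>
  have "mono_on {c'<..<min d' (c' + r)} u"
  proof (intro mono_onI)
    fix s t assume "s \<in> {c'<..<min d' (c' + r)}" "t \<in> {c'<..<min d' (c' + r)}" "s \<le> t"
    then show "u s \<le> u t" using r(5)[of s "t - s"] by (cases "s = t") auto
  qed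
  then show ?thesis using r ac by (intro that[of c' "min d' (c' + r)"]) auto
qed

text \<open>By \<open>germ\<close>, at every \<open>t\<close> either \<open>u\<close> or
  \<open>- u\<close> does not drop immediately to the right. One of the two alternatives holds at
  infinitely many points, and \<open>mono_subinterval_if\<close> applies to it.\<close>

lemma monotone_subinterval:
  assumes u: "definable_real_fun u" and "a < b"
  obtains c d where "a \<le> c" "c < d" "d \<le> b"
    "mono_on {c<..<d} u \<or> mono_on {c<..<d} (\<lambda>t. - u t)"
proof (cases "infinite {t. a < t \<and> t < b \<and> (\<forall>\<^sub>F \<sigma> in at_right 0. u t \<le> u (t + \<sigma>))}")
  case True
  from mono_subinterval_if[OF u True] show ?thesis by (metis that)
next
  case False
  have "(\<forall>\<^sub>F \<sigma> in at_right 0. u t \<le> u (t + \<sigma>)) \<or> (\<forall>\<^sub>F \<sigma> in at_right 0. - u t \<le> - u (t + \<sigma>))" for t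
  proof -
    have "(\<forall>\<^sub>F \<sigma> in at_right 0. u t \<le> u (t + \<sigma>)) \<or> (\<forall>\<^sub>F \<sigma> in at_right 0. \<not> u t \<le> u (t + \<sigma>))"
      by (rule germ) (intro definable_intros term_app1[OF u])
    then show ?thesis by (rule disj_forward) (auto elim: eventually_mono)
  qed
  then have "{a<..<b} \<subseteq> {t. a < t \<and> t < b \<and> (\<forall>\<^sub>F \<sigma> in at_right 0. u t \<le> u (t + \<sigma>))} \<union>
      {t. a < t \<and> t < b \<and> (\<forall>\<^sub>F \<sigma> in at_right 0. - u t \<le> - u (t + \<sigma>))}" by auto
  then have "infinite {t. a < t \<and> t < b \<and> (\<forall>\<^sub>F \<sigma> in at_right 0. - u t \<le> - u (t + \<sigma>))}"
    using False infinite_Ioo[OF \<open>a < b\<close>] finite_subset by blast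
  from mono_subinterval_if[OF real_fun_uminus[OF u] this] show ?thesis by (metis that)
qed

text \<open>The hypothesis compares only points on opposite sides of \<open>t\<close> (or
  \<open>t\<close> itself), which is what the bisection principle \<open>Bolzano\<close> needs and
  is also expressible by a formula.\<close>

lemma mono_on_if_locally:
  fixes u :: "real \<Rightarrow> real"
  assumes "\<And>t. a < t \<Longrightarrow> t < b \<Longrightarrow> \<exists>e>0. \<forall>s r. t - e < s \<and> s \<le> t \<and> t \<le> r \<and> r < t + e \<longrightarrow> u s \<le> u r"
  shows "mono_on {a<..<b} u"
proof (intro mono_onI)
  fix s t assume st: "s \<in> {a<..<b}" "t \<in> {a<..<b}" "s \<le> t"
  show "u s \<le> u t" using \<open>s \<le> t\<close>
  proof (induction rule: Bolzano)
    case (local x)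
    then obtain e where "e > 0" "\<forall>s r. x - e < s \<and> s \<le> x \<and> x \<le> r \<and> r < x + e \<longrightarrow> u s \<le> u r"
      using assms[of x] st by auto
    then show ?case by (intro exI[of _ e]) auto
  qed auto
qed

text \<open>\<open>monotone_subinterval\<close> yields intervals inside every \<open>(0, a)\<close>
  but none that reaches 0. Being locally monotone at \<open>t\<close> is definable, so it holds for
  all small \<open>t\<close> or for none; the second alternative for both \<open>u\<close> and
  \<open>- u\<close> contradicts the existence of those intervals.\<close>

lemma monotone_germ:
  assumes u: "definable_real_fun u"
  obtains a where "a > 0" "mono_on {0<..<a} u \<or> mono_on {0<..<a} (\<lambda>t. - u t)"
proof -
  define inc where "inc v t \<longleftrightarrow> (\<exists>e>0. \<forall>s r. t - e < s \<and> s \<le> t \<and> t \<le> r \<and> r < t + e \<longrightarrow> v s \<le> v r)"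
    for v :: "real \<Rightarrow> real" and t
  have inc_definable: "definable_pred (\<lambda>e. inc v (e 0))" if "definable_real_fun v" for v
    unfolding inc_def by (intro definable_intros term_app1[OF that])
  have *: "\<exists>a>0. mono_on {0<..<a} v" if ev: "\<forall>\<^sub>F t in at_right 0. inc v t" for v
  proof -
    obtain a where a: "a > 0" "\<And>t. 0 < t \<Longrightarrow> t < a \<Longrightarrow> inc v t"
      using ev by (auto simp: eventually_at_right_field)
    then have "mono_on {0<..<a} v" by (intro mono_on_if_locally) (auto simp: inc_def)
    with a show ?thesis by blast
  qed
  have "(\<forall>\<^sub>F t in at_right 0. inc u t) \<or> (\<forall>\<^sub>F t in at_right 0. inc (\<lambda>t. - u t) t)"
  proof (rule ccontr)
    assume "\<not> ?thesis"
    then have "\<forall>\<^sub>F t in at_right 0. \<not> inc u t \<and> \<not> inc (\<lambda>t. - u t) t"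
      using germ[OF inc_definable[OF u]] germ[OF inc_definable[OF real_fun_uminus[OF u]]] by (auto intro: eventually_conj)
    then obtain a where a: "a > 0" "\<And>t. 0 < t \<Longrightarrow> t < a \<Longrightarrow> \<not> inc u t \<and> \<not> inc (\<lambda>t. - u t) t"
      by (auto simp: eventually_at_right_field)
    obtain c d where cd: "0 \<le> c" "c < d" "d \<le> a"
      "mono_on {c<..<d} u \<or> mono_on {c<..<d} (\<lambda>t. - u t)"
      using monotone_subinterval[OF u a(1)] by metis
    have "inc v ((c + d) / 2)" if "mono_on {c<..<d} v" for v
      unfolding inc_def
    proof (intro exI[of _ "(d - c) / 2"] conjI allI impI)
      fix s r
      assume "(c + d) / 2 - (d - c) / 2 < s \<and> s \<le> (c + d) / 2 \<and> (c + d) / 2 \<le> r \<and> r < (c + d) / 2 + (d - c) / 2"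
      then have "c < s" "s \<le> r" "r < d" by (auto simp: field_simps)
      then show "v s \<le> v r" by (intro mono_onD[OF that]) auto
    qed (use cd in auto)
    with a(2)[of "(c + d) / 2"] cd show False by auto
  qed
  then show thesis using *[of u] *[of "\<lambda>t. - u t"] that by blast
qed

section \<open>Definable choice\<close>

text \<open>The selected element of a bounded definable set of reals is its minimum if there is one, and
  otherwise the midpoint \<open>x\<close> of the first of its maximal open intervals \<open>{a<..<s}\<close>.\<close>

definition selected :: "(real \<Rightarrow> bool) \<Rightarrow> real \<Rightarrow> bool" where
  "selected B x \<longleftrightarrow> (B x \<and> (\<forall>z. B z \<longrightarrow> x \<le> z)) \<or>
     (\<not> (\<exists>m. B m \<and> (\<forall>z. B z \<longrightarrow> m \<le> z)) \<and>
      (\<exists>a s. x + x = a + s \<and> a < s \<and> (\<forall>z. B z \<longrightarrow> a < z) \<and> (\<forall>z. a < z \<and> z < s \<longrightarrow> B z) \<and>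
         (\<forall>r>s. \<exists>z>a. z < r \<and> \<not> B z)))"

lemma selected_unique:
  assumes "selected B x" "selected B y" shows "x = y"
proof (cases "\<exists>m. B m \<and> (\<forall>z. B z \<longrightarrow> m \<le> z)")
  case True
  then show ?thesis using assms unfolding selected_def by (meson antisym)
next
  case False
  from assms(1) False obtain a s where a: "x + x = a + s" "a < s" "\<forall>z. B z \<longrightarrow> a < z"
    "\<forall>z. a < z \<and> z < s \<longrightarrow> B z" "\<forall>r>s. \<exists>z>a. z < r \<and> \<not> B z" unfolding selected_def by blast
  from assms(2) False obtain a' s' where a': "y + y = a' + s'" "a' < s'" "\<forall>z. B z \<longrightarrow> a' < z"
    "\<forall>z. a' < z \<and> z < s' \<longrightarrow> B z" "\<forall>r>s'. \<exists>z>a'. z < r \<and> \<not> B z" unfolding selected_def by blast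
  have "\<not> a < a'"
  proof
    assume "a < a'"
    then obtain z where "a < z" "z < min a' s" using dense[of a "min a' s"] a(2) by auto
    then show False using a(4) a'(3) by force
  qed
  moreover have "\<not> a' < a"
  proof
    assume "a' < a"
    then obtain z where "a' < z" "z < min a s'" using dense[of a' "min a s'"] a'(2) by auto
    then show False using a'(4) a(3) by force
  qed
  ultimately have "a = a'" by simp
  moreover have "\<not> s < s'" using a(5) a'(4) \<open>a = a'\<close> by metis
  moreover have "\<not> s' < s" using a'(5) a(4) \<open>a = a'\<close> by metis
  ultimately show ?thesis using a(1) a'(1) by simp
qed

lemma selected_exists:
  assumes B: "definable_pred (\<lambda>e. B (e 0))" and "B b" and bound: "\<And>z. B z \<Longrightarrow> \<bar>z\<bar> \<le> K"
  shows "\<exists>x. B x \<and> selected B x"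
proof (cases "\<exists>m. B m \<and> (\<forall>z. B z \<longrightarrow> m \<le> z)")
  case True
  then show ?thesis unfolding selected_def by blast
next
  case False
  define a where "a = Inf {z. B z}"
  have bdd: "bdd_below {z. B z}" using bound by (intro bdd_belowI[of _ "-K"]) force
  have "a \<le> z" if "B z" for z unfolding a_def using that bdd by (intro cInf_lower) auto
  then have a_less: "a < z" if "B z" for z using False that by (metis order_le_less)
  have near: "\<exists>z<r. B z" if "a < r" for r
    using that \<open>B b\<close> cInf_less_iff[of "{z. B z}" r] bdd unfolding a_def by auto
  have "definable_pred (\<lambda>e. B (a + e 0))" using pred_subst[OF B, of "\<lambda>_ e. a + e 0"] by (simp add: term_add term_const term_var)
  \<comment> \<open>The set \<open>B\<close> meets every interval above its infimum
    \<open>a\<close>, which it does not attain; so \<open>B\<close> cannot fail throughout a right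
    neighbourhood of \<open>a\<close>, and by \<open>germ\<close> it holds throughout one.\<close>
  then have "\<forall>\<^sub>F \<sigma> in at_right 0. B (a + \<sigma>)"
  proof (rule disjE[OF germ])
    assume "\<forall>\<^sub>F \<sigma> in at_right 0. \<not> B (a + \<sigma>)"
    then obtain r where r: "r > 0" "\<And>\<sigma>. 0 < \<sigma> \<Longrightarrow> \<sigma> < r \<Longrightarrow> \<not> B (a + \<sigma>)"
      by (auto simp: eventually_at_right_field)
    obtain z where "z < a + r" "B z" using near[of "a + r"] r by auto
    then show ?thesis using r(2)[of "z - a"] a_less[of z] by auto
  qed
  then obtain r where r: "r > 0" "\<And>\<sigma>. 0 < \<sigma> \<Longrightarrow> \<sigma> < r \<Longrightarrow> B (a + \<sigma>)"
    by (auto simp: eventually_at_right_field)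
  define T where "T = {s. a < s \<and> (\<forall>z. a < z \<and> z < s \<longrightarrow> B z)}"
  have "a + r \<in> T" 
  proof -
    have "B z" if "a < z" "z < a + r" for z using r(2)[of "z - a"] that by simp
    then show ?thesis using r(1) by (simp add: T_def)
  qed
  have "s \<le> K" if "s \<in> T" for s
    using that bound unfolding T_def by (intro dense_le_bounded[of a s]) force+
  then have bddT: "bdd_above T" by (intro bdd_aboveI)
  define s where "s = Sup T"
  have "a + r \<le> s" unfolding s_def using \<open>a + r \<in> T\<close> bddT by (rule cSup_upper)
  then have "a < s" using r by simp
  have full: "B z" if "a < z" "z < s" for z
    using that(2) \<open>a + r \<in> T\<close> less_cSup_iff[of T z] bddT that(1) unfolding s_def T_def by blast
  have "\<exists>z>a. z < q \<and> \<not> B z" if "q > s" for q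
  proof (rule ccontr)
    assume "\<not> ?thesis"
    then have "q \<in> T" using that \<open>a < s\<close> unfolding T_def by auto
    then show False using cSup_upper[OF _ bddT, of q] that unfolding s_def by simp
  qed
  then have "selected B ((a + s) / 2)"
    unfolding selected_def using False a_less full \<open>a < s\<close>
    by (intro disjI2 conjI exI[of _ a] exI[of _ s]) auto
  moreover have "B ((a + s) / 2)" using full \<open>a < s\<close> by simp
  ultimately show ?thesis by blast
qed

text \<open>The graph of the choice function is written with the formula \<open>selected\<close>,
  hence is definable; 0 is the default value over empty fibres. The bound guarantees the infimum and
  supremum behind \<open>selected_exists\<close>.\<close>

lemma selection_1:
  assumes Q: "definable_pred (\<lambda>e. Q (\<lambda>i. e (Suc i)) (e 0))" and bound: "\<And>e x. Q e x \<Longrightarrow> \<bar>x\<bar> \<le> K"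
  shows "\<exists>h. definable_term h \<and> (\<forall>e x. Q e x \<longrightarrow> Q e (h e))"
proof -
  define h where "h e = (if \<exists>x. Q e x then THE x. selected (Q e) x else 0)" for e
  have sel: "Q e (h e) \<and> selected (Q e) (h e)" if "Q e x" for e x
  proof -
    \<comment> \<open>For fixed \<open>e\<close> the fibre is definable with the values of
      \<open>e\<close> as parameters.\<close>
    have "definable_term (\<lambda>e'. (case_nat (e' 0) e) i)" for i by (cases i) (auto intro: term_var term_const)
    from pred_subst[OF Q, of "\<lambda>i e'. (case_nat (e' 0) e) i", OF this]
    have "definable_pred (\<lambda>e'. Q e (e' 0))" by simp
    then have "\<exists>y. Q e y \<and> selected (Q e) y" using that bound by (rule selected_exists)
    then obtain y where y: "Q e y" "selected (Q e) y" by (elim exE conjE)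
    then have "(THE x. selected (Q e) x) = y" by (intro the_equality) (auto intro: selected_unique)
    with y show ?thesis by (auto simp: h_def)
  qed
  have Q': "definable_pred (\<lambda>e. Q (\<lambda>i. f i e) (g e))" if "\<And>i. definable_term (f i)" "definable_term g" for f g
  proof -
    have "definable_term (\<lambda>e. case i of 0 \<Rightarrow> g e | Suc j \<Rightarrow> f j e)" for i by (cases i) (auto intro: that)
    from pred_subst[OF Q, of "\<lambda>i e. case i of 0 \<Rightarrow> g e | Suc j \<Rightarrow> f j e", OF this]
    show ?thesis by simp
  qed
  have "definable_pred (\<lambda>e. (selected (Q (\<lambda>i. e (Suc i))) (e 0) \<and> (\<exists>x. Q (\<lambda>i. e (Suc i)) x)) \<or>
    (\<not> (\<exists>x. Q (\<lambda>i. e (Suc i)) x) \<and> e 0 = 0))"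
    unfolding selected_def
    by (intro definable_intros Q')
  moreover have "e 0 = h (\<lambda>i. e (Suc i)) \<longleftrightarrow>
      (selected (Q (\<lambda>i. e (Suc i))) (e 0) \<and> (\<exists>x. Q (\<lambda>i. e (Suc i)) x)) \<or>
      (\<not> (\<exists>x. Q (\<lambda>i. e (Suc i)) x) \<and> e 0 = 0)" for e
    using sel selected_unique by (metis h_def)
  ultimately have "definable_term h" unfolding definable_term_def by simp
  then show ?thesis using sel by blast
qed

text \<open>The coordinates after the first are selected from the projection along slot 0; slot 0 is
  then selected in the fibre over these choices.\<close>

lemma selection_block:
  assumes "definable_pred Q" "\<And>e i. Q e \<Longrightarrow> i < m \<Longrightarrow> \<bar>e i\<bar> \<le> K"
  shows "\<exists>h. (\<forall>i<m. definable_term (h i)) \<and>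
    (\<forall>e z. Q (\<lambda>i. if i < m then z i else e (i - m)) \<longrightarrow> Q (\<lambda>i. if i < m then h i e else e (i - m)))"
  using assms
proof (induction m arbitrary: Q)
  case (Suc m)
  have eta: "case_nat (e 0) (\<lambda>i. e (Suc i)) = e" for e :: "nat \<Rightarrow> real"
    by (auto simp: fun_eq_iff split: nat.split)
  have block: "(\<lambda>i. if i < Suc m then z i else e (i - Suc m)) =
      case_nat (z 0) (\<lambda>i. if i < m then z (Suc i) else e (i - m))" for z and e :: "nat \<Rightarrow> real"
    by (auto simp: fun_eq_iff split: nat.split)
  have "definable_pred (\<lambda>e. \<exists>x. Q (case_nat x e))" by (intro pred_ex) (simp add: eta Suc.prems)
  moreover have "\<bar>e i\<bar> \<le> K" if "\<exists>x. Q (case_nat x e)" "i < m" for e i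
    using that Suc.prems(2)[of "case_nat _ e" "Suc i"] by auto
  ultimately obtain h where h: "\<And>i. i < m \<Longrightarrow> definable_term (h i)"
    "\<And>e z. \<exists>x. Q (case_nat x (\<lambda>i. if i < m then z i else e (i - m))) \<Longrightarrow>
      \<exists>x. Q (case_nat x (\<lambda>i. if i < m then h i e else e (i - m)))"
    using Suc.IH[of "\<lambda>e. \<exists>x. Q (case_nat x e)"] by blast
  define Q' where "Q' e x \<longleftrightarrow> Q (case_nat x (\<lambda>i. if i < m then h i e else e (i - m)))" for e x
  have "definable_pred (\<lambda>e. Q' (\<lambda>i. e (Suc i)) (e 0))"
  proof -
    have "definable_term (\<lambda>e. case i of 0 \<Rightarrow> e 0 | Suc j \<Rightarrow>
        if j < m then h j (\<lambda>i. e (Suc i)) else e (Suc (j - m)))" for i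
      by (cases i; cases "i - 1 < m") (auto intro: term_var term_rename h(1))
    from pred_subst[OF Suc.prems(1), of "\<lambda>i e. case i of 0 \<Rightarrow> e 0 | Suc j \<Rightarrow>
        if j < m then h j (\<lambda>i. e (Suc i)) else e (Suc (j - m))", OF this]
    show ?thesis by (simp add: Q'_def)
  qed
  moreover have "\<bar>x\<bar> \<le> K" if "Q' e x" for e x
    using that Suc.prems(2)[of "case_nat x _" 0] by (auto simp: Q'_def)
  ultimately have "\<exists>h. definable_term h \<and> (\<forall>e x. Q' e x \<longrightarrow> Q' e (h e))" by (rule selection_1)
  then obtain h0 where h0: "definable_term h0" "\<And>e x. Q' e x \<Longrightarrow> Q' e (h0 e)" by blast
  define H where "H = case_nat h0 h"
  have "definable_term (H i)" if "i < Suc m" for i using that h0 h by (cases i) (auto simp: H_def)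
  moreover have "Q (\<lambda>i. if i < Suc m then H i e else e (i - Suc m))"
    if "Q (\<lambda>i. if i < Suc m then z i else e (i - Suc m))" for e z
  proof -
    have "\<exists>x. Q' e x" unfolding Q'_def using that h(2)[of "\<lambda>i. z (Suc i)" e] unfolding block by blast
    then have "Q' e (h0 e)" using h0 by blast
    then show ?thesis unfolding block[of "\<lambda>i. H i e" e] by (simp add: Q'_def H_def cong: if_cong)
  qed
  ultimately show ?case by blast
qed simp

lemma selection:
  fixes R :: "real \<Rightarrow> real^'n::finite \<Rightarrow> bool"
  assumes R: "definable_pred (\<lambda>e. R (e CARD('n)) (\<chi> j. e (coord_index j)))"
    and bound: "\<And>t v j. R t v \<Longrightarrow> \<bar>v $ j\<bar> \<le> K"
  shows "\<exists>y. (\<forall>j. definable_real_fun (\<lambda>t. y t $ j)) \<and> (\<forall>t v. R t v \<longrightarrow> R t (y t))"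
proof -
  have "\<bar>e i\<bar> \<le> K" if "R (e CARD('n)) (\<chi> j. e (coord_index j))" and i: "i < CARD('n)" for e i
  proof -
    obtain j :: 'n where "i = coord_index j" using i bij_coord_index[where 'n = 'n] by (auto simp: bij_betw_def)
    then show ?thesis using bound[OF that(1), of j] by simp
  qed
  then have "\<exists>h. (\<forall>i<CARD('n). definable_term (h i)) \<and>
      (\<forall>e z. R (e 0) (\<chi> j::'n. z (coord_index j)) \<longrightarrow> R (e 0) (\<chi> j::'n. h (coord_index j) e))"
    using selection_block[OF R, of "CARD('n)" K] by (simp add: coord_index_less)
  then obtain h where h: "\<And>i. i < CARD('n) \<Longrightarrow> definable_term (h i)"
    "\<And>e z. R (e 0) (\<chi> j::'n. z (coord_index j)) \<Longrightarrow> R (e 0) (\<chi> j::'n. h (coord_index j) e)"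
    by blast
  \<comment> \<open>The selected terms may depend on the whole environment, although
    \<open>R\<close> sees only its variable 0. Evaluating them at a constant environment makes them
    functions of \<open>t\<close> alone.\<close>
  define y where "y t = (\<chi> j::'n. h (coord_index j) (\<lambda>_. t))" for t
  have "definable_real_fun (\<lambda>t. y t $ j)" for j
    unfolding definable_real_fun_def y_def using term_rename[OF h(1)[OF coord_index_less], of j "\<lambda>_. 0"] by simp
  moreover have "R t (y t)" if "R t v" for t v
    using h(2)[of "\<lambda>_. t" "\<lambda>i. v $ inv coord_index i"] that by (simp add: inv_coord_index y_def)
  ultimately show ?thesis by blast
qed

end

section \<open>Semismoothness\<close>

text \<open>Take the last time at which \<open>p\<close> is at most \<open>p 0\<close>. This turns
  one steep chord into a base point from which all short chords are steep.\<close>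

lemma ascent_point:
  fixes p :: "real \<Rightarrow> real"
  assumes "continuous_on {0..s} p" "p 0 < p s" "0 < s"
  shows "\<exists>\<tau>\<ge>0. \<tau> < s \<and> (\<forall>\<sigma>. 0 < \<sigma> \<and> \<sigma> < s - \<tau> \<longrightarrow> p \<tau> < p (\<tau> + \<sigma>))"
proof -
  define T where "T = {\<tau> \<in> {0..s}. p \<tau> \<le> p 0}"
  have "closed T" unfolding T_def
    using assms(1) by (intro continuous_on_closed_Collect_le) auto
  then have "compact T"
    by (auto simp: compact_eq_bounded_closed T_def intro: bounded_subset[OF bounded_closed_interval])
  moreover have "0 \<in> T" using assms by (simp add: T_def)
  ultimately obtain \<tau> where \<tau>: "\<tau> \<in> T" "\<And>t. t \<in> T \<Longrightarrow> t \<le> \<tau>"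
    using compact_attains_sup[of T] by blast
  have "\<tau> < s" using \<tau>(1) assms(2) by (cases "\<tau> = s") (auto simp: T_def)
  moreover have "p \<tau> < p (\<tau> + \<sigma>)" if "0 < \<sigma>" "\<sigma> < s - \<tau>" for \<sigma>
  proof -
    have "\<not> p (\<tau> + \<sigma>) \<le> p 0" using \<tau>(2)[of "\<tau> + \<sigma>"] \<tau>(1) that by (auto simp: T_def)
    then show ?thesis using \<tau>(1) by (simp add: T_def)
  qed
  ultimately show ?thesis using \<tau>(1) by (intro exI[of _ \<tau>]) (simp add: T_def)
qed

context o_minimal_structure
begin

text \<open>The function \<open>\<kappa> * t - w t\<close> is monotone near 0. It lies between
  \<open>(\<kappa> - \<delta>) * t\<close> and \<open>(\<kappa> + \<delta>) * t\<close>, so it is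
  positive and tends to 0, and therefore cannot be decreasing.\<close>

lemma germ_increment_le:
  assumes w: "definable_real_fun w" and small: "\<forall>\<^sub>F t in at_right 0. \<bar>w t\<bar> \<le> \<delta> * t" and "\<delta> < \<kappa>"
  shows "\<exists>a>0. \<forall>s t. 0 < s \<and> s \<le> t \<and> t < a \<longrightarrow> w t - w s \<le> \<kappa> * (t - s)"
proof -
  obtain b where b: "b > 0" "\<And>t. 0 < t \<Longrightarrow> t < b \<Longrightarrow> \<bar>w t\<bar> \<le> \<delta> * t"
    using small by (auto simp: eventually_at_right_field)
  have "0 \<le> \<delta> * (b / 2)" using b(2)[of "b / 2"] b(1) by simp
  then have "\<delta> \<ge> 0" using b(1) by (simp add: zero_le_mult_iff)
  have "definable_real_fun (\<lambda>t. \<kappa> * t - w t)"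
    unfolding definable_real_fun_def by (intro definable_intros term_app1[OF w])
  then obtain a where a: "a > 0"
    "mono_on {0<..<a} (\<lambda>t. \<kappa> * t - w t) \<or> mono_on {0<..<a} (\<lambda>t. - (\<kappa> * t - w t))"
    by (rule monotone_germ)
  have "\<not> mono_on {0<..<a} (\<lambda>t. - (\<kappa> * t - w t))"
  proof
    assume m: "mono_on {0<..<a} (\<lambda>t. - (\<kappa> * t - w t))"
    define t where "t = min a b / 2"
    \<comment> \<open>Chosen so that the upper bound \<open>(\<kappa> + \<delta>) * s\<close> is at
      most half of the lower bound \<open>(\<kappa> - \<delta>) * t\<close>.\<close>
    define s where "s = t * min (1 / 2) ((\<kappa> - \<delta>) / (2 * (\<kappa> + \<delta>)))"
    have t: "0 < t" "t < a" "t < b" using a b by (auto simp: t_def)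
    have s: "0 < s" "s < t"
      using t \<open>\<delta> < \<kappa>\<close> \<open>\<delta> \<ge> 0\<close> by (auto simp: s_def min_def field_simps)
    have "s \<le> t * ((\<kappa> - \<delta>) / (2 * (\<kappa> + \<delta>)))"
      unfolding s_def using t by (intro mult_left_mono) auto
    then have "(\<kappa> + \<delta>) * s \<le> (\<kappa> - \<delta>) * t / 2"
      using \<open>\<delta> < \<kappa>\<close> \<open>\<delta> \<ge> 0\<close> by (simp add: field_simps)
    moreover have "(\<kappa> - \<delta>) * t > 0" using t \<open>\<delta> < \<kappa>\<close> by simp
    moreover have "- (\<kappa> * s - w s) \<le> - (\<kappa> * t - w t)"
      by (rule mono_onD[OF m]) (use s t in auto)
    moreover have "\<bar>w s\<bar> \<le> \<delta> * s" "\<bar>w t\<bar> \<le> \<delta> * t" using s t by (auto intro: b(2))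
    ultimately show False by (simp add: algebra_simps abs_le_iff)
  qed
  then have m: "mono_on {0<..<a} (\<lambda>t. \<kappa> * t - w t)" using a(2) by blast
  have "w t - w s \<le> \<kappa> * (t - s)" if "0 < s" "s \<le> t" "t < a" for s t
    using mono_onD[OF m, of s t] that by (simp add: algebra_simps)
  with a(1) show ?thesis by blast
qed

lemma germ_lipschitz:
  assumes w: "definable_real_fun w" and small: "\<forall>\<^sub>F t in at_right 0. \<bar>w t\<bar> \<le> \<delta> * t" and "\<delta> < \<kappa>"
  shows "\<exists>a>0. \<forall>s t. 0 < s \<and> s \<le> t \<and> t < a \<longrightarrow> \<bar>w t - w s\<bar> \<le> \<kappa> * (t - s)"
proof -
  obtain a where a: "a > 0" "\<forall>s t. 0 < s \<and> s \<le> t \<and> t < a \<longrightarrow> w t - w s \<le> \<kappa> * (t - s)"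
    using germ_increment_le[OF assms] by blast
  obtain b where b: "b > 0" "\<forall>s t. 0 < s \<and> s \<le> t \<and> t < b \<longrightarrow> - w t - - w s \<le> \<kappa> * (t - s)"
    using germ_increment_le[of "\<lambda>t. - w t", OF real_fun_uminus[OF w], of \<delta> \<kappa>] small \<open>\<delta> < \<kappa>\<close> by auto
  have "\<bar>w t - w s\<bar> \<le> \<kappa> * (t - s)" if "0 < s \<and> s \<le> t \<and> t < min a b" for s t
    using a(2)[rule_format, of s t] b(2)[rule_format, of s t] that by (simp add: abs_le_iff)
  with a(1) b(1) show ?thesis by (intro exI[of _ "min a b"]) auto
qed

text \<open>The segments on which \<open>F\<close> is steep are replaced by a definable curve \<open>y\<close>, whose deviation
  from the half-line has a small Lipschitz constant near \<open>0\<close> by monotonicity.\<close>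

lemma semismooth:
  fixes F :: "real^'n::finite \<Rightarrow> real"
  assumes F: "definable_fun F" and lip: "L-lipschitz_on UNIV F"
    and steep: "\<And>\<delta>. \<delta> > 0 \<Longrightarrow> \<exists>t y s. 0 < t \<and> t < \<delta> \<and> norm (y - x - t *\<^sub>R d) \<le> \<delta> * t \<and>
      0 < s \<and> s \<le> \<delta> * t \<and> A * s \<le> F (y + s *\<^sub>R d) - F y"
    and "\<eta> > 0"
  shows "\<forall>\<^sub>F t in at_right 0. (A - \<eta>) * t \<le> F (x + t *\<^sub>R d) - F x"
proof -
  have L: "L \<ge> 0" using lip by (rule lipschitz_on_nonneg)
  have F_diff: "\<bar>F u - F v\<bar> \<le> L * norm (u - v)" for u v
    using lipschitz_onD[OF lip, of u v] by (simp add: dist_norm)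
  define n where "n = real CARD('n)"
  \<comment> \<open>A componentwise bound \<open>\<delta> * t\<close> costs
    \<open>n * \<delta> * t\<close> in norm and \<open>n * L * \<delta> * t\<close> in values of
    \<open>F\<close>; the latter is at most \<open>\<eta> / 8 * t\<close>.\<close>
  define \<delta> where "\<delta> = \<eta> / (8 * (n * L + 1))"
  have "n * L \<ge> 0" using L by (simp add: n_def)
  then have "\<delta> > 0" using \<open>\<eta> > 0\<close> by (simp add: \<delta>_def add_nonneg_pos)
  have nL\<delta>: "n * L * \<delta> \<le> \<eta> / 8"
    using \<open>n * L \<ge> 0\<close> \<open>\<eta> > 0\<close> by (simp add: \<delta>_def field_simps add_nonneg_pos)
  have norm_le: "norm v \<le> n * b" if "\<And>j. \<bar>v $ j\<bar> \<le> b" for v :: "real^'n" and b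
  proof -
    have "norm v \<le> (\<Sum>j\<in>UNIV. \<bar>v $ j\<bar>)" by (rule norm_le_l1_cart)
    also have "\<dots> \<le> (\<Sum>j\<in>(UNIV :: 'n set). b)" by (intro sum_mono that)
    finally show ?thesis by (simp add: n_def)
  qed
  \<comment> \<open>The slope is spent as follows: \<open>\<eta> / 4\<close> for a strict ascent,
    \<open>2 * (n * L * \<delta>)\<close> for the speed at which the curve drifts from direction
    \<open>d\<close>, \<open>\<eta> / 4\<close> for a strict contradiction, and
    \<open>n * L * \<delta>\<close> for the final passage from curve to half-line. The total is at
    most \<open>7 * \<eta> / 8\<close>.\<close>
  define A1 where "A1 = A - \<eta> / 4"
  define A2 where "A2 = A1 - 2 * (n * L * \<delta>) - \<eta> / 4"
  \<comment> \<open>A condition on all short steps rather than on one chord, so that at any chosen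
    parameter the selected point can be compared with later points of its own curve.\<close>
  define W where "W v \<longleftrightarrow> (\<exists>r>0. \<forall>\<sigma>. 0 < \<sigma> \<and> \<sigma> < r \<longrightarrow> F v + A1 * \<sigma> \<le> F (v + \<sigma> *\<^sub>R d))" for v
  define R where "R t v \<longleftrightarrow> 0 < t \<and> t < 1 \<and> W v \<and> (\<forall>j. \<bar>v $ j - x $ j - t * d $ j\<bar> \<le> \<delta> * t)" for t v
  have R_definable: "definable_pred (\<lambda>e. R (e CARD('n)) (\<chi> j. e (coord_index j)))"
    unfolding R_def W_def by (intro definable_intros term_app[OF F])
  have "definable_pred (\<lambda>e. \<exists>v. R (e 0) v)"
    unfolding R_def W_def by (intro definable_intros term_app[OF F])
  then have R_ev: "\<forall>\<^sub>F t in at_right 0. \<exists>v. R t v"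
  proof (rule disjE[OF germ])
    assume "\<forall>\<^sub>F t in at_right 0. \<not> (\<exists>v. R t v)"
    then obtain a where a: "a > 0" "\<And>t v. 0 < t \<Longrightarrow> t < a \<Longrightarrow> \<not> R t v"
      by (auto simp: eventually_at_right_field)
    \<comment> \<open>By \<open>germ\<close> it suffices to find one \<open>t\<close> below
      \<open>a\<close> admitting a \<open>v\<close>. Moving the base point from \<open>y\<close> to
      \<open>y + \<tau> *\<^sub>R d\<close> costs at most \<open>\<delta>' * t * norm d\<close>,
      which the factor \<open>1 + norm d\<close> covers.\<close>
    define \<delta>' where "\<delta>' = min (min a 1) (\<delta> / (1 + norm d))"
    have "\<delta>' > 0" using a \<open>\<delta> > 0\<close> by (simp add: \<delta>'_def add_pos_nonneg)
    then obtain t y s where tys: "0 < t" "t < \<delta>'" "norm (y - x - t *\<^sub>R d) \<le> \<delta>' * t" "0 < s" "s \<le> \<delta>' * t"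
      "A * s \<le> F (y + s *\<^sub>R d) - F y"
      using steep by metis
    define p where "p \<tau> = F (y + \<tau> *\<^sub>R d) - A1 * \<tau>" for \<tau>
    have "continuous_on {0..s} p" unfolding p_def
      by (intro continuous_intros
          continuous_on_compose2[OF lipschitz_on_continuous_on[OF lip]]) auto
    moreover have "\<eta> * s > 0" using tys \<open>\<eta> > 0\<close> by simp
    then have "p 0 < p s" using tys(6) by (simp add: p_def A1_def algebra_simps)
    ultimately obtain \<tau> where \<tau>: "0 \<le> \<tau>" "\<tau> < s"
      "\<And>\<sigma>. 0 < \<sigma> \<Longrightarrow> \<sigma> < s - \<tau> \<Longrightarrow> p \<tau> < p (\<tau> + \<sigma>)"
      using ascent_point[of s p] \<open>0 < s\<close> by blast
    define v where "v = y + \<tau> *\<^sub>R d"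
    have "F v + A1 * \<sigma> \<le> F (v + \<sigma> *\<^sub>R d)" if "0 < \<sigma> \<and> \<sigma> < s - \<tau>" for \<sigma>
      using \<tau>(3)[of \<sigma>] that by (simp add: p_def v_def algebra_simps)
    then have "W v" unfolding W_def using \<tau>(2) by (intro exI[of _ "s - \<tau>"]) auto
    moreover have "\<bar>v $ j - x $ j - t * d $ j\<bar> \<le> \<delta> * t" for j
    proof -
      have "\<bar>v $ j - x $ j - t * d $ j\<bar> \<le> norm (v - x - t *\<^sub>R d)"
        using component_le_norm_cart[of "v - x - t *\<^sub>R d" j] by simp
      also have "\<dots> = norm ((y - x - t *\<^sub>R d) + \<tau> *\<^sub>R d)" by (simp add: v_def algebra_simps)
      also have "\<dots> \<le> norm (y - x - t *\<^sub>R d) + norm (\<tau> *\<^sub>R d)" by (rule norm_triangle_ineq)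
      also have "norm (\<tau> *\<^sub>R d) = \<tau> * norm d" using \<tau>(1) by simp
      also have "norm (y - x - t *\<^sub>R d) + \<tau> * norm d \<le> \<delta>' * t + (\<delta>' * t) * norm d"
        using tys \<tau> by (intro add_mono mult_right_mono) auto
      also have "\<dots> = (\<delta>' * (1 + norm d)) * t" by (simp add: algebra_simps)
      also have "\<dots> \<le> \<delta> * t"
      proof (intro mult_right_mono)
        have "\<delta>' \<le> \<delta> / (1 + norm d)" by (simp add: \<delta>'_def)
        then show "\<delta>' * (1 + norm d) \<le> \<delta>" by (simp add: pos_le_divide_eq add_pos_nonneg)
      qed (use tys in simp)
      finally show ?thesis .
    qed
    ultimately have "R t v" unfolding R_def using tys by (auto simp: \<delta>'_def)
    then show ?thesis using a(2) tys by (auto simp: \<delta>'_def)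
  qed
  have "\<bar>v $ j\<bar> \<le> norm x + norm d + \<delta>" if "R t v" for t v j
  proof -
    have "\<bar>v $ j - x $ j - t * d $ j\<bar> \<le> \<delta> * t" "0 < t" "t < 1" using that by (auto simp: R_def)
    moreover have "\<bar>t * d $ j\<bar> \<le> 1 * norm d"
      using that component_le_norm_cart[of d j] unfolding R_def abs_mult by (intro mult_mono) auto
    moreover have "\<delta> * t \<le> \<delta> * 1" using that \<open>\<delta> > 0\<close> by (auto simp: R_def)
    ultimately show ?thesis using component_le_norm_cart[of x j] by linarith
  qed
  with R_definable have "\<exists>y. (\<forall>j. definable_real_fun (\<lambda>t. y t $ j)) \<and> (\<forall>t v. R t v \<longrightarrow> R t (y t))"
    by (rule selection)
  then obtain y where y: "\<And>j. definable_real_fun (\<lambda>t. y t $ j)" "\<And>t v. R t v \<Longrightarrow> R t (y t)" by blast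
  obtain a1 where a1: "a1 > 0" "\<And>t. 0 < t \<Longrightarrow> t < a1 \<Longrightarrow> R t (y t)"
    using R_ev y(2) unfolding eventually_at_right_field by blast
  have "\<exists>a>0. \<forall>s t. 0 < s \<and> s \<le> t \<and> t < a \<longrightarrow>
      \<bar>(y t $ j - x $ j - t * d $ j) - (y s $ j - x $ j - s * d $ j)\<bar> \<le> (2 * \<delta>) * (t - s)" for j
  proof (rule germ_lipschitz)
    show "definable_real_fun (\<lambda>t. y t $ j - x $ j - t * d $ j)"
      unfolding definable_real_fun_def by (intro definable_intros term_app1[OF y(1)])
    show "\<forall>\<^sub>F t in at_right 0. \<bar>y t $ j - x $ j - t * d $ j\<bar> \<le> \<delta> * t"
      using a1 unfolding eventually_at_right_field R_def by blast
  qed (use \<open>\<delta> > 0\<close> in simp)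
  then obtain a' where a': "\<And>j. a' j > 0" "\<And>j s t. 0 < s \<Longrightarrow> s \<le> t \<Longrightarrow> t < a' j \<Longrightarrow>
      \<bar>(y t $ j - x $ j - t * d $ j) - (y s $ j - x $ j - s * d $ j)\<bar> \<le> (2 * \<delta>) * (t - s)"
    by metis
  define a2 where "a2 = Min (range a')"
  have a2: "a2 > 0" "\<And>j. a2 \<le> a' j" using a'(1) by (auto simp: a2_def)
  have y_diff: "norm (y t - (y s + (t - s) *\<^sub>R d)) \<le> n * ((2 * \<delta>) * (t - s))"
    if "0 < s" "s \<le> t" "t < a2" for s t
  proof (rule norm_le)
    fix j show "\<bar>(y t - (y s + (t - s) *\<^sub>R d)) $ j\<bar> \<le> (2 * \<delta>) * (t - s)"
      using a'(2)[of s t j] that a2(2)[of j] by (simp add: algebra_simps)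
  qed
  have y_near: "norm (y t - (x + t *\<^sub>R d)) \<le> n * (\<delta> * t)" if "0 < t" "t < a1" for t
  proof (rule norm_le)
    fix j show "\<bar>(y t - (x + t *\<^sub>R d)) $ j\<bar> \<le> \<delta> * t"
      using a1(2)[OF that] by (simp add: R_def algebra_simps)
  qed
  define P where "P t = F (y t) - A2 * t" for t
  have "definable_vec (\<lambda>e. y (e 0))" unfolding definable_vec_def using term_app1[OF y(1) term_var] by blast
  then have "definable_real_fun P" unfolding definable_real_fun_def P_def by (intro definable_intros term_app[OF F])
  then obtain a3 where a3: "a3 > 0" "mono_on {0<..<a3} P \<or> mono_on {0<..<a3} (\<lambda>t. - P t)"
    by (rule monotone_germ)
  define a where "a = min a1 (min a2 a3)"
  have "a > 0" using a1 a2 a3 by (simp add: a_def)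
  \<comment> \<open>One parameter refutes a decreasing \<open>P\<close>: at
    \<open>y (a / 2)\<close>, \<open>F\<close> grows with slope \<open>A1\<close> along
    \<open>d\<close>, while the curve leaves that ray at speed at most
    \<open>n * (2 * \<delta>)\<close>.\<close>
  have "\<not> mono_on {0<..<a3} (\<lambda>t. - P t)"
  proof
    assume m: "mono_on {0<..<a3} (\<lambda>t. - P t)"
    have "R (a / 2) (y (a / 2))" using \<open>a > 0\<close> by (intro a1(2)) (auto simp: a_def)
    then obtain r where r: "r > 0"
      "\<And>\<sigma>. 0 < \<sigma> \<Longrightarrow> \<sigma> < r \<Longrightarrow> F (y (a / 2)) + A1 * \<sigma> \<le> F (y (a / 2) + \<sigma> *\<^sub>R d)"
      unfolding R_def W_def by blast
    define \<sigma> where "\<sigma> = min r (a / 2) / 2"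
    have \<sigma>: "0 < \<sigma>" "\<sigma> < r" "a / 2 + \<sigma> < a" using r \<open>a > 0\<close> by (auto simp: \<sigma>_def)
    have "\<bar>F (y (a / 2 + \<sigma>)) - F (y (a / 2) + \<sigma> *\<^sub>R d)\<bar> \<le> L * (n * ((2 * \<delta>) * \<sigma>))"
      using F_diff y_diff[of "a / 2" "a / 2 + \<sigma>"] \<sigma> L \<open>a > 0\<close>
      by (intro order_trans[OF F_diff] mult_left_mono) (auto simp: a_def)
    moreover have "- P (a / 2) \<le> - P (a / 2 + \<sigma>)"
      by (rule mono_onD[OF m]) (use \<sigma> \<open>a > 0\<close> in \<open>auto simp: a_def\<close>)
    moreover have "\<eta> * \<sigma> > 0" using \<sigma> \<open>\<eta> > 0\<close> by simp
    ultimately show False using r(2)[OF \<sigma>(1,2)]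
      by (simp add: P_def A2_def algebra_simps abs_le_iff)
  qed
  then have m: "mono_on {0<..<a3} P" using a3 by blast
  have P_ge: "F x \<le> P t" if t: "0 < t" "t < a" for t
  proof -
    \<comment> \<open>A constant for which \<open>F x - C * s \<le> P s\<close>; the claim follows
      from \<open>P s \<le> P t\<close> as \<open>s\<close> tends to 0, where \<open>y s\<close>
      tends to \<open>x\<close>.\<close>
    define C where "C = L * (n * \<delta> + norm d) + \<bar>A2\<bar>"
    have "((\<lambda>s. F x - C * s) \<longlongrightarrow> F x - C * 0) (at_right 0)" by (intro tendsto_intros)
    then have "((\<lambda>s. F x - C * s) \<longlongrightarrow> F x) (at_right 0)" by simp
    moreover have "\<forall>\<^sub>F s in at_right 0. F x - C * s \<le> P t"
      unfolding eventually_at_right_field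
    proof (intro exI[of _ t] conjI allI impI)
      fix s :: real assume s: "0 < s" "s < t"
      have "norm (y s - x) \<le> norm (y s - (x + s *\<^sub>R d)) + norm (s *\<^sub>R d)"
        using norm_triangle_ineq[of "y s - (x + s *\<^sub>R d)" "s *\<^sub>R d"] by (simp add: algebra_simps)
      also have "\<dots> \<le> n * (\<delta> * s) + s * norm d"
        using y_near[of s] s t by (simp add: a_def)
      finally have "\<bar>F (y s) - F x\<bar> \<le> L * (n * (\<delta> * s) + s * norm d)"
        using F_diff[of "y s" x] L by (meson mult_left_mono order_trans)
      moreover have "A2 * s \<le> \<bar>A2\<bar> * s" using s by (intro mult_right_mono) auto
      moreover have "P s \<le> P t" by (rule mono_onD[OF m]) (use s t in \<open>auto simp: a_def\<close>)
      ultimately show "F x - C * s \<le> P t" by (simp add: P_def C_def algebra_simps abs_le_iff)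
    qed (use t in simp)
    ultimately show ?thesis by (rule tendsto_upperbound) simp
  qed
  show ?thesis unfolding eventually_at_right_field
  proof (intro exI[of _ a] conjI allI impI)
    fix t assume t: "0 < t" "t < a"
    have "\<bar>F (y t) - F (x + t *\<^sub>R d)\<bar> \<le> L * (n * (\<delta> * t))"
      using y_near[of t] t L by (intro order_trans[OF F_diff] mult_left_mono) (auto simp: a_def)
    moreover have "(n * L * \<delta>) * t \<le> \<eta> / 8 * t" using nL\<delta> t by (intro mult_right_mono) auto
    moreover have "\<eta> * t > 0" using t \<open>\<eta> > 0\<close> by simp
    ultimately show "(A - \<eta>) * t \<le> F (x + t *\<^sub>R d) - F x"
      using P_ge[OF t] by (simp add: P_def A2_def A1_def algebra_simps abs_le_iff)
  qed (rule \<open>a > 0\<close>)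
qed

end

section \<open>Critical values\<close>

text \<open>Equivalent to \<open>clarke_dd F x d \<ge> ereal B\<close>.\<close>

definition clarke_ge :: "('v::real_normed_vector \<Rightarrow> real) \<Rightarrow> 'v \<Rightarrow> 'v \<Rightarrow> real \<Rightarrow> bool" where
  "clarke_ge F x d B \<longleftrightarrow> (\<forall>\<epsilon>>0. \<exists>y s. norm (y - x) < \<epsilon> \<and> 0 < s \<and> s < \<epsilon> \<and>
     (B - \<epsilon>) * s \<le> F (y + s *\<^sub>R d) - F y)"

text \<open>Each chord is traversed backwards, its end point becoming the new base point. This
  displaces the base point by \<open>s * norm d\<close>, whence the factor \<open>1 + norm d\<close>
  in \<open>\<epsilon>'\<close>.\<close>

lemma clarke_ge_uminus:
  assumes "clarke_ge F x (- d) B"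
  shows "clarke_ge (\<lambda>x. - F x) x d B"
  unfolding clarke_ge_def
proof (intro allI impI)
  fix \<epsilon> :: real assume "\<epsilon> > 0"
  define \<epsilon>' where "\<epsilon>' = \<epsilon> / (1 + norm d)"
  have pos: "1 + norm d > 0" by (simp add: add_pos_nonneg)
  then have "\<epsilon>' > 0" using \<open>\<epsilon> > 0\<close> by (simp add: \<epsilon>'_def)
  have "\<epsilon>' \<le> \<epsilon>" using \<open>\<epsilon> > 0\<close> pos by (simp add: \<epsilon>'_def field_simps)
  obtain y s where ys: "norm (y - x) < \<epsilon>'" "0 < s" "s < \<epsilon>'"
      "(B - \<epsilon>') * s \<le> F (y + s *\<^sub>R (- d)) - F y"
    using assms \<open>\<epsilon>' > 0\<close> unfolding clarke_ge_def by blast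
  have "norm (y - s *\<^sub>R d - x) \<le> norm (y - x) + s * norm d"
    using norm_triangle_ineq4[of "y - x" "s *\<^sub>R d"] ys by (simp add: algebra_simps)
  also have "\<dots> < \<epsilon>' + \<epsilon>' * norm d"
    using ys by (intro add_less_le_mono mult_right_mono) auto
  also have "\<dots> = \<epsilon>' * (1 + norm d)" by (simp add: algebra_simps)
  also have "\<dots> = \<epsilon>" using pos by (simp add: \<epsilon>'_def)
  finally have "norm (y - s *\<^sub>R d - x) < \<epsilon>" .
  moreover have "(B - \<epsilon>) * s \<le> (B - \<epsilon>') * s"
    using \<open>\<epsilon>' \<le> \<epsilon>\<close> ys by (intro mult_right_mono) auto
  then have "(B - \<epsilon>) * s \<le> F (y + s *\<^sub>R (- d)) - F y" using ys(4) by (rule order_trans)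
  ultimately show "\<exists>y s. norm (y - x) < \<epsilon> \<and> 0 < s \<and> s < \<epsilon> \<and> (B - \<epsilon>) * s \<le> - F (y + s *\<^sub>R d) - - F y"
    using ys \<open>\<epsilon>' \<le> \<epsilon>\<close> by (intro exI[of _ "y - s *\<^sub>R d"] exI[of _ s]) auto
qed

text \<open>Continuous induction over the set of \<open>t\<close> where the bound holds from
  \<open>p\<close>. Monotonicity of \<open>S\<close> takes the place of left continuity at the
  supremum.\<close>

lemma increment_if_right_increments:
  fixes S :: "real \<Rightarrow> real"
  assumes "p \<le> q" "K > 0" and mono: "mono_on {p..q} S"
    and right: "\<And>t. p \<le> t \<Longrightarrow> t < q \<Longrightarrow> \<forall>\<^sub>F \<sigma> in at_right 0. K * \<sigma> \<le> S (t + \<sigma>) - S t"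
  shows "K * (q - p) \<le> S q - S p"
proof -
  define T where "T = {t. p \<le> t \<and> t \<le> q \<and> K * (t - p) \<le> S t - S p}"
  have "p \<in> T" using \<open>p \<le> q\<close> by (simp add: T_def)
  have bdd: "bdd_above T" by (intro bdd_aboveI[of _ q]) (simp add: T_def)
  define s where "s = Sup T"
  have le_s: "t \<le> s" if "t \<in> T" for t unfolding s_def using that bdd by (rule cSup_upper)
  have "p \<le> s" using le_s[OF \<open>p \<in> T\<close>] .
  have "s \<le> q" unfolding s_def using \<open>p \<in> T\<close> by (intro cSup_least) (auto simp: T_def)
  have "K * (s - p) \<le> S s - S p"
  proof (rule ccontr)
    assume "\<not> ?thesis"
    then have "p + (S s - S p) / K < s" using \<open>K > 0\<close> by (simp add: field_simps)
    then obtain t where t: "t \<in> T" "p + (S s - S p) / K < t"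
      using less_cSup_iff[OF _ bdd] \<open>p \<in> T\<close> unfolding s_def by blast
    then have "S s - S p < K * (t - p)" using \<open>K > 0\<close> by (simp add: field_simps)
    moreover have "S t \<le> S s"
      by (rule mono_onD[OF mono]) (use t le_s \<open>p \<le> s\<close> \<open>s \<le> q\<close> in \<open>auto simp: T_def\<close>)
    ultimately show False using t by (simp add: T_def)
  qed
  moreover have "s = q"
  proof (rule ccontr)
    assume "s \<noteq> q"
    then have "s < q" using \<open>s \<le> q\<close> by simp
    from right[OF \<open>p \<le> s\<close> this] obtain e where
      e: "e > 0" "\<And>\<sigma>. 0 < \<sigma> \<Longrightarrow> \<sigma> < e \<Longrightarrow> K * \<sigma> \<le> S (s + \<sigma>) - S s"
      by (auto simp: eventually_at_right_field)
    define \<sigma> where "\<sigma> = min e (q - s) / 2"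
    have \<sigma>: "0 < \<sigma>" "\<sigma> < e" "s + \<sigma> \<le> q" using e \<open>s < q\<close> by (auto simp: \<sigma>_def min_def field_simps)
    have "s + \<sigma> \<in> T"
      using \<sigma> e(2)[of \<sigma>] \<open>p \<le> s\<close> \<open>K * (s - p) \<le> S s - S p\<close> by (simp add: T_def algebra_simps)
    then show False using le_s[of "s + \<sigma>"] \<sigma> by simp
  qed
  ultimately show ?thesis by simp
qed

context o_minimal_structure
begin

lemma term_sum: "finite A \<Longrightarrow> (\<And>a. a \<in> A \<Longrightarrow> definable_term (h a)) \<Longrightarrow> definable_term (\<lambda>e. \<Sum>a\<in>A. h a e)"
  by (induction A rule: finite_induct) (auto intro: term_const term_add)

lemma term_norm: fixes h :: "(nat \<Rightarrow> real) \<Rightarrow> real^'n::finite" assumes "definable_vec h" shows "definable_term (\<lambda>e. norm (h e))"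
proof -
  have h: "definable_term (\<lambda>e. h (\<lambda>i. e (Suc i)) $ j)" for j
    using assms by (intro term_rename[of "\<lambda>e. h e $ j" Suc]) (simp add: definable_vec_def)
  have "definable_pred (\<lambda>e. 0 \<le> e 0 \<and> e 0 * e 0 = (\<Sum>j\<in>UNIV. h (\<lambda>i. e (Suc i)) $ j * h (\<lambda>i. e (Suc i)) $ j))"
    by (intro definable_intros term_sum h) simp
  moreover have "r = norm v \<longleftrightarrow> 0 \<le> r \<and> r * r = (\<Sum>j\<in>UNIV. v $ j * v $ j)" for r and v :: "real^'n"
    by (auto simp: norm_vec_def L2_set_def power2_eq_square sum_nonneg intro: real_sqrt_unique[symmetric])
  ultimately show ?thesis unfolding definable_term_def by simp
qed

lemma definable_uminus: "definable_fun F \<Longrightarrow> definable_fun (\<lambda>x. - F x)"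
  unfolding definable_fun_def by (rule term_uminus)

text \<open>The Clarke bound at \<open>x'\<close> is realised by a chord so short and so near
  \<open>x'\<close> that the cone around the half-line is at most doubled; \<open>semismooth\<close>
  then applies to these chords.\<close>

lemma semismooth_clarke:
  fixes F :: "real^'n::finite \<Rightarrow> real"
  assumes F: "definable_fun F" "L-lipschitz_on UNIV F"
    and steep: "\<And>\<delta>. \<delta> > 0 \<Longrightarrow> \<exists>t x'. 0 < t \<and> t < \<delta> \<and> norm (x' - x - t *\<^sub>R d) \<le> \<delta> * t \<and> clarke_ge F x' d B"
    and "\<eta> > 0"
  shows "\<forall>\<^sub>F t in at_right 0. (B - \<eta>) * t \<le> F (x + t *\<^sub>R d) - F x"
proof -
  have "\<forall>\<^sub>F t in at_right 0. (B - \<eta> / 2 - \<eta> / 2) * t \<le> F (x + t *\<^sub>R d) - F x"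
  proof (rule semismooth[OF F])
    fix \<delta> :: real assume "\<delta> > 0"
    then obtain t x' where t: "0 < t" "t < \<delta> / 2" "norm (x' - x - t *\<^sub>R d) \<le> (\<delta> / 2) * t" "clarke_ge F x' d B"
      using steep[of "\<delta> / 2"] by auto
    define \<epsilon> where "\<epsilon> = min (\<eta> / 2) ((\<delta> / 2) * t)"
    have "\<epsilon> > 0" using t \<open>\<delta> > 0\<close> \<open>\<eta> > 0\<close> by (simp add: \<epsilon>_def)
    then obtain y s where ys: "norm (y - x') < \<epsilon>" "0 < s" "s < \<epsilon>" "(B - \<epsilon>) * s \<le> F (y + s *\<^sub>R d) - F y"
      using t(4) unfolding clarke_ge_def by blast
    have "norm (y - x - t *\<^sub>R d) \<le> norm (y - x') + norm (x' - x - t *\<^sub>R d)"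
      using norm_triangle_ineq[of "y - x'" "x' - x - t *\<^sub>R d"] by (simp add: algebra_simps)
    also have "\<dots> \<le> (\<delta> / 2) * t + (\<delta> / 2) * t" using ys t by (auto simp: \<epsilon>_def)
    finally have "norm (y - x - t *\<^sub>R d) \<le> \<delta> * t" by simp
    moreover have "(B - \<eta> / 2) * s \<le> (B - \<epsilon>) * s" using ys by (intro mult_right_mono) (auto simp: \<epsilon>_def)
    then have "(B - \<eta> / 2) * s \<le> F (y + s *\<^sub>R d) - F y" using ys(4) by (rule order_trans)
    moreover have "\<delta> * t > 0" using \<open>\<delta> > 0\<close> t by simp
    then have "s \<le> \<delta> * t" using ys(3) by (auto simp: \<epsilon>_def)
    ultimately show "\<exists>t y s. 0 < t \<and> t < \<delta> \<and> norm (y - x - t *\<^sub>R d) \<le> \<delta> * t \<and>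
        0 < s \<and> s \<le> \<delta> * t \<and> (B - \<eta> / 2) * s \<le> F (y + s *\<^sub>R d) - F y"
      using t(1,2) ys(2) \<open>\<delta> > 0\<close> by (intro exI[of _ t], intro exI[of _ y], intro exI[of _ s]) auto
  qed (use \<open>\<eta> > 0\<close> in simp)
  then show ?thesis by simp
qed

lemma monotone_subinterval_finite:
  assumes "finite J" "\<And>j. j \<in> J \<Longrightarrow> definable_real_fun (u j)" "a < b"
  shows "\<exists>c d. a \<le> c \<and> c < d \<and> d \<le> b \<and>
    (\<forall>j\<in>J. mono_on {c<..<d} (u j) \<or> mono_on {c<..<d} (\<lambda>t. - u j t))"
  using assms
proof (induction J rule: finite_induct)
  case empty
  then show ?case by auto
next
  case (insert j J)
  then obtain c d where cd: "a \<le> c" "c < d" "d \<le> b"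
    "\<forall>j\<in>J. mono_on {c<..<d} (u j) \<or> mono_on {c<..<d} (\<lambda>t. - u j t)" by auto
  have "definable_real_fun (u j)" using insert by auto
  from monotone_subinterval[OF this cd(2)] obtain c' d' where c'd': "c \<le> c'" "c' < d'" "d' \<le> d"
    "mono_on {c'<..<d'} (u j) \<or> mono_on {c'<..<d'} (\<lambda>t. - u j t)" by metis
  have "mono_on {c'<..<d'} v" if "mono_on {c<..<d} v" for v :: "real \<Rightarrow> real"
    using that c'd' by (auto intro: mono_on_subset)
  then have "\<forall>j\<in>insert j J. mono_on {c'<..<d'} (u j) \<or> mono_on {c'<..<d'} (\<lambda>t. - u j t)"
    using cd(4) c'd'(4) by blast
  then show ?case using cd c'd' by (intro exI[of _ c'] exI[of _ d']) auto
qed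

text \<open>Otherwise \<open>y (r + \<sigma>)\<close> approaches \<open>y r\<close> with
  \<open>norm z < K * \<sigma>\<close> along a sequence, and after normalisation from a direction
  \<open>d\<close>. The points are critical, so semismoothness of \<open>- F\<close> allows
  \<open>F\<close> to grow along \<open>d\<close> by at most \<open>\<eta> * t\<close>; but
  \<open>F\<close> has to grow by \<open>\<sigma>\<close>, which exceeds
  \<open>norm z / K\<close>.\<close>

lemma critical_curve_steep:
  fixes F :: "real^'n::finite \<Rightarrow> real" and y :: "real \<Rightarrow> real^'n"
  assumes F: "definable_fun F" and lip: "L-lipschitz_on UNIV F"
    and y: "\<And>r. a < r \<Longrightarrow> r < b \<Longrightarrow> F (y r) = r \<and> (\<forall>d. clarke_ge F (y r) d 0)"
    and r: "a < r" "r < b" and "K > 0"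
  shows "\<forall>\<^sub>F \<sigma> in at_right 0. K * \<sigma> \<le> norm (y (r + \<sigma>) - y r)"
proof (rule ccontr)
  assume not: "\<not> ?thesis"
  have L: "L \<ge> 0" using lip by (rule lipschitz_on_nonneg)
  have "\<exists>\<sigma>. 0 < \<sigma> \<and> \<sigma> < e \<and> norm (y (r + \<sigma>) - y r) < K * \<sigma>" if "e > 0" for e
    using not that unfolding eventually_at_right_field by (force simp: not_le)
  then have "\<exists>\<sigma>. 0 < \<sigma> \<and> \<sigma> < min (inverse (Suc k)) (b - r) \<and> norm (y (r + \<sigma>) - y r) < K * \<sigma>" for k :: nat
  proof -
    have "min (inverse (real (Suc k))) (b - r) > 0" using r by simp
    then show ?thesis using \<open>\<And>e. e > 0 \<Longrightarrow> _\<close> by blast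
  qed
  then obtain \<sigma> where \<sigma>: "\<And>k. 0 < \<sigma> k" "\<And>k. \<sigma> k < inverse (Suc k)" "\<And>k. r + \<sigma> k < b"
    "\<And>k. norm (y (r + \<sigma> k) - y r) < K * \<sigma> k"
    unfolding min_less_iff_conj less_diff_eq by (metis add.commute)
  define z where "z k = y (r + \<sigma> k) - y r" for k
  have yr: "F (y (r + \<sigma> k)) = r + \<sigma> k" "F (y r) = r" for k
    using y r \<sigma>(1,3)[of k] by (auto simp: less_eq_real_def intro: add_strict_increasing)
  have z_pos: "norm (z k) > 0" for k
  proof -
    have "y (r + \<sigma> k) \<noteq> y r" using yr(1)[of k] yr(2) \<sigma>(1)[of k] by auto
    then show ?thesis by (simp add: z_def)
  qed
  have "\<sigma> \<longlonglongrightarrow> 0"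
    by (rule real_tendsto_sandwich[OF _ _ tendsto_const LIMSEQ_inverse_real_of_nat])
      (use \<sigma>(1,2) in \<open>auto intro: less_imp_le always_eventually\<close>)
  then have "(\<lambda>k. K * \<sigma> k) \<longlonglongrightarrow> 0" by (rule tendsto_mult_right_zero)
  then have z0: "(\<lambda>k. norm (z k)) \<longlonglongrightarrow> 0"
    by (rule Lim_null_comparison[rotated])
      (use \<sigma>(4) in \<open>auto simp: z_def intro!: always_eventually less_imp_le\<close>)
  have "z k /\<^sub>R norm (z k) \<in> sphere 0 1" for k using z_pos[of k] by auto
  moreover have "seq_compact (sphere (0 :: real^'n) 1)" by (intro compact_imp_seq_compact) simp
  ultimately obtain d \<rho> where d: "strict_mono \<rho>" "((\<lambda>k. z k /\<^sub>R norm (z k)) \<circ> \<rho>) \<longlonglongrightarrow> d"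
    using seq_compactE[of "sphere 0 1" "\<lambda>k. z k /\<^sub>R norm (z k)"] by metis
  have d_ev: "\<forall>\<^sub>F k in sequentially. norm (z (\<rho> k) - norm (z (\<rho> k)) *\<^sub>R d) \<le> e * norm (z (\<rho> k))"
    if "e > 0" for e
  proof -
    have "\<forall>\<^sub>F k in sequentially. dist (z (\<rho> k) /\<^sub>R norm (z (\<rho> k))) d < e"
      using tendstoD[OF d(2) that] by simp
    then show ?thesis
    proof eventually_elim
      case (elim k)
      have "z (\<rho> k) - norm (z (\<rho> k)) *\<^sub>R d = norm (z (\<rho> k)) *\<^sub>R (z (\<rho> k) /\<^sub>R norm (z (\<rho> k)) - d)"
        using z_pos[of "\<rho> k"] by (simp add: algebra_simps)
      then have "norm (z (\<rho> k) - norm (z (\<rho> k)) *\<^sub>R d) =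
          norm (z (\<rho> k)) * norm (z (\<rho> k) /\<^sub>R norm (z (\<rho> k)) - d)" by (metis norm_ge_zero norm_scaleR abs_of_nonneg)
      also have "\<dots> \<le> norm (z (\<rho> k)) * e"
        using elim by (intro mult_left_mono) (auto simp: dist_norm)
      finally show ?case by (simp add: mult.commute)
    qed
  qed
  have z0': "(\<lambda>k. norm (z (\<rho> k))) \<longlonglongrightarrow> 0"
    using LIMSEQ_subseq_LIMSEQ[OF z0 d(1)] by (simp add: o_def)
  \<comment> \<open>One \<open>\<eta>\<close> is the slope along \<open>d\<close>, a second pays for
    replacing \<open>z\<close> by \<open>norm z *\<^sub>R d\<close>;
    \<open>2 * \<eta> * K = 1 / 2\<close> then gives \<open>\<sigma> < \<sigma> / 2\<close>.\<close>
  define \<eta> where "\<eta> = 1 / (4 * K)"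
  have "\<eta> > 0" using \<open>K > 0\<close> by (simp add: \<eta>_def)
  have lip': "L-lipschitz_on UNIV (\<lambda>x. - F x)"
    using lip by (rule lipschitz_on_minus)
  have "\<forall>\<^sub>F t in at_right 0. (0 - \<eta>) * t \<le> - F (y r + t *\<^sub>R d) - - F (y r)"
  proof (rule semismooth_clarke[OF definable_uminus[OF F] lip' _ \<open>\<eta> > 0\<close>])
    fix \<delta> :: real assume "\<delta> > 0"
    have "\<forall>\<^sub>F k in sequentially. norm (z (\<rho> k)) < \<delta>" using order_tendstoD(2)[OF z0' \<open>\<delta> > 0\<close>] .
    with d_ev[OF \<open>\<delta> > 0\<close>]
    have "\<forall>\<^sub>F k in sequentially. norm (z (\<rho> k) - norm (z (\<rho> k)) *\<^sub>R d) \<le> \<delta> * norm (z (\<rho> k)) \<and> norm (z (\<rho> k)) < \<delta>"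
      by (rule eventually_conj)
    then obtain k where k: "norm (z (\<rho> k) - norm (z (\<rho> k)) *\<^sub>R d) \<le> \<delta> * norm (z (\<rho> k))" "norm (z (\<rho> k)) < \<delta>"
      using eventually_happens'[OF sequentially_bot] by blast
    have "clarke_ge (\<lambda>x. - F x) (y (r + \<sigma> (\<rho> k))) d 0"
      using y[of "r + \<sigma> (\<rho> k)"] \<sigma>(1,3)[of "\<rho> k"] r by (intro clarke_ge_uminus) auto
    then show "\<exists>t x'. 0 < t \<and> t < \<delta> \<and> norm (x' - y r - t *\<^sub>R d) \<le> \<delta> * t \<and> clarke_ge (\<lambda>x. - F x) x' d 0"
      using k z_pos[of "\<rho> k"]
      by (intro exI[of _ "norm (z (\<rho> k))"] exI[of _ "y (r + \<sigma> (\<rho> k))"]) (auto simp: z_def)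
  qed
  moreover have "filterlim (\<lambda>k. norm (z (\<rho> k))) (at_right 0) sequentially"
    using z0' z_pos by (auto simp: filterlim_at intro!: always_eventually)
  ultimately have ev: "\<forall>\<^sub>F k in sequentially. (0 - \<eta>) * norm (z (\<rho> k)) \<le> - F (y r + norm (z (\<rho> k)) *\<^sub>R d) - - F (y r)"
    unfolding filterlim_iff by blast
  have "\<eta> / (L + 1) > 0" using \<open>\<eta> > 0\<close> L by simp
  from eventually_happens'[OF sequentially_bot eventually_conj[OF ev d_ev[OF this]]]
  obtain k where k: "(0 - \<eta>) * norm (z (\<rho> k)) \<le> - F (y r + norm (z (\<rho> k)) *\<^sub>R d) - - F (y r)"
    "norm (z (\<rho> k) - norm (z (\<rho> k)) *\<^sub>R d) \<le> \<eta> / (L + 1) * norm (z (\<rho> k))" by blast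
  have "F (y r + z (\<rho> k)) - F (y r + norm (z (\<rho> k)) *\<^sub>R d) \<le> L * norm (z (\<rho> k) - norm (z (\<rho> k)) *\<^sub>R d)"
    using lipschitz_onD[OF lip, of "y r + z (\<rho> k)" "y r + norm (z (\<rho> k)) *\<^sub>R d"]
    by (simp add: dist_norm abs_le_iff)
  also have "\<dots> \<le> L * (\<eta> / (L + 1) * norm (z (\<rho> k)))" using k(2) L by (rule mult_left_mono)
  also have "\<dots> = (L * \<eta> / (L + 1)) * norm (z (\<rho> k))" by simp
  also have "\<dots> \<le> \<eta> * norm (z (\<rho> k))"
    using L \<open>\<eta> > 0\<close> by (intro mult_right_mono) (auto simp: field_simps)
  finally have "\<sigma> (\<rho> k) \<le> 2 * \<eta> * norm (z (\<rho> k))" using k(1) yr(1)[of "\<rho> k"] yr(2) by (simp add: z_def)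
  also have "\<dots> < 2 * \<eta> * (K * \<sigma> (\<rho> k))"
    using \<sigma>(4)[of "\<rho> k"] \<open>\<eta> > 0\<close> by (intro mult_strict_left_mono) (auto simp: z_def)
  also have "\<dots> = \<sigma> (\<rho> k) / 2" using \<open>K > 0\<close> by (simp add: \<eta>_def)
  finally show False using \<sigma>(1)[of "\<rho> k"] by simp
qed

lemma finite_critical_values:
  fixes F :: "real^'n::finite \<Rightarrow> real"
  assumes F: "definable_fun F" and lip: "L-lipschitz_on UNIV F"
  shows "finite {F x | x. norm x \<le> \<rho> \<and> (\<forall>d. clarke_ge F x d 0)}"
proof (rule ccontr)
  assume inf: "infinite {F x | x. norm x \<le> \<rho> \<and> (\<forall>d. clarke_ge F x d 0)}"
  define R where "R r x \<longleftrightarrow> r = F x \<and> norm x \<le> \<rho> \<and> (\<forall>d. clarke_ge F x d 0)" for r x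
  have "definable_pred (\<lambda>e. \<exists>x. R (e 0) x)"
    unfolding R_def clarke_ge_def by (intro definable_intros term_app[OF F] term_norm)
  moreover have "infinite {r. \<exists>x. R r x}" using inf by (simp add: R_def)
  ultimately obtain a b where ab: "a < b" "\<And>r. a < r \<Longrightarrow> r < b \<Longrightarrow> \<exists>x. R r x"
    by (rule infinite_interval) blast
  have R_definable: "definable_pred (\<lambda>e. R (e CARD('n)) (\<chi> j. e (coord_index j)))"
    unfolding R_def clarke_ge_def by (intro definable_intros term_app[OF F] term_norm)
  have "\<bar>x $ j\<bar> \<le> \<rho>" if "R r x" for r x j
    using that component_le_norm_cart[of x j] by (auto simp: R_def)
  with R_definable have "\<exists>y. (\<forall>j. definable_real_fun (\<lambda>t. y t $ j)) \<and> (\<forall>r x. R r x \<longrightarrow> R r (y r))" by (rule selection)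
  then obtain y where y: "\<And>j. definable_real_fun (\<lambda>r. y r $ j)" "\<And>r x. R r x \<Longrightarrow> R r (y r)" by blast
  have Ry: "R r (y r)" if "a < r" "r < b" for r using ab(2)[OF that] y(2) by blast
  obtain c d where cd: "a \<le> c" "c < d" "d \<le> b"
    "\<And>j. mono_on {c<..<d} (\<lambda>r. y r $ j) \<or> mono_on {c<..<d} (\<lambda>r. - y r $ j)"
    using monotone_subinterval_finite[of "UNIV :: 'n set" "\<lambda>j r. y r $ j", OF _ y(1) ab(1)] by auto
  \<comment> \<open>Interior points: monotonicity is available only on the open interval, and right
    increments at \<open>t < q\<close> need room up to \<open>d\<close>.\<close>
  define p where "p = (2 * c + d) / 3"
  define q where "q = (c + 2 * d) / 3"
  have pq: "c < p" "p < q" "q < d" using cd by (auto simp: p_def q_def)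
  \<comment> \<open>The variation of the curve from \<open>p\<close> in the sum norm. Since the
    coordinates are monotone, increments of \<open>S\<close> equal sum-norm distances, which
    dominate the norm in \<open>critical_curve_steep\<close>.\<close>
  define S where "S r = (\<Sum>j\<in>UNIV. \<bar>y r $ j - y p $ j\<bar>)" for r
  have S_diff: "S t - S s = (\<Sum>j\<in>UNIV. \<bar>y t $ j - y s $ j\<bar>)" if "p \<le> s" "s \<le> t" "t < d" for s t
    unfolding S_def sum_subtractf[symmetric]
  proof (rule sum.cong[OF refl])
    fix j
    show "\<bar>y t $ j - y p $ j\<bar> - \<bar>y s $ j - y p $ j\<bar> = \<bar>y t $ j - y s $ j\<bar>"
      using cd(4)[of j]
    proof
      assume m: "mono_on {c<..<d} (\<lambda>r. y r $ j)"
      show ?thesis using mono_onD[OF m, of p s] mono_onD[OF m, of s t] that pq by auto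
    next
      assume m: "mono_on {c<..<d} (\<lambda>r. - y r $ j)"
      show ?thesis using mono_onD[OF m, of p s] mono_onD[OF m, of s t] that pq by auto
    qed
  qed
  have "S s \<le> S t" if "s \<in> {p..q}" "t \<in> {p..q}" "s \<le> t" for s t
  proof -
    have "0 \<le> S t - S s" using that pq by (subst S_diff) (auto intro: sum_nonneg)
    then show ?thesis by simp
  qed
  then have mono: "mono_on {p..q} S" by (rule mono_onI)
  \<comment> \<open>A slope that would force an increment of \<open>S\<close> larger by 1 than the
    actual one.\<close>
  define K where "K = (S q - S p + 1) / (q - p)"
  have "S p \<le> S q" using pq by (intro mono_onD[OF mono]) auto
  then have "K > 0" using pq by (simp add: K_def)
  have "K * (q - p) \<le> S q - S p"
  proof (rule increment_if_right_increments[OF _ \<open>K > 0\<close> mono])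
    fix t assume t: "p \<le> t" "t < q"
    have "\<forall>\<^sub>F \<sigma> in at_right 0. K * \<sigma> \<le> norm (y (t + \<sigma>) - y t)"
      by (rule critical_curve_steep[OF F lip _ _ _ \<open>K > 0\<close>, of a b])
        (use Ry cd pq t in \<open>auto simp: R_def\<close>)
    moreover have "\<forall>\<^sub>F \<sigma> in at_right 0. 0 < \<sigma> \<and> \<sigma> < d - t"
      using t pq by (auto simp: eventually_at_right_field intro: exI[of _ "d - t"])
    ultimately show "\<forall>\<^sub>F \<sigma> in at_right 0. K * \<sigma> \<le> S (t + \<sigma>) - S t"
    proof eventually_elim
      case (elim \<sigma>)
      then have "S (t + \<sigma>) - S t = (\<Sum>j\<in>UNIV. \<bar>(y (t + \<sigma>) - y t) $ j\<bar>)"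
        using t by (subst S_diff) auto
      then show ?case using norm_le_l1_cart[of "y (t + \<sigma>) - y t"] elim by linarith
    qed
  qed (use pq in simp)
  then show False using pq by (simp add: K_def)
qed

end

section \<open>Absolutely continuous curves\<close>

text \<open>Cover \<open>N\<close> by an open set of small measure and apply absolute continuity to those intervals of
  a fine tagged division whose tags lie in \<open>N\<close>.\<close>

lemma increment_le_if_ae:
  fixes h :: "real \<Rightarrow> real"
  assumes ac: "abs_continuous_on 0 T h" and ab: "0 \<le> a" "a \<le> b" "b \<le> T" and N: "negligible N"
    and local: "\<And>t \<eta>. t \<in> {a..b} - N \<Longrightarrow> \<eta> > 0 \<Longrightarrow> \<exists>\<delta>>0. \<forall>u v. a \<le> u \<and> u \<le> t \<and> t \<le> v \<and> v \<le> b \<and>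
      v - u < \<delta> \<longrightarrow> h v - h u \<le> (\<rho> + \<eta>) * (v - u)"
  shows "h b - h a \<le> \<rho> * (b - a)"
proof -
  \<comment> \<open>Tags outside \<open>N\<close> contribute \<open>\<eta> * (b - a)\<close>. Tags
    in \<open>N\<close> contribute \<open>2 * \<eta>\<close>: one \<open>\<eta>\<close> from
    absolute continuity, one from \<open>\<rho>\<close> times a total length below
    \<open>\<delta>\<^sub>1\<close>.\<close>
  have main: "h b - h a - \<rho> * (b - a) \<le> \<eta> * (b - a + 2)" if pos: "\<eta> > 0" for \<eta>
  proof -
    obtain \<delta>\<^sub>0 where \<delta>\<^sub>0: "\<delta>\<^sub>0 > 0" "\<And>P. finite P \<Longrightarrow> (\<forall>(u, v) \<in> P. 0 \<le> u \<and> u < v \<and> v \<le> T) \<Longrightarrow>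
        disjoint_family_on (\<lambda>(u, v). {u<..<v}) P \<Longrightarrow> (\<Sum>(u, v) \<in> P. v - u) < \<delta>\<^sub>0 \<Longrightarrow>
        (\<Sum>(u, v) \<in> P. norm (h v - h u)) < \<eta>"
      using ac pos unfolding abs_continuous_on_def by meson
    define \<delta>\<^sub>1 where "\<delta>\<^sub>1 = min \<delta>\<^sub>0 (\<eta> / (\<bar>\<rho>\<bar> + 1))"
    have "\<delta>\<^sub>1 > 0" using \<delta>\<^sub>0 pos by (simp add: \<delta>\<^sub>1_def add_nonneg_pos)
    have "N \<in> sets lebesgue" using N by (simp add: negligible_imp_sets)
    then obtain U where U: "open U" "N \<subseteq> U" "(U - N) \<in> lmeasurable" "emeasure lebesgue (U - N) < ennreal \<delta>\<^sub>1"
      using sets_lebesgue_outer_open[OF _ \<open>\<delta>\<^sub>1 > 0\<close>] by metis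
    have "U \<in> lmeasurable"
      using fmeasurable.Un[OF U(3) negligible_imp_measurable[OF N]] U(2) by (simp add: Un_absorb2)
    have "measure lebesgue (U - N) = measure lebesgue U"
      by (rule measure_negligible_symdiff) (use \<open>U \<in> lmeasurable\<close> N in \<open>auto intro: negligible_subset\<close>)
    moreover have "measure lebesgue (U - N) < \<delta>\<^sub>1"
      using U(3,4) by (simp add: emeasure_eq_measure2 ennreal_less_iff)
    ultimately have U_small: "measure lebesgue U < \<delta>\<^sub>1" by simp
    have "\<exists>\<delta>>0. \<forall>u v. a \<le> u \<and> u \<le> t \<and> t \<le> v \<and> v \<le> b \<and> v - u < \<delta> \<longrightarrow>
        h v - h u \<le> (\<rho> + \<eta>) * (v - u)" if "t \<in> {a..b} - N" for t
      using local[OF that pos] .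
    then obtain \<delta> where \<delta>: "\<And>t. t \<in> {a..b} - N \<Longrightarrow> \<delta> t > 0"
      "\<And>t u v. t \<in> {a..b} - N \<Longrightarrow> a \<le> u \<Longrightarrow> u \<le> t \<Longrightarrow> t \<le> v \<Longrightarrow> v \<le> b \<Longrightarrow> v - u < \<delta> t \<Longrightarrow>
        h v - h u \<le> (\<rho> + \<eta>) * (v - u)" by metis
    \<comment> \<open>For tags in \<open>N\<close> fineness puts the interval inside
      \<open>U\<close>; for other tags the radius is halved so that the whole interval is shorter
      than \<open>\<delta> t\<close>.\<close>
    define \<gamma> where "\<gamma> t = (if t \<in> N then U else if t \<in> {a..b} then ball t (\<delta> t / 2) else UNIV)" for t
    have "gauge \<gamma>" unfolding gauge_def \<gamma>_def using U(1,2) \<delta>(1) by auto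
    then obtain p where p: "p tagged_division_of {a..b}" "\<gamma> fine p"
      using fine_division_exists_real by blast
    have "finite p" using p(1) by (rule tagged_division_of_finite)
    define G where "G k = h (Sup k) - h (Inf k) - \<rho> * (Sup k - Inf k)" for k :: "real set"
    have k_eq: "k = {Inf k..Sup k} \<and> Inf k \<in> k \<and> Sup k \<in> k \<and> x \<in> k \<and> Inf k \<le> x \<and> x \<le> Sup k \<and> a \<le> Inf k \<and> Sup k \<le> b" if xk: "(x, k) \<in> p" for x k
    proof -
      have "x \<in> k" "k \<subseteq> {a..b}" using xk p(1) by (auto simp: tagged_division_of_def tagged_partial_division_of_def)
      moreover obtain c d where "k = {c..d}" using tagged_division_ofD(4)[OF p(1) xk] by auto
      ultimately show ?thesis by auto
    qed
    have sum_id: "(\<Sum>(x, k)\<in>p. Sup k - Inf k) = b - a"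
      using additive_tagged_division_1[OF ab(2) p(1), of "\<lambda>x. x"] by simp
    have "(\<Sum>(x, k)\<in>p. G k) =
        (\<Sum>(x, k)\<in>p. h (Sup k) - h (Inf k)) - \<rho> * (\<Sum>(x, k)\<in>p. Sup k - Inf k)"
      by (simp only: G_def case_prod_unfold sum_distrib_left flip: sum_subtractf)
    then have "h b - h a - \<rho> * (b - a) = (\<Sum>(x, k)\<in>p. G k)"
      using sum_id additive_tagged_division_1[OF ab(2) p(1), of h] by simp
    also have "p = {z \<in> p. fst z \<notin> N} \<union> {z \<in> p. fst z \<in> N}" by blast
    also have "(\<Sum>(x, k)\<in>{z \<in> p. fst z \<notin> N} \<union> {z \<in> p. fst z \<in> N}. G k) =
        (\<Sum>(x, k)\<in>{z \<in> p. fst z \<notin> N}. G k) + (\<Sum>(x, k)\<in>{z \<in> p. fst z \<in> N}. G k)"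
      using \<open>finite p\<close> by (intro sum.union_disjoint) auto
    also have "(\<Sum>(x, k)\<in>{z \<in> p. fst z \<notin> N}. G k) \<le> (\<Sum>(x, k)\<in>{z \<in> p. fst z \<notin> N}. \<eta> * (Sup k - Inf k))"
    proof (rule sum_mono, clarsimp)
      fix x k assume xk: "(x, k) \<in> p" "x \<notin> N"
      note k = k_eq[OF xk(1)]
      have "x \<in> {a..b}" using k by auto
      then have "k \<subseteq> ball x (\<delta> x / 2)" using fineD[OF p(2) xk(1)] xk(2) by (simp add: \<gamma>_def)
      then have "Inf k \<in> ball x (\<delta> x / 2)" "Sup k \<in> ball x (\<delta> x / 2)" using k by blast+
      then have "Sup k - Inf k < \<delta> x" unfolding mem_ball dist_real_def by linarith
      then have "h (Sup k) - h (Inf k) \<le> (\<rho> + \<eta>) * (Sup k - Inf k)"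
        using \<delta>(2)[of x "Inf k" "Sup k"] k xk ab by auto
      then show "G k \<le> \<eta> * (Sup k - Inf k)" by (simp add: G_def algebra_simps)
    qed
    also have "\<dots> \<le> (\<Sum>(x, k)\<in>p. \<eta> * (Sup k - Inf k))"
      by (rule sum_mono2) (use \<open>finite p\<close> pos k_eq in fastforce)+
    also have "\<dots> = \<eta> * (b - a)"
      unfolding sum_id[symmetric] by (simp add: sum_distrib_left case_prod_unfold)
    also have "(\<Sum>(x, k)\<in>{z \<in> p. fst z \<in> N}. G k) \<le> 2 * \<eta>"
    proof -
      \<comment> \<open>Degenerate intervals contribute nothing to the sum. They are removed because
        \<open>abs_continuous_on\<close> asks for \<open>u < v\<close>, and because
        \<open>\<phi>\<close> is injective only without them.\<close>
      define q where "q = {z \<in> p. fst z \<in> N \<and> Inf (snd z) < Sup (snd z)}"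
      define \<phi> where "\<phi> = (\<lambda>z :: real \<times> real set. (Inf (snd z), Sup (snd z)))"
      have q: "finite q" "q \<subseteq> p" using \<open>finite p\<close> by (auto simp: q_def)
      have disj: "{Inf (snd z)<..<Sup (snd z)} \<inter> {Inf (snd z')<..<Sup (snd z')} = {}"
        if "z \<in> q" "z' \<in> q" "z \<noteq> z'" for z z'
      proof -
        have z: "(fst z, snd z) \<in> p" "(fst z', snd z') \<in> p" using that by (auto simp: q_def)
        have "interior (snd z) \<inter> interior (snd z') = {}"
          by (rule tagged_division_ofD(5)[OF p(1) z]) (use that in \<open>auto simp: prod_eq_iff\<close>)
        moreover have "interior (snd z) = {Inf (snd z)<..<Sup (snd z)}"
          using k_eq[OF z(1)] interior_atLeastAtMost_real by metis
        moreover have "interior (snd z') = {Inf (snd z')<..<Sup (snd z')}"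
          using k_eq[OF z(2)] interior_atLeastAtMost_real by metis
        ultimately show ?thesis by simp
      qed
      have inj: "inj_on \<phi> q"
      proof (rule inj_onI, rule ccontr)
        fix z z' assume z: "z \<in> q" "z' \<in> q" "\<phi> z = \<phi> z'" "z \<noteq> z'"
        then have "{Inf (snd z)<..<Sup (snd z)} = {}" using disj[of z z'] by (simp add: \<phi>_def)
        then show False using z(1) by (simp add: q_def)
      qed
      have dq: "disjoint_family_on (\<lambda>z. {Inf (snd z)<..<Sup (snd z)}) q"
        unfolding disjoint_family_on_def using disj by blast
      have "(\<Sum>z\<in>q. Sup (snd z) - Inf (snd z)) = (\<Sum>z\<in>q. measure lebesgue {Inf (snd z)<..<Sup (snd z)})"
        by (intro sum.cong) (auto simp: q_def)
      also have "\<dots> = measure lebesgue (\<Union>z\<in>q. {Inf (snd z)<..<Sup (snd z)})"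
      proof (rule measure_finite_Union[symmetric])
        show "emeasure lebesgue {Inf (snd z)<..<Sup (snd z)} \<noteq> \<infinity>" if "z \<in> q" for z
          using that by (simp add: q_def)
      qed (use q(1) dq in auto)
      also have "\<dots> \<le> measure lebesgue U"
      proof (rule measure_mono_fmeasurable)
        show "(\<Union>z\<in>q. {Inf (snd z)<..<Sup (snd z)}) \<subseteq> U"
        proof (rule UN_least)
          fix z assume "z \<in> q"
          then have z: "(fst z, snd z) \<in> p" "fst z \<in> N" by (auto simp: q_def)
          then have "snd z \<subseteq> U" using fineD[OF p(2) z(1)] by (simp add: \<gamma>_def)
          then show "{Inf (snd z)<..<Sup (snd z)} \<subseteq> U" using k_eq[OF z(1)] by force
        qed
      qed (use \<open>U \<in> lmeasurable\<close> q in auto)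
      finally have small: "(\<Sum>z\<in>q. Sup (snd z) - Inf (snd z)) < \<delta>\<^sub>1" using U_small by simp
      have "(\<Sum>(u, v)\<in>\<phi> ` q. norm (h v - h u)) < \<eta>"
      proof (rule \<delta>\<^sub>0(2))
        show "disjoint_family_on (\<lambda>(u, v). {u<..<v}) (\<phi> ` q)"
          unfolding disjoint_family_on_def using disj by (auto simp: \<phi>_def)
        show "(\<Sum>(u, v)\<in>\<phi> ` q. v - u) < \<delta>\<^sub>0"
          unfolding sum.reindex[OF inj] using small by (simp add: \<phi>_def o_def \<delta>\<^sub>1_def)
        show "\<forall>(u, v)\<in>\<phi> ` q. 0 \<le> u \<and> u < v \<and> v \<le> T"
        proof clarify
          fix u v z assume z: "(u, v) = \<phi> z" "z \<in> q"
          then have "(fst z, snd z) \<in> p" by (simp add: q_def)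
          from k_eq[OF this] z ab show "0 \<le> u \<and> u < v \<and> v \<le> T" by (auto simp: \<phi>_def q_def)
        qed
      qed (use q in simp)
      then have h_small: "(\<Sum>z\<in>q. norm (h (Sup (snd z)) - h (Inf (snd z)))) < \<eta>"
        unfolding sum.reindex[OF inj] by (simp add: \<phi>_def o_def)
      have "(\<Sum>(x, k)\<in>{z \<in> p. fst z \<in> N}. G k) = (\<Sum>z\<in>q. G (snd z))"
        unfolding case_prod_unfold
      proof (rule sum.mono_neutral_right)
        show "\<forall>z\<in>{z \<in> p. fst z \<in> N} - q. G (snd z) = 0"
        proof
          fix z assume z: "z \<in> {z \<in> p. fst z \<in> N} - q"
          then have "(fst z, snd z) \<in> p" by simp
          from k_eq[OF this] z have "Inf (snd z) = Sup (snd z)" by (auto simp: q_def)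
          then show "G (snd z) = 0" by (simp add: G_def)
        qed
      qed (use \<open>finite p\<close> in \<open>auto simp: q_def\<close>)
      also have "\<dots> \<le> (\<Sum>z\<in>q. norm (h (Sup (snd z)) - h (Inf (snd z))) + \<bar>\<rho>\<bar> * (Sup (snd z) - Inf (snd z)))"
      proof (rule sum_mono)
        fix z assume "z \<in> q"
        then have "- \<rho> * (Sup (snd z) - Inf (snd z)) \<le> \<bar>\<rho>\<bar> * (Sup (snd z) - Inf (snd z))"
          by (intro mult_right_mono) (auto simp: q_def)
        then show "G (snd z) \<le> norm (h (Sup (snd z)) - h (Inf (snd z))) + \<bar>\<rho>\<bar> * (Sup (snd z) - Inf (snd z))"
          by (simp add: G_def)
      qed
      also have "\<dots> = (\<Sum>z\<in>q. norm (h (Sup (snd z)) - h (Inf (snd z)))) +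
          \<bar>\<rho>\<bar> * (\<Sum>z\<in>q. Sup (snd z) - Inf (snd z))"
        by (simp add: sum.distrib sum_distrib_left)
      also have "\<dots> \<le> \<eta> + \<bar>\<rho>\<bar> * (\<eta> / (\<bar>\<rho>\<bar> + 1))"
        using h_small small by (intro add_mono mult_left_mono) (auto simp: \<delta>\<^sub>1_def)
      also have "\<dots> \<le> 2 * \<eta>" using pos by (simp add: field_simps add_nonneg_pos)
      finally show ?thesis .
    qed
    finally show ?thesis by (simp add: algebra_simps)
  qed
  have "h b - h a - \<rho> * (b - a) \<le> 0"
  proof (rule field_le_epsilon)
    fix e :: real assume "e > 0"
    then show "h b - h a - \<rho> * (b - a) \<le> 0 + e"
      using main[of "e / (b - a + 2)"] ab by (simp add: add_nonneg_pos)
  qed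
  then show ?thesis by simp
qed

lemma abs_continuous_on_lipschitz:
  assumes "abs_continuous_on a b g" and lip: "L-lipschitz_on UNIV F"
  shows "abs_continuous_on a b (\<lambda>t. F (g t))"
  unfolding abs_continuous_on_def
proof (intro allI impI)
  fix \<epsilon> :: real assume "\<epsilon> > 0"
  have L: "L \<ge> 0" using lip by (rule lipschitz_on_nonneg)
  then have "\<epsilon> / (L + 1) > 0" using \<open>\<epsilon> > 0\<close> by simp
  then obtain \<delta> where \<delta>: "\<delta> > 0" "\<And>P. finite P \<and> (\<forall>(u, v) \<in> P. a \<le> u \<and> u < v \<and> v \<le> b) \<and>
        disjoint_family_on (\<lambda>(u, v). {u<..<v}) P \<and> (\<Sum>(u, v) \<in> P. v - u) < \<delta> \<Longrightarrow>
        (\<Sum>(u, v) \<in> P. norm (g v - g u)) < \<epsilon> / (L + 1)"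
    using assms(1) unfolding abs_continuous_on_def by meson
  show "\<exists>\<delta>>0. \<forall>P. finite P \<and> (\<forall>(u, v) \<in> P. a \<le> u \<and> u < v \<and> v \<le> b) \<and>
        disjoint_family_on (\<lambda>(u, v). {u<..<v}) P \<and> (\<Sum>(u, v) \<in> P. v - u) < \<delta> \<longrightarrow>
        (\<Sum>(u, v) \<in> P. norm (F (g v) - F (g u))) < \<epsilon>"
  proof (intro exI[of _ \<delta>] conjI allI impI)
    fix P assume "finite P \<and> (\<forall>(u, v) \<in> P. a \<le> u \<and> u < v \<and> v \<le> b) \<and>
        disjoint_family_on (\<lambda>(u, v). {u<..<v}) P \<and> (\<Sum>(u, v) \<in> P. v - u) < \<delta>"
    from \<delta>(2)[OF this] have less: "(\<Sum>(u, v) \<in> P. norm (g v - g u)) < \<epsilon> / (L + 1)" .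
    have "(\<Sum>(u, v) \<in> P. norm (F (g v) - F (g u))) \<le> (\<Sum>(u, v) \<in> P. (L + 1) * norm (g v - g u))"
    proof (rule sum_mono, clarify)
      fix u v
      have "norm (F (g v) - F (g u)) \<le> L * norm (g v - g u)"
        using lipschitz_onD[OF lip, of "g v" "g u"] by (simp add: dist_norm)
      also have "\<dots> \<le> (L + 1) * norm (g v - g u)" by (intro mult_right_mono) auto
      finally show "norm (F (g v) - F (g u)) \<le> (L + 1) * norm (g v - g u)" .
    qed
    also have "\<dots> = (L + 1) * (\<Sum>(u, v) \<in> P. norm (g v - g u))"
      by (simp add: sum_distrib_left case_prod_unfold)
    also have "\<dots> < \<epsilon>" using less L by (simp add: field_simps)
    finally show "(\<Sum>(u, v) \<in> P. norm (F (g v) - F (g u))) < \<epsilon>" .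
  qed (rule \<delta>(1))
qed

lemma abs_continuous_on_imp_continuous:
  assumes "abs_continuous_on a b g"
  shows "continuous_on {a..b} g"
  unfolding continuous_on_iff
proof (intro ballI allI impI)
  fix x \<epsilon> :: real assume x: "x \<in> {a..b}" "\<epsilon> > 0"
  then obtain \<delta> where \<delta>: "\<delta> > 0" "\<And>P. finite P \<and> (\<forall>(u, v) \<in> P. a \<le> u \<and> u < v \<and> v \<le> b) \<and>
        disjoint_family_on (\<lambda>(u, v). {u<..<v}) P \<and> (\<Sum>(u, v) \<in> P. v - u) < \<delta> \<Longrightarrow>
        (\<Sum>(u, v) \<in> P. norm (g v - g u)) < \<epsilon>"
    using assms unfolding abs_continuous_on_def by meson
  have *: "norm (g v - g u) < \<epsilon>" if "a \<le> u" "u < v" "v \<le> b" "v - u < \<delta>" for u v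
    using \<delta>(2)[of "{(u, v)}"] that by (simp add: disjoint_family_on_def)
  show "\<exists>\<delta>>0. \<forall>y\<in>{a..b}. dist y x < \<delta> \<longrightarrow> dist (g y) (g x) < \<epsilon>"
  proof (intro exI[of _ \<delta>] conjI ballI impI)
    fix y assume y: "y \<in> {a..b}" "dist y x < \<delta>"
    consider "y < x" | "y = x" | "x < y" by linarith
    then show "dist (g y) (g x) < \<epsilon>"
      by cases (use *[of y x] *[of x y] x y in \<open>auto simp: dist_norm norm_minus_commute dist_real_def\<close>)
  qed (rule \<delta>(1))
qed

text \<open>Each exceptional \<open>t\<close> gets a code: a rational radius \<open>r\<close>, a
  rational between \<open>t\<close> and \<open>t + r\<close>, and a point of a countable dense set
  within \<open>r / 2\<close> of \<open>v t\<close>. If \<open>t < t'\<close> shared a code,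
  \<open>t'\<close> would lie within \<open>r\<close> to the right of \<open>t\<close> with
  \<open>v t'\<close> closer than \<open>r\<close> to \<open>v t\<close>.\<close>

lemma countable_not_right_limit:
  fixes v :: "real \<Rightarrow> 'a::{metric_space, second_countable_topology}"
  shows "countable {t \<in> Z. \<exists>e>0. \<forall>t'\<in>Z. t < t' \<and> t' < t + e \<longrightarrow> e \<le> dist (v t') (v t)}" (is "countable ?B")
proof -
  obtain D :: "'a set" where D: "countable D" "\<And>X. open X \<Longrightarrow> X \<noteq> {} \<Longrightarrow> \<exists>d\<in>D. d \<in> X"
    using countable_dense_setE by metis
  define code where "code t c \<longleftrightarrow> c \<in> \<rat> \<times> \<rat> \<times> D \<and>
      (\<forall>t'\<in>Z. t < t' \<and> t' < t + fst c \<longrightarrow> fst c \<le> dist (v t') (v t)) \<and>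
      t < fst (snd c) \<and> fst (snd c) < t + fst c \<and> dist (v t) (snd (snd c)) < fst c / 2" for t c
  have "\<forall>t\<in>?B. \<exists>c. code t c"
  proof
    fix t assume "t \<in> ?B"
    then obtain e where e: "e > 0" "\<forall>t'\<in>Z. t < t' \<and> t' < t + e \<longrightarrow> e \<le> dist (v t') (v t)" by blast
    obtain r where r: "r \<in> \<rat>" "0 < r" "r < e" using Rats_dense_in_real[OF e(1)] by blast
    obtain q where q: "q \<in> \<rat>" "t < q" "q < t + r" using Rats_dense_in_real[of t "t + r"] r by auto
    obtain d where d: "d \<in> D" "d \<in> ball (v t) (r / 2)" using D(2)[of "ball (v t) (r / 2)"] r by auto
    have "r \<le> dist (v t') (v t)" if "t' \<in> Z" "t < t' \<and> t' < t + r" for t'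
      using e(2)[rule_format, OF that(1)] that(2) r by auto
    then have "code t (r, q, d)" using r q d by (auto simp: code_def)
    then show "\<exists>c. code t c" ..
  qed
  then obtain c where c: "\<And>t. t \<in> ?B \<Longrightarrow> code t (c t)" by (metis (no_types, lifting))
  have not_less: "\<not> t < t'" if "t \<in> ?B" "t' \<in> ?B" "c t = c t'" for t t'
  proof
    assume "t < t'"
    note c = c[OF that(1), unfolded code_def] c[OF that(2), folded that(3), unfolded code_def]
    have "t' \<in> Z" using that(2) by blast
    then have "fst (c t) \<le> dist (v t') (v t)" using c \<open>t < t'\<close> by fastforce
    also have "\<dots> \<le> dist (v t') (snd (snd (c t))) + dist (v t) (snd (snd (c t)))"
      by (rule dist_triangle2)
    also have "\<dots> < fst (c t) / 2 + fst (c t) / 2"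
      using c by (intro add_strict_mono) auto
    finally show False by simp
  qed
  have "inj_on c ?B"
  proof (rule inj_onI)
    fix t t' assume t: "t \<in> ?B" "t' \<in> ?B" "c t = c t'"
    show "t = t'" using not_less[OF t] not_less[OF t(2,1) t(3)[symmetric]] by linarith
  qed
  moreover have "c ` ?B \<subseteq> \<rat> \<times> \<rat> \<times> D" using c unfolding code_def by blast
  then have "countable (c ` ?B)" by (rule countable_subset) (intro countable_SIGMA countable_rat D(1))
  ultimately show ?thesis by (rule countable_image_inj_on[rotated])
qed

lemma countable_not_left_limit:
  fixes v :: "real \<Rightarrow> 'a::{metric_space, second_countable_topology}"
  shows "countable {t \<in> Z. \<exists>e>0. \<forall>t'\<in>Z. t - e < t' \<and> t' < t \<longrightarrow> e \<le> dist (v t') (v t)}" (is "countable ?B")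
proof -
  have "countable (uminus ` {t \<in> uminus ` Z. \<exists>e>0. \<forall>t'\<in>uminus ` Z. t < t' \<and> t' < t + e \<longrightarrow>
      e \<le> dist (v (- t')) (v (- t))})"
    by (intro countable_image countable_not_right_limit)
  moreover have "?B \<subseteq> uminus ` {t \<in> uminus ` Z. \<exists>e>0. \<forall>t'\<in>uminus ` Z. t < t' \<and> t' < t + e \<longrightarrow>
      e \<le> dist (v (- t')) (v (- t))}"
  proof
    fix t assume "t \<in> ?B"
    then obtain e where "t \<in> Z" "e > 0" "\<forall>t'\<in>Z. t - e < t' \<and> t' < t \<longrightarrow> e \<le> dist (v t') (v t)" by blast
    then have "- t \<in> {t \<in> uminus ` Z. \<exists>e>0. \<forall>t'\<in>uminus ` Z. t < t' \<and> t' < t + e \<longrightarrow>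
      e \<le> dist (v (- t')) (v (- t))}" by (auto intro!: exI[of _ e])
    then show "t \<in> uminus ` {t \<in> uminus ` Z. \<exists>e>0. \<forall>t'\<in>uminus ` Z. t < t' \<and> t' < t + e \<longrightarrow>
      e \<le> dist (v (- t')) (v (- t))}" by (rule rev_image_eqI) simp
  qed
  ultimately show ?thesis by (rule countable_subset[rotated])
qed

section \<open>Descent along subgradient trajectories\<close>

lemma clarke_ge_mono: assumes "clarke_ge F x d B" "B' \<le> B" shows "clarke_ge F x d B'"
  unfolding clarke_ge_def
proof (intro allI impI)
  fix \<epsilon> :: real assume "\<epsilon> > 0"
  then obtain y s where ys: "norm (y - x) < \<epsilon>" "0 < s" "s < \<epsilon>" "(B - \<epsilon>) * s \<le> F (y + s *\<^sub>R d) - F y"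
    using assms(1) unfolding clarke_ge_def by blast
  have "(B' - \<epsilon>) * s \<le> (B - \<epsilon>) * s" using assms(2) ys(2) by (intro mult_right_mono) auto
  with ys show "\<exists>y s. norm (y - x) < \<epsilon> \<and> 0 < s \<and> s < \<epsilon> \<and> (B' - \<epsilon>) * s \<le> F (y + s *\<^sub>R d) - F y"
    by (meson order_trans)
qed

lemma clarke_ge_cong:
  assumes "clarke_ge f x d B" "r > 0" and eq: "\<And>y. norm (y - x) < r \<Longrightarrow> F y = f y"
  shows "clarke_ge F x d B"
  unfolding clarke_ge_def
proof (intro allI impI)
  fix \<epsilon> :: real assume "\<epsilon> > 0"
  \<comment> \<open>Keeps both ends of the chord, \<open>y\<close> and
    \<open>y + s *\<^sub>R d\<close>, in the ball where the functions agree.\<close>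
  define \<epsilon>' where "\<epsilon>' = min \<epsilon> (r / (1 + norm d))"
  have pos: "1 + norm d > 0" by (simp add: add_pos_nonneg)
  then have "\<epsilon>' > 0" "\<epsilon>' \<le> \<epsilon>" "\<epsilon>' \<le> r / (1 + norm d)" using \<open>\<epsilon> > 0\<close> \<open>r > 0\<close> by (simp_all add: \<epsilon>'_def)
  then have r: "\<epsilon>' + \<epsilon>' * norm d \<le> r" using pos by (simp add: field_simps)
  obtain y s where ys: "norm (y - x) < \<epsilon>'" "0 < s" "s < \<epsilon>'" "(B - \<epsilon>') * s \<le> f (y + s *\<^sub>R d) - f y"
    using assms(1) \<open>\<epsilon>' > 0\<close> unfolding clarke_ge_def by blast
  have "norm (y + s *\<^sub>R d - x) \<le> norm (y - x) + s * norm d"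
    using norm_triangle_ineq[of "y - x" "s *\<^sub>R d"] ys by (simp add: algebra_simps)
  also have "\<dots> < \<epsilon>' + \<epsilon>' * norm d" using ys by (intro add_less_le_mono mult_right_mono) auto
  finally have "F (y + s *\<^sub>R d) = f (y + s *\<^sub>R d)" using r by (intro eq) simp
  moreover have "\<epsilon>' * norm d \<ge> 0" using \<open>\<epsilon>' > 0\<close> by simp
  then have "F y = f y" using ys(1) r by (intro eq) simp
  moreover have "(B - \<epsilon>) * s \<le> (B - \<epsilon>') * s"
    using \<open>\<epsilon>' \<le> \<epsilon>\<close> ys by (intro mult_right_mono) auto
  then have "(B - \<epsilon>) * s \<le> f (y + s *\<^sub>R d) - f y" using ys(4) by (rule order_trans)
  ultimately show "\<exists>y s. norm (y - x) < \<epsilon> \<and> 0 < s \<and> s < \<epsilon> \<and> (B - \<epsilon>) * s \<le> F (y + s *\<^sub>R d) - F y"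
    using ys \<open>\<epsilon>' \<le> \<epsilon>\<close> by (intro exI[of _ y] exI[of _ s]) auto
qed

lemma clarke_subdiff_imp_clarke_ge:
  assumes "v \<in> clarke_subdiff ip f x"
  shows "clarke_ge f x d (ip v d)"
proof (rule ccontr)
  assume "\<not> ?thesis"
  then obtain \<epsilon> where \<epsilon>: "\<epsilon> > 0" "\<And>y s. norm (y - x) < \<epsilon> \<Longrightarrow> 0 < s \<Longrightarrow> s < \<epsilon> \<Longrightarrow>
      f (y + s *\<^sub>R d) - f y < (ip v d - \<epsilon>) * s"
    unfolding clarke_ge_def by (force simp: not_le)
  have "\<forall>\<^sub>F y in nhds x. norm (y - x) < \<epsilon>"
    using \<epsilon>(1) unfolding eventually_nhds_metric dist_norm by blast
  moreover have "\<forall>\<^sub>F s in at_right 0. 0 < s \<and> s < \<epsilon>"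
    using \<epsilon>(1) unfolding eventually_at_right_field by blast
  ultimately have "\<forall>\<^sub>F z in nhds x \<times>\<^sub>F at_right 0. norm (fst z - x) < \<epsilon> \<and> 0 < snd z \<and> snd z < \<epsilon>"
    unfolding eventually_prod_filter by (auto intro!: exI)
  then have "\<forall>\<^sub>F z in nhds x \<times>\<^sub>F at_right 0.
      (case z of (y, t) \<Rightarrow> ereal ((f (y + t *\<^sub>R d) - f y) / t)) \<le> ereal (ip v d - \<epsilon>)"
  proof eventually_elim
    case (elim z)
    then show ?case
      using \<epsilon>(2)[of "fst z" "snd z"] by (auto simp: case_prod_beta divide_le_eq)
  qed
  then have "clarke_dd f x d \<le> ereal (ip v d - \<epsilon>)" unfolding clarke_dd_def by (rule Limsup_bounded)
  moreover have "ereal (ip v d) \<le> clarke_dd f x d" using assms by (simp add: clarke_subdiff_def)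
  ultimately have "ereal (ip v d) \<le> ereal (ip v d - \<epsilon>)" by (rule order_trans[rotated])
  then show False using \<epsilon>(1) by simp
qed

context o_minimal_structure
begin

text \<open>The bound \<open>steep\<close> concerns a sequence of parameters only. Semismoothness
  extends it to the whole germ of the half-line, and differentiability of the curve at 0 carries it
  over to the curve. The three thirds of \<open>\<eta>\<close> pay for the Clarke bound, the
  semismooth bound and the distance between curve and half-line.\<close>

lemma curve_slope:
  fixes F :: "real^'n::finite \<Rightarrow> real"
  assumes F: "definable_fun F" and lip: "L-lipschitz_on UNIV F"
    and diff: "\<And>\<delta>. \<delta> > 0 \<Longrightarrow> \<forall>\<^sub>F \<sigma> in at_right 0. norm (\<gamma> \<sigma> - x - \<sigma> *\<^sub>R d) \<le> \<delta> * \<sigma>"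
    and steep: "\<And>\<delta>. \<delta> > 0 \<Longrightarrow> \<exists>\<sigma>. 0 < \<sigma> \<and> \<sigma> < \<delta> \<and> clarke_ge F (\<gamma> \<sigma>) d (B - \<delta>)"
    and "\<eta> > 0"
  shows "\<forall>\<^sub>F \<sigma> in at_right 0. (B - \<eta>) * \<sigma> \<le> F (\<gamma> \<sigma>) - F x"
proof -
  have L: "L \<ge> 0" using lip by (rule lipschitz_on_nonneg)
  have "\<forall>\<^sub>F t in at_right 0. (B - \<eta> / 3 - \<eta> / 3) * t \<le> F (x + t *\<^sub>R d) - F x"
  proof (rule semismooth_clarke[OF F lip])
    fix \<delta> :: real assume "\<delta> > 0"
    obtain e where e: "e > 0" "\<And>\<sigma>. 0 < \<sigma> \<Longrightarrow> \<sigma> < e \<Longrightarrow> norm (\<gamma> \<sigma> - x - \<sigma> *\<^sub>R d) \<le> \<delta> * \<sigma>"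
      using diff[OF \<open>\<delta> > 0\<close>] unfolding eventually_at_right_field by blast
    obtain \<sigma> where \<sigma>: "0 < \<sigma>" "\<sigma> < min (min \<delta> e) (\<eta> / 3)"
      "clarke_ge F (\<gamma> \<sigma>) d (B - min (min \<delta> e) (\<eta> / 3))"
      using steep[of "min (min \<delta> e) (\<eta> / 3)"] \<open>\<delta> > 0\<close> e(1) \<open>\<eta> > 0\<close> by auto
    have "clarke_ge F (\<gamma> \<sigma>) d (B - \<eta> / 3)" using \<sigma>(3) by (rule clarke_ge_mono) simp
    then show "\<exists>t x'. 0 < t \<and> t < \<delta> \<and> norm (x' - x - t *\<^sub>R d) \<le> \<delta> * t \<and> clarke_ge F x' d (B - \<eta> / 3)"
      using \<sigma>(1,2) e(2)[of \<sigma>] by (intro exI[of _ \<sigma>] exI[of _ "\<gamma> \<sigma>"]) auto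
  qed (use \<open>\<eta> > 0\<close> in simp)
  moreover have "\<eta> / (3 * (L + 1)) > 0" using \<open>\<eta> > 0\<close> L by simp
  from diff[OF this]
  have "\<forall>\<^sub>F \<sigma> in at_right 0. norm (\<gamma> \<sigma> - x - \<sigma> *\<^sub>R d) \<le> \<eta> / (3 * (L + 1)) * \<sigma>" .
  moreover have "\<forall>\<^sub>F \<sigma>::real in at_right 0. 0 < \<sigma>" by (simp add: eventually_at_right_less)
  ultimately show ?thesis
  proof eventually_elim
    case (elim \<sigma>)
    have "\<bar>F (\<gamma> \<sigma>) - F (x + \<sigma> *\<^sub>R d)\<bar> \<le> L * norm (\<gamma> \<sigma> - x - \<sigma> *\<^sub>R d)"
      using lipschitz_onD[OF lip, of "\<gamma> \<sigma>" "x + \<sigma> *\<^sub>R d"] by (simp add: dist_norm algebra_simps)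
    also have "\<dots> \<le> L * (\<eta> / (3 * (L + 1)) * \<sigma>)" using elim(2) L by (rule mult_left_mono)
    also have "\<dots> = (L * (\<eta> / (3 * (L + 1)))) * \<sigma>" by simp
    also have "\<dots> \<le> \<eta> / 3 * \<sigma>" using L \<open>\<eta> > 0\<close> elim(3) by (intro mult_right_mono) (auto simp: field_simps)
    finally have "\<bar>F (\<gamma> \<sigma>) - F (x + \<sigma> *\<^sub>R d)\<bar> \<le> \<eta> / 3 * \<sigma>" .
    moreover have "(B - \<eta>) * \<sigma> = (B - \<eta> / 3 - \<eta> / 3) * \<sigma> - \<eta> / 3 * \<sigma>" by (simp add: algebra_simps)
    ultimately show ?case using elim(1) by linarith
  qed
qed

text \<open>At almost every \<open>t\<close> the subgradient \<open>w = v t\<close> is approached by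
  subgradients \<open>v t'\<close> from both sides. These give Clarke slopes close to
  \<open>c * ip w w\<close> in direction \<open>- d\<close> at \<open>g t'\<close>, where
  \<open>d = - c *\<^sub>R w\<close> is the velocity; \<open>curve_slope\<close> turns them into
  one-sided slopes of \<open>F\<close> along \<open>g\<close>, without any chain rule.\<close>

lemma subgradient_descent:
  fixes F :: "real^'n::finite \<Rightarrow> real" and g :: "real \<Rightarrow> real^'n"
  assumes F: "definable_fun F" and lip: "L-lipschitz_on UNIV F"
    and ip: "is_inner_product ip" and "c > 0"
    and ac: "abs_continuous_on 0 T g" and ab: "0 \<le> a" "a \<le> b" "b \<le> T"
    and ae: "AE t in lebesgue. t \<in> {a..b} \<longrightarrow> (\<exists>w. (g has_vector_derivative - c *\<^sub>R w) (at t within {0..T}) \<and>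
      (\<forall>d. clarke_ge F (g t) d (ip w d)))"
    and \<mu>: "\<And>t w. t \<in> {a..b} \<Longrightarrow> (\<And>d. clarke_ge F (g t) d (ip w d)) \<Longrightarrow> \<mu> \<le> ip w w"
  shows "F (g b) - F (g a) \<le> - (c * \<mu>) * (b - a)"
proof -
  have bil: "bilinear ip" using ip by (simp add: is_inner_product_def)
  obtain C where C: "C > 0" "\<And>x y. \<bar>ip x y\<bar> \<le> C * norm x * norm y"
    using bilinear_bounded_pos[OF bil] by auto
  define good where "good t w \<longleftrightarrow> (g has_vector_derivative - c *\<^sub>R w) (at t within {0..T}) \<and>
      (\<forall>d. clarke_ge F (g t) d (ip w d))" for t w
  \<comment> \<open>Arbitrary choice, with no control over measurability: the limit points needed
    below come from the countability of the exceptional sets \<open>N1\<close> and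
    \<open>N2\<close>.\<close>
  define v where "v t = (SOME w. good t w)" for t
  define Z where "Z = {t. a < t \<and> t < b \<and> good t (v t)}"
  define N1 where "N1 = {t \<in> Z. \<exists>e>0. \<forall>t'\<in>Z. t < t' \<and> t' < t + e \<longrightarrow> e \<le> dist (v t') (v t)}"
  define N2 where "N2 = {t \<in> Z. \<exists>e>0. \<forall>t'\<in>Z. t - e < t' \<and> t' < t \<longrightarrow> e \<le> dist (v t') (v t)}"
  obtain N0 where N0: "N0 \<in> null_sets lebesgue" "{t. \<not> (t \<in> {a..b} \<longrightarrow> (\<exists>w. good t w))} \<subseteq> N0"
    using ae unfolding eventually_ae_filter good_def[symmetric] by auto
  have "countable (N1 \<union> N2 \<union> {a, b})"
    unfolding N1_def N2_def by (intro countable_Un countable_not_right_limit countable_not_left_limit) simp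
  then have "negligible (N1 \<union> N2 \<union> {a, b})" 
    by (simp add: negligible_iff_null_sets null_sets_completionI countable_imp_null_set_lborel)
  moreover have "negligible N0" using N0(1) by (simp add: negligible_iff_null_sets)
  ultimately have neg: "negligible (N0 \<union> (N1 \<union> N2 \<union> {a, b}))" by simp
  show ?thesis
  proof (rule increment_le_if_ae[OF abs_continuous_on_lipschitz[OF ac lip] ab neg])
    fix t \<eta> :: real
    assume t: "t \<in> {a..b} - (N0 \<union> (N1 \<union> N2 \<union> {a, b}))" and "\<eta> > 0"
    then have "\<exists>w. good t w" using N0(2) by blast
    then have good: "good t (v t)" unfolding v_def by (rule someI_ex)
    then have tZ: "t \<in> Z" using t by (auto simp: Z_def)
    define w where "w = v t"
    define d where "d = - c *\<^sub>R w"
    have "0 < t" "t < T" using t ab by auto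
    then have "(g has_vector_derivative d) (at t)"
      using good at_within_Icc_at[of 0 t T] by (simp add: good_def d_def w_def)
    then have deriv: "\<exists>e>0. \<forall>s. \<bar>s - t\<bar> < e \<longrightarrow> norm (g s - g t - (s - t) *\<^sub>R d) \<le> \<delta> * \<bar>s - t\<bar>"
      if "\<delta> > 0" for \<delta>
      using that unfolding has_vector_derivative_def has_derivative_at_alt by simp
    have ipd: "ip w (- d) = c * ip w w" "ip (v s) (- d) \<ge> ip w (- d) - C * dist (v s) w * norm d" for s
    proof -
      show "ip w (- d) = c * ip w w" using bil by (simp add: d_def bilinear_rmul)
      have "ip (v s - w) (- d) = ip (v s) (- d) - ip w (- d)" using bil by (simp add: bilinear_lsub)
      then show "ip (v s) (- d) \<ge> ip w (- d) - C * dist (v s) w * norm d"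
        using C(2)[of "v s - w" "- d"] by (simp add: dist_norm abs_le_iff)
    qed
    \<comment> \<open>\<open>C\<close> is the bound of the bilinear form; the tolerance on
      \<open>dist (v s) w\<close> limits the change of \<open>ip (v s) (- d)\<close> to
      \<open>\<delta>\<close>.\<close>
    have steep: "clarke_ge F (g s) (- d) (c * ip w w - \<delta>)"
      if "s \<in> Z" "dist (v s) w \<le> \<delta> / (C * norm d + 1)" "\<delta> > 0" for s \<delta>
    proof (rule clarke_ge_mono)
      show "clarke_ge F (g s) (- d) (ip (v s) (- d))" using that(1) by (simp add: Z_def good_def)
      have "C * norm d \<ge> 0" using C(1) by simp
      have "C * dist (v s) w * norm d = (C * norm d) * dist (v s) w" by simp
      also have "\<dots> \<le> (C * norm d) * (\<delta> / (C * norm d + 1))"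
        using that(2) \<open>C * norm d \<ge> 0\<close> by (rule mult_left_mono)
      also have "\<dots> \<le> \<delta>" using \<open>C * norm d \<ge> 0\<close> that(3) by (simp add: field_simps add_nonneg_pos)
      finally show "c * ip w w - \<delta> \<le> ip (v s) (- d)" using ipd(2)[of s] ipd(1) by simp
    qed
    have close: "\<delta> / (C * norm d + 1) > 0" if "\<delta> > 0" for \<delta>
      using that C(1) by (simp add: add_nonneg_pos)
    have right: "\<exists>t'\<in>Z. t < t' \<and> t' < t + e \<and> dist (v t') (v t) < e" if "e > 0" for e
    proof (rule ccontr)
      assume "\<not> ?thesis"
      then have "\<forall>t'\<in>Z. t < t' \<and> t' < t + e \<longrightarrow> e \<le> dist (v t') (v t)" by (meson not_le)
      then have "t \<in> N1" unfolding N1_def using tZ that by blast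
      then show False using t by blast
    qed
    have left: "\<exists>t'\<in>Z. t - e < t' \<and> t' < t \<and> dist (v t') (v t) < e" if "e > 0" for e
    proof (rule ccontr)
      assume "\<not> ?thesis"
      then have "\<forall>t'\<in>Z. t - e < t' \<and> t' < t \<longrightarrow> e \<le> dist (v t') (v t)" by (meson not_le)
      then have "t \<in> N2" unfolding N2_def using tZ that by blast
      then show False using t by blast
    qed
    have "\<forall>\<^sub>F \<sigma> in at_right 0. (c * ip w w - \<eta>) * \<sigma> \<le> - F (g (t + \<sigma>)) - - F (g t)"
    \<comment> \<open>Forward in time the curve leaves \<open>g t\<close> in direction
      \<open>d\<close>, in which \<open>F\<close> should fall; the rule needs ascent, so it is
      applied to \<open>- F\<close>.\<close>
    proof (rule curve_slope[OF definable_uminus[OF F] lipschitz_on_minus[OF lip] _ _ \<open>\<eta> > 0\<close>, where d = d])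
      fix \<delta> :: real assume "\<delta> > 0"
      obtain e where e: "e > 0" "\<And>s. \<bar>s - t\<bar> < e \<Longrightarrow> norm (g s - g t - (s - t) *\<^sub>R d) \<le> \<delta> * \<bar>s - t\<bar>"
        using deriv[OF \<open>\<delta> > 0\<close>] by blast
      show "\<forall>\<^sub>F \<sigma> in at_right 0. norm (g (t + \<sigma>) - g t - \<sigma> *\<^sub>R d) \<le> \<delta> * \<sigma>"
        unfolding eventually_at_right_field
      proof (intro exI[of _ e] conjI allI impI)
        fix \<sigma> assume "0 < \<sigma>" "\<sigma> < e"
        then show "norm (g (t + \<sigma>) - g t - \<sigma> *\<^sub>R d) \<le> \<delta> * \<sigma>" using e(2)[of "t + \<sigma>"] by simp
      qed (rule e(1))
      have "\<exists>t'\<in>Z. t < t' \<and> t' < t + min \<delta> (\<delta> / (C * norm d + 1)) \<and>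
          dist (v t') (v t) < min \<delta> (\<delta> / (C * norm d + 1))"
        using close[OF \<open>\<delta> > 0\<close>] \<open>\<delta> > 0\<close> by (intro right) simp
      then obtain t' where t': "t' \<in> Z" "t < t'" "t' < t + \<delta>" "dist (v t') w \<le> \<delta> / (C * norm d + 1)"
        by (auto simp: w_def)
      then show "\<exists>\<sigma>. 0 < \<sigma> \<and> \<sigma> < \<delta> \<and> clarke_ge (\<lambda>x. - F x) (g (t + \<sigma>)) d (c * ip w w - \<delta>)"
        using clarke_ge_uminus[OF steep[OF t'(1,4) \<open>\<delta> > 0\<close>]] by (intro exI[of _ "t' - t"]) auto
    qed
    moreover have "\<forall>\<^sub>F \<sigma> in at_right 0. (c * ip w w - \<eta>) * \<sigma> \<le> F (g (t - \<sigma>)) - F (g t)"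
    \<comment> \<open>Backward in time the curve leaves \<open>g t\<close> in direction
      \<open>- d\<close>, in which \<open>F\<close> itself ascends.\<close>
    proof (rule curve_slope[OF F lip _ _ \<open>\<eta> > 0\<close>, where d = "- d"])
      fix \<delta> :: real assume "\<delta> > 0"
      obtain e where e: "e > 0" "\<And>s. \<bar>s - t\<bar> < e \<Longrightarrow> norm (g s - g t - (s - t) *\<^sub>R d) \<le> \<delta> * \<bar>s - t\<bar>"
        using deriv[OF \<open>\<delta> > 0\<close>] by blast
      show "\<forall>\<^sub>F \<sigma> in at_right 0. norm (g (t - \<sigma>) - g t - \<sigma> *\<^sub>R - d) \<le> \<delta> * \<sigma>"
        unfolding eventually_at_right_field
      proof (intro exI[of _ e] conjI allI impI)
        fix \<sigma> assume "0 < \<sigma>" "\<sigma> < e"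
        then show "norm (g (t - \<sigma>) - g t - \<sigma> *\<^sub>R - d) \<le> \<delta> * \<sigma>" using e(2)[of "t - \<sigma>"] by simp
      qed (rule e(1))
      have "\<exists>t'\<in>Z. t - min \<delta> (\<delta> / (C * norm d + 1)) < t' \<and> t' < t \<and>
          dist (v t') (v t) < min \<delta> (\<delta> / (C * norm d + 1))"
        using close[OF \<open>\<delta> > 0\<close>] \<open>\<delta> > 0\<close> by (intro left) simp
      then obtain t' where t': "t' \<in> Z" "t' < t" "t - \<delta> < t'" "dist (v t') w \<le> \<delta> / (C * norm d + 1)"
        by (auto simp: w_def)
      then show "\<exists>\<sigma>. 0 < \<sigma> \<and> \<sigma> < \<delta> \<and> clarke_ge F (g (t - \<sigma>)) (- d) (c * ip w w - \<delta>)"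
        using steep[OF t'(1,4) \<open>\<delta> > 0\<close>] by (intro exI[of _ "t - t'"]) auto
    qed
    ultimately have "\<forall>\<^sub>F \<sigma> in at_right 0. F (g (t + \<sigma>)) - F (g t) \<le> (- (c * \<mu>) + \<eta>) * \<sigma> \<and>
        F (g t) - F (g (t - \<sigma>)) \<le> (- (c * \<mu>) + \<eta>) * \<sigma>"
      using eventually_at_right_less[of "0 :: real"]
    proof eventually_elim
      case (elim \<sigma>)
      have "\<mu> \<le> ip w w" using good t by (intro \<mu>[of t]) (auto simp: good_def w_def)
      then have "c * \<mu> - \<eta> \<le> c * ip w w - \<eta>" using \<open>c > 0\<close> by simp
      then have "(c * \<mu> - \<eta>) * \<sigma> \<le> (c * ip w w - \<eta>) * \<sigma>"
        using elim(3) by (intro mult_right_mono) auto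
      moreover have "(- (c * \<mu>) + \<eta>) * \<sigma> = - ((c * \<mu> - \<eta>) * \<sigma>)" by (simp add: algebra_simps)
      ultimately show ?case using elim(1,2) by linarith
    qed
    then obtain \<delta> where \<delta>: "\<delta> > 0" "\<And>\<sigma>. 0 < \<sigma> \<Longrightarrow> \<sigma> < \<delta> \<Longrightarrow>
        F (g (t + \<sigma>)) - F (g t) \<le> (- (c * \<mu>) + \<eta>) * \<sigma> \<and>
        F (g t) - F (g (t - \<sigma>)) \<le> (- (c * \<mu>) + \<eta>) * \<sigma>"
      unfolding eventually_at_right_field by blast
    show "\<exists>\<delta>>0. \<forall>u s. a \<le> u \<and> u \<le> t \<and> t \<le> s \<and> s \<le> b \<and> s - u < \<delta> \<longrightarrow>
        F (g s) - F (g u) \<le> (- (c * \<mu>) + \<eta>) * (s - u)"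
    proof (intro exI[of _ \<delta>] conjI allI impI)
      fix u s assume us: "a \<le> u \<and> u \<le> t \<and> t \<le> s \<and> s \<le> b \<and> s - u < \<delta>"
      have "F (g s) - F (g t) \<le> (- (c * \<mu>) + \<eta>) * (s - t)"
        using \<delta>(2)[of "s - t"] us by (cases "s = t") auto
      moreover have "F (g t) - F (g u) \<le> (- (c * \<mu>) + \<eta>) * (t - u)"
        using \<delta>(2)[of "t - u"] us by (cases "t = u") auto
      ultimately show "F (g s) - F (g u) \<le> (- (c * \<mu>) + \<eta>) * (s - u)" by (simp add: algebra_simps)
    qed (rule \<delta>(1))
  qed
qed

text \<open>Tameness controls the graph only inside balls of \<open>ipg\<close>. Composing
  \<open>f\<close> with the coordinatewise clamp \<open>cl\<close> onto a small box confines the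
  graph to one such ball; the clamp is definable and 1-Lipschitz, so definability and the local
  Lipschitz constant become global.\<close>

lemma definable_extension:
  fixes f :: "real^'n::finite \<Rightarrow> real" and ipg :: "(real^'n) \<times> real \<Rightarrow> (real^'n) \<times> real \<Rightarrow> real"
  assumes idx: "distinct idx" "set idx = UNIV" and ipg: "is_inner_product ipg"
    and lip: "locally_lipschitz f" and tame: "tame_fun S idx ipg f"
  obtains F L \<rho> where "definable_fun F" "L-lipschitz_on UNIV F" "\<rho> > 0" "\<And>x. norm (x - a) < \<rho> \<Longrightarrow> F x = f x"
proof -
  obtain r L where r: "r > 0" "L-lipschitz_on (cball a r) f"
    using lip unfolding locally_lipschitz_def by blast
  have L: "L \<ge> 0" using r(2) by (rule lipschitz_on_nonneg)
  obtain B where B: "B > 0" "\<And>z z'. \<bar>ipg z z'\<bar> \<le> B * norm z * norm z'"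
    using bilinear_bounded_pos[of ipg] ipg unfolding is_inner_product_def by auto
  define N where "N = CARD('n)"
  have len: "length idx = N" using distinct_card[OF idx(1)] idx(2) by (simp add: N_def)
  define A where "A = {(x, f x) | x. True} \<inter> ip_cball ipg (a, f a) 1"
  have "(\<lambda>(x, y). coords idx x @ [y]) ` A \<in> S (Suc N)"
    using tame unfolding tame_fun_def tame_set_def A_def N_def by simp
  \<comment> \<open>The position of the coordinate \<open>j\<close> in \<open>idx\<close>.\<close>
  define p where "p j = (THE i. i < N \<and> idx ! i = j)" for j
  have p: "p j < N \<and> idx ! p j = j" for j
  proof -
    have "\<exists>!i. i < N \<and> idx ! i = j"
      using idx len by (metis UNIV_I distinct_Ex1)
    then show ?thesis unfolding p_def by (rule theI')
  qed
  have p_idx: "p (idx ! i) = i" if "i < N" for i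
    using p[of "idx ! i"] that idx(1) len by (metis nth_eq_iff_index_eq)
  have "{xs. length xs = Suc N \<and> ((\<chi> j. xs ! p j), xs ! N) \<in> A} = (\<lambda>(x, y). coords idx x @ [y]) ` A" (is "?l = ?r")
  proof (intro equalityI subsetI)
    fix xs assume xs: "xs \<in> ?l"
    have "xs = coords idx (\<chi> j. xs ! p j) @ [xs ! N]"
    proof (rule nth_equalityI)
      show "length xs = length (coords idx (\<chi> j. xs ! p j) @ [xs ! N])"
        using xs by (simp add: coords_def len)
      fix i assume "i < length xs"
      then show "xs ! i = (coords idx (\<chi> j. xs ! p j) @ [xs ! N]) ! i"
        using xs p_idx by (auto simp: coords_def nth_append len less_Suc_eq)
    qed
    then show "xs \<in> ?r" using xs by (intro image_eqI[of _ _ "((\<chi> j. xs ! p j), xs ! N)"]) auto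
  next
    fix xs assume "xs \<in> ?r"
    then obtain x y where xy: "(x, y) \<in> A" "xs = coords idx x @ [y]" by auto
    have "(\<chi> j. xs ! p j) = x"
      using p by (auto simp: vec_eq_iff xy(2) coords_def nth_append len)
    moreover have "xs ! N = y" by (simp add: xy(2) coords_def nth_append len)
    ultimately show "xs \<in> ?l" using xy by (simp add: coords_def len)
  qed
  then have "{xs. length xs = Suc N \<and> ((\<chi> j. xs ! p j), xs ! N) \<in> A} \<in> S (Suc N)"
    using \<open>_ \<in> S (Suc N)\<close> by simp
  moreover have "(\<chi> j. e (p j)) = (\<chi> j. e' (p j)) \<and> e N = e' N" if "\<forall>i<Suc N. e i = e' i"
    for e e' :: "nat \<Rightarrow> real"
    using that p by (auto simp: vec_eq_iff less_Suc_eq)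
  ultimately have "cyl (Suc N) (\<lambda>e. ((\<chi> j. e (p j)), e N) \<in> A)"
    unfolding cyl_def by (metis (no_types, lifting))
  then have graph: "definable_pred (\<lambda>e. ((\<chi> j. e (p j)), e N) \<in> A)" unfolding definable_pred_def by blast
  have graph': "definable_pred (\<lambda>e. ((\<chi> j. h j e), k e) \<in> A)" if "\<And>j. definable_term (h j)" "definable_term k" for h k
  proof -
    have "definable_term (if i < N then h (idx ! i) else k)" for i using that by simp
    from pred_subst[OF graph, of "\<lambda>i. if i < N then h (idx ! i) else k", OF this]
    show ?thesis using p by simp
  qed
  \<comment> \<open>Division by \<open>N\<close> accounts for the sum-norm bound over the box. The
    first term keeps the box where \<open>f\<close> is Lipschitz; the second keeps graph points
    within norm \<open>1 / sqrt B\<close> of \<open>(a, f a)\<close>, hence in the unit ball of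
    \<open>ipg\<close>.\<close>
  define \<rho> where "\<rho> = min r (1 / ((1 + L) * sqrt B)) / N"
  have "N > 0" by (simp add: N_def)
  then have "\<rho> > 0" using r(1) B(1) L by (simp add: \<rho>_def)
  define cl where "cl x = (\<chi> j. max (a $ j - \<rho>) (min (a $ j + \<rho>) (x $ j)))" for x
  have cl_near: "norm (cl x - a) \<le> min r (1 / ((1 + L) * sqrt B))" for x
  proof -
    have "norm (cl x - a) \<le> (\<Sum>j\<in>UNIV. \<bar>(cl x - a) $ j\<bar>)" by (rule norm_le_l1_cart)
    also have "\<dots> \<le> (\<Sum>j\<in>(UNIV :: 'n set). \<rho>)"
      using \<open>\<rho> > 0\<close> by (intro sum_mono) (auto simp: cl_def)
    also have "\<dots> = min r (1 / ((1 + L) * sqrt B))" using \<open>N > 0\<close> by (simp add: \<rho>_def N_def)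
    finally show ?thesis .
  qed
  have in_cball: "cl x \<in> cball a r" for x
    using cl_near[of x] by (simp add: dist_norm norm_minus_commute)
  have in_A: "(cl x, f (cl x)) \<in> A" for x
  proof -
    let ?z = "(cl x, f (cl x)) - (a, f a)"
    have "\<bar>f (cl x) - f a\<bar> \<le> L * norm (cl x - a)"
      using lipschitz_onD[OF r(2) in_cball, of a x] r(1) by (simp add: dist_norm)
    then have "norm ?z \<le> (1 + L) * norm (cl x - a)"
      using norm_Pair_le[of "cl x - a" "f (cl x) - f a"] by (simp add: algebra_simps)
    also have "\<dots> \<le> (1 + L) * (1 / ((1 + L) * sqrt B))"
      using cl_near[of x] L by (intro mult_left_mono) auto
    also have "\<dots> = 1 / sqrt B" using L by simp
    finally have z: "norm ?z \<le> 1 / sqrt B" .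
    have "ipg ?z ?z \<le> B * norm ?z * norm ?z" using B(2)[of ?z ?z] by (simp add: abs_le_iff)
    also have "\<dots> = (sqrt B * norm ?z)\<^sup>2" using B(1) by (simp add: power2_eq_square algebra_simps)
    also have "\<dots> \<le> 1\<^sup>2"
      using z B(1) by (intro power_mono) (auto simp: field_simps)
    finally have "ip_norm ipg ?z \<le> 1" by (simp add: ip_norm_def)
    then show ?thesis by (auto simp: A_def ip_cball_def)
  qed
  define F where "F x = f (cl x)" for x
  have F_iff: "y = F x \<longleftrightarrow> (cl x, y) \<in> A" for x y
    using in_A[of x] by (auto simp: A_def F_def)
  have "definable_fun F"
    unfolding definable_fun_def definable_term_def F_iff cl_def max_def min_def
    by (intro graph' definable_intros term_if)
  moreover have "L-lipschitz_on UNIV F"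
  proof (rule lipschitz_onI)
    fix x y
    have "dist (F x) (F y) \<le> L * dist (cl x) (cl y)"
      unfolding F_def by (rule lipschitz_onD[OF r(2) in_cball in_cball])
    also have "dist (cl x) (cl y) \<le> dist x y"
      unfolding dist_norm by (rule norm_le_componentwise_cart) (auto simp: cl_def)
    finally show "dist (F x) (F y) \<le> L * dist x y" using L by (simp add: mult_left_mono)
  qed (rule L)
  moreover have "F x = f x" if "norm (x - a) < \<rho>" for x
  proof -
    have "cl x $ j = x $ j" for j
      using component_le_norm_cart[of "x - a" j] that by (auto simp: cl_def max_def min_def)
    then have "cl x = x" by (simp add: vec_eq_iff)
    then show ?thesis by (simp add: F_def)
  qed
  ultimately show ?thesis using \<open>\<rho> > 0\<close> that by blast
qed

end

section \<open>Stability\<close>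

lemma ip_norm_equiv:
  fixes ip :: "real^'n::finite \<Rightarrow> real^'n \<Rightarrow> real"
  assumes ip: "is_inner_product ip"
  obtains m M where "m > 0" "M > 0" "\<And>x. m * norm x \<le> ip_norm ip x" "\<And>x. ip_norm ip x \<le> M * norm x"
proof -
  have bil: "bilinear ip" using ip by (simp add: is_inner_product_def)
  obtain B where B: "B > 0" "\<And>x y. \<bar>ip x y\<bar> \<le> B * norm x * norm y"
    using bilinear_bounded_pos[OF bil] by auto
  have "ip_norm ip x \<le> sqrt B * norm x" for x
  proof -
    have "ip x x \<le> B * norm x * norm x" using B(2)[of x x] by (simp add: abs_le_iff)
    also have "\<dots> = (sqrt B * norm x)\<^sup>2" using B(1) by (simp add: power2_eq_square algebra_simps)
    finally show ?thesis unfolding ip_norm_def using B(1) by (intro real_le_lsqrt) auto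
  qed
  moreover obtain m where m: "m > 0" "\<And>x. m * norm x \<le> ip_norm ip x"
  proof -
    have "bounded_bilinear ip" using bil by (simp add: bilinear_conv_bounded_bilinear)
    then have "continuous_on (sphere 0 1) (\<lambda>x. ip x x)"
      by (intro bounded_bilinear.continuous_on[of ip] continuous_intros)
    moreover have "sphere (0 :: real^'n) 1 \<noteq> {}" by simp
    ultimately obtain u where u: "u \<in> sphere 0 1" "\<And>x. x \<in> sphere 0 1 \<Longrightarrow> ip u u \<le> ip x x"
      using continuous_attains_inf[of "sphere (0 :: real^'n) 1" "\<lambda>x. ip x x"] by auto
    have "u \<noteq> 0" using u(1) by auto
    then have pos: "ip u u > 0" using ip by (simp add: is_inner_product_def)
    have "sqrt (ip u u) * norm x \<le> ip_norm ip x" for x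
    proof (cases "x = 0")
      case True
      then show ?thesis using bil by (simp add: ip_norm_def bilinear_lzero)
    next
      case False
      define y where "y = x /\<^sub>R norm x"
      have "y \<in> sphere 0 1" using False by (simp add: y_def)
      then have "ip u u \<le> ip y y" by (rule u(2))
      then have "ip u u * (norm x)\<^sup>2 \<le> ip y y * (norm x)\<^sup>2" by (rule mult_right_mono) simp
      also have "\<dots> = ip (norm x *\<^sub>R y) (norm x *\<^sub>R y)"
        using bil by (simp add: bilinear_lmul bilinear_rmul power2_eq_square)
      also have "norm x *\<^sub>R y = x" using False by (simp add: y_def)
      finally have "sqrt (ip u u * (norm x)\<^sup>2) \<le> sqrt (ip x x)" by (rule real_sqrt_le_mono)
      then show ?thesis by (simp add: ip_norm_def real_sqrt_mult)
    qed
    then show thesis using pos by (intro that[of "sqrt (ip u u)"]) auto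
  qed
  ultimately show ?thesis using B(1) by (intro that[of m "sqrt B"]) auto
qed

text \<open>The Clarke subdifferential has closed graph: points with levels tending to
  \<open>r\<close> and subgradients tending to 0 would accumulate at a critical point of level
  \<open>r\<close>. A single \<open>\<eta>\<close> serves both as width of the band of levels and as
  lower bound for \<open>ip w w\<close>.\<close>

lemma uniformly_noncritical:
  fixes F :: "real^'n::finite \<Rightarrow> real"
  assumes ip: "is_inner_product ip" and "compact X" and cont: "continuous_on X F"
    and noncrit: "\<And>x. x \<in> X \<Longrightarrow> F x = r \<Longrightarrow> \<exists>d. \<not> clarke_ge F x d 0"
  shows "\<exists>\<eta>>0. \<forall>x w. x \<in> X \<and> \<bar>F x - r\<bar> \<le> \<eta> \<and> (\<forall>d. clarke_ge F x d (ip w d)) \<longrightarrow> \<eta> \<le> ip w w"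
proof (rule ccontr)
  assume "\<not> ?thesis"
  then have "\<exists>x w. x \<in> X \<and> \<bar>F x - r\<bar> \<le> \<eta> \<and> (\<forall>d. clarke_ge F x d (ip w d)) \<and> ip w w < \<eta>"
    if "\<eta> > 0" for \<eta>
    using that by (meson not_le)
  then have "\<exists>x w. x \<in> X \<and> \<bar>F x - r\<bar> \<le> inverse (Suc k) \<and> (\<forall>d. clarke_ge F x d (ip w d)) \<and>
      ip w w < inverse (Suc k)" for k by simp
  then obtain x w where xw: "\<And>k. x k \<in> X" "\<And>k. \<bar>F (x k) - r\<bar> \<le> inverse (Suc k)"
    "\<And>k d. clarke_ge F (x k) d (ip (w k) d)" "\<And>k. ip (w k) (w k) < inverse (Suc k)" by metis
  obtain l \<rho> where l: "l \<in> X" "strict_mono \<rho>" "(x \<circ> \<rho>) \<longlonglongrightarrow> l"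
    using seq_compactE[of X x] \<open>compact X\<close> xw(1) by (metis compact_imp_seq_compact)
  have "(\<lambda>k. F (x (\<rho> k))) \<longlonglongrightarrow> F l"
    using continuous_on_tendsto_compose[OF cont l(3,1)] xw(1) by (simp add: o_def)
  moreover have "(\<lambda>k. F (x k) - r) \<longlonglongrightarrow> 0"
    using xw(2) by (intro Lim_null_comparison[OF _ LIMSEQ_inverse_real_of_nat]) auto
  then have "(\<lambda>k. F (x k)) \<longlonglongrightarrow> r" by (simp add: LIM_zero_iff)
  then have "(\<lambda>k. F (x (\<rho> k))) \<longlonglongrightarrow> r" using LIMSEQ_subseq_LIMSEQ[OF _ l(2)] by (auto simp: o_def)
  ultimately have "F l = r" by (rule LIMSEQ_unique)
  then obtain d where "\<not> clarke_ge F l d 0" using noncrit l(1) by blast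
  then obtain \<epsilon> where \<epsilon>: "\<epsilon> > 0" "\<And>y s. norm (y - l) < \<epsilon> \<Longrightarrow> 0 < s \<Longrightarrow> s < \<epsilon> \<Longrightarrow>
      F (y + s *\<^sub>R d) - F y < - \<epsilon> * s"
    unfolding clarke_ge_def by (force simp: not_le)
  have bil: "bilinear ip" using ip by (simp add: is_inner_product_def)
  obtain C where C: "C > 0" "\<And>x y. \<bar>ip x y\<bar> \<le> C * norm x * norm y"
    using bilinear_bounded_pos[OF bil] by auto
  obtain m M where m: "m > 0" "\<And>x. m * norm x \<le> ip_norm ip x" using ip_norm_equiv[OF ip] by metis
  have "(\<lambda>k. sqrt (inverse (real (Suc k)))) \<longlonglongrightarrow> sqrt 0"
    by (intro tendsto_real_sqrt LIMSEQ_inverse_real_of_nat)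
  then have "(\<lambda>k. C * (sqrt (inverse (real (Suc k))) / m) * norm d) \<longlonglongrightarrow> C * (sqrt 0 / m) * norm d"
    by (rule tendsto_mult_right[OF tendsto_mult_left[OF tendsto_divide[OF _ tendsto_const]]])
      (use m(1) in simp)
  then have "(\<lambda>k. C * (sqrt (inverse (real (Suc k))) / m) * norm d) \<longlonglongrightarrow> 0" by simp
  from LIMSEQ_subseq_LIMSEQ[OF this l(2)]
  have "(\<lambda>k. C * (sqrt (inverse (real (Suc (\<rho> k)))) / m) * norm d) \<longlonglongrightarrow> 0" by (simp add: o_def)
  then have "\<forall>\<^sub>F k in sequentially. C * (sqrt (inverse (real (Suc (\<rho> k)))) / m) * norm d < \<epsilon> / 2"
    by (rule order_tendstoD(2)) (use \<epsilon>(1) in simp)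
  moreover have "\<forall>\<^sub>F k in sequentially. dist (x (\<rho> k)) l < \<epsilon> / 2"
    using tendstoD[OF l(3), of "\<epsilon> / 2"] \<epsilon>(1) by simp
  ultimately have "\<forall>\<^sub>F k in sequentially. C * (sqrt (inverse (real (Suc (\<rho> k)))) / m) * norm d < \<epsilon> / 2 \<and>
      dist (x (\<rho> k)) l < \<epsilon> / 2" by (rule eventually_conj)
  then obtain k where k: "C * (sqrt (inverse (real (Suc (\<rho> k)))) / m) * norm d < \<epsilon> / 2" "dist (x (\<rho> k)) l < \<epsilon> / 2"
    using eventually_happens'[OF sequentially_bot] by blast
  have "m * norm (w (\<rho> k)) \<le> sqrt (inverse (real (Suc (\<rho> k))))"
    using m(2)[of "w (\<rho> k)"] real_sqrt_less_mono[OF xw(4)[of "\<rho> k"]]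
    unfolding ip_norm_def by linarith
  then have "norm (w (\<rho> k)) \<le> sqrt (inverse (real (Suc (\<rho> k)))) / m"
    using m(1) by (simp add: field_simps)
  then have "C * norm (w (\<rho> k)) * norm d \<le> C * (sqrt (inverse (real (Suc (\<rho> k)))) / m) * norm d"
    using C(1) by (intro mult_right_mono mult_left_mono) auto
  then have small: "- (\<epsilon> / 2) \<le> ip (w (\<rho> k)) d" using C(2)[of "w (\<rho> k)" d] k(1) by linarith
  have "\<epsilon> / 2 > 0" using \<epsilon>(1) by simp
  then obtain y s where ys: "norm (y - x (\<rho> k)) < \<epsilon> / 2" "0 < s" "s < \<epsilon> / 2"
      "(ip (w (\<rho> k)) d - \<epsilon> / 2) * s \<le> F (y + s *\<^sub>R d) - F y"
    using xw(3)[of "\<rho> k" d] unfolding clarke_ge_def by blast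
  have "norm (y - l) < \<epsilon>"
    using norm_triangle_ineq[of "y - x (\<rho> k)" "x (\<rho> k) - l"] ys(1) k(2) by (simp add: dist_norm)
  then have "F (y + s *\<^sub>R d) - F y < - \<epsilon> * s" using ys by (intro \<epsilon>(2)) auto
  moreover have "- \<epsilon> * s \<le> (ip (w (\<rho> k)) d - \<epsilon> / 2) * s"
    using small ys(2) by (intro mult_right_mono) auto
  ultimately show False using ys(4) by linarith
qed

lemma first_hitting_time:
  fixes \<phi> :: "real \<Rightarrow> real"
  assumes "continuous_on {0..T} \<phi>" "\<phi> 0 < R" "0 \<le> t" "t \<le> T" "R \<le> \<phi> t"
  obtains t1 where "0 \<le> t1" "t1 \<le> t" "\<phi> t1 = R" "\<And>s. 0 \<le> s \<Longrightarrow> s \<le> t1 \<Longrightarrow> \<phi> s \<le> R"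
proof -
  have cont: "continuous_on {0..u} \<phi>" if "u \<le> t" for u
    using assms(1) by (rule continuous_on_subset) (use that assms in auto)
  define H where "H = {s \<in> {0..t}. \<phi> s = R}"
  have "closed H" unfolding H_def by (intro continuous_closed_preimage_constant cont) auto
  then have "compact H"
    by (auto simp: compact_eq_bounded_closed H_def intro: bounded_subset[OF bounded_closed_interval])
  moreover have "H \<noteq> {}"
    using IVT'[of \<phi> 0 R t] cont[of t] assms unfolding H_def by force
  ultimately obtain t1 where t1: "t1 \<in> H" "\<And>s. s \<in> H \<Longrightarrow> t1 \<le> s" using compact_attains_inf by metis
  have "\<phi> s \<le> R" if s: "0 \<le> s" "s \<le> t1" for s
  proof (rule ccontr)
    assume gt: "\<not> \<phi> s \<le> R"
    then obtain u where "0 \<le> u" "u \<le> s" "\<phi> u = R"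
      using IVT'[of \<phi> 0 R s] cont[of s] assms(2) s t1(1) by (force simp: H_def)
    then have "t1 \<le> u" using t1(1) s by (intro t1(2)) (auto simp: H_def)
    then have "s = t1" using \<open>u \<le> s\<close> s by simp
    then show False using gt t1(1) by (simp add: H_def)
  qed
  then show ?thesis using t1(1) by (intro that[of t1]) (auto simp: H_def)
qed

context o_minimal_structure
begin

text \<open>Transfers \<open>subgradient_descent\<close> from \<open>F\<close> to trajectories of
  \<open>f\<close>: while the curve stays within \<open>R\<close> of \<open>a\<close>, subgradients
  of \<open>f\<close> give the Clarke bounds for \<open>F\<close>.\<close>

lemma trajectory_descent:
  fixes F :: "real^'n::finite \<Rightarrow> real"
  assumes F: "definable_fun F" and lip: "L-lipschitz_on UNIV F"
    and ip: "is_inner_product ip" and "c > 0"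
    and eq: "\<And>x. norm (x - a) < \<rho> \<Longrightarrow> F x = f x" and "R < \<rho>"
    and g: "subgradient_trajectory ip f c T g"
    and st: "0 \<le> s" "s \<le> t" "t \<le> T" and near: "\<And>u. s \<le> u \<Longrightarrow> u \<le> t \<Longrightarrow> norm (g u - a) \<le> R"
    and \<mu>: "\<And>u w. s \<le> u \<Longrightarrow> u \<le> t \<Longrightarrow> (\<And>d. clarke_ge F (g u) d (ip w d)) \<Longrightarrow> \<mu> \<le> ip w w"
  shows "F (g t) - F (g s) \<le> - (c * \<mu>) * (t - s)"
proof (rule subgradient_descent[OF F lip ip \<open>c > 0\<close> _ st])
  show "abs_continuous_on 0 T g" using g by (simp add: subgradient_trajectory_def)
  have "AE u in lebesgue. u \<in> {0..T} \<longrightarrow>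
        (\<exists>v. (g has_vector_derivative v) (at u within {0..T}) \<and>
             v \<in> (\<lambda>s. (- c) *\<^sub>R s) ` clarke_subdiff ip f (g u))"
    using g by (simp add: subgradient_trajectory_def)
  then show "AE u in lebesgue. u \<in> {s..t} \<longrightarrow> (\<exists>w. (g has_vector_derivative - c *\<^sub>R w) (at u within {0..T}) \<and>
      (\<forall>d. clarke_ge F (g u) d (ip w d)))"
  proof (rule AE_mp, intro AE_I2 impI)
    fix u assume u: "u \<in> {s..t}" and *: "u \<in> {0..T} \<longrightarrow>
        (\<exists>v. (g has_vector_derivative v) (at u within {0..T}) \<and>
             v \<in> (\<lambda>s. (- c) *\<^sub>R s) ` clarke_subdiff ip f (g u))"
    then obtain w where w: "(g has_vector_derivative - c *\<^sub>R w) (at u within {0..T})"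
      "w \<in> clarke_subdiff ip f (g u)" using st by auto
    have "clarke_ge F (g u) d (ip w d)" for d
    proof (rule clarke_ge_cong[OF clarke_subdiff_imp_clarke_ge[OF w(2)]])
      show "\<rho> - R > 0" using \<open>R < \<rho>\<close> by simp
      fix y assume "norm (y - g u) < \<rho> - R"
      then have "norm (y - a) < \<rho>"
        using norm_triangle_ineq[of "y - g u" "g u - a"] near[of u] u by simp
      then show "F y = f y" by (rule eq)
    qed
    with w(1) show "\<exists>w. (g has_vector_derivative - c *\<^sub>R w) (at u within {0..T}) \<and>
      (\<forall>d. clarke_ge F (g u) d (ip w d))" by blast
  qed
qed (use \<mu> in auto)

text \<open>To leave the half ball the curve would have to reach the shell, where
  \<open>F > r\<close>, although \<open>F\<close> does not increase along it. At time
  \<open>t\<close>, either \<open>F\<close> is already at most \<open>r - \<eta>\<close>, or by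
  monotonicity the curve has spent all of \<open>[0, t]\<close> in the band where
  \<open>ip w w \<ge> \<eta>\<close>. The gap between \<open>R / 2\<close> and \<open>R\<close> is
  reserved for the error of the iterates.\<close>

lemma sublevel_trajectory:
  fixes F :: "real^'n::finite \<Rightarrow> real"
  assumes F: "definable_fun F" and lip: "L-lipschitz_on UNIV F"
    and ip: "is_inner_product ip" and "c > 0"
    and eq: "\<And>x. norm (x - a) < \<rho> \<Longrightarrow> F x = f x" and "0 < R" "R < \<rho>"
    and barrier: "\<And>x. R / 2 \<le> norm (x - a) \<Longrightarrow> norm (x - a) \<le> R \<Longrightarrow> r < F x"
    and \<eta>: "\<eta> > 0" "\<And>x w. norm (x - a) \<le> R \<Longrightarrow> \<bar>F x - r\<bar> \<le> \<eta> \<Longrightarrow> (\<And>d. clarke_ge F x d (ip w d)) \<Longrightarrow>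
      \<eta> \<le> ip w w"
    and g: "subgradient_trajectory ip f c T g" and g0: "norm (g 0 - a) \<le> R" "F (g 0) \<le> r"
    and t: "0 \<le> t" "t \<le> T"
  shows "norm (g t - a) < R / 2 \<and> F (g t) \<le> r - min \<eta> (c * \<eta> * t)"
proof -
  have ip_nonneg: "0 \<le> ip w w" for w
    using ip bilinear_lzero[of ip] by (cases "w = 0") (auto simp: is_inner_product_def less_imp_le)
  have cont: "continuous_on {0..T} (\<lambda>t. norm (g t - a))"
    using g by (intro continuous_intros abs_continuous_on_imp_continuous)
      (simp add: subgradient_trajectory_def)
  have inside: "norm (g t - a) < R / 2" if t: "0 \<le> t" "t \<le> T" for t
  proof (rule ccontr)
    assume "\<not> ?thesis"
    moreover have "norm (g 0 - a) < R / 2" using barrier[of "g 0"] g0 by force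
    ultimately obtain t1 where t1: "0 \<le> t1" "t1 \<le> t" "norm (g t1 - a) = R / 2"
      "\<And>s. 0 \<le> s \<Longrightarrow> s \<le> t1 \<Longrightarrow> norm (g s - a) \<le> R / 2"
      using first_hitting_time[OF cont, of "R / 2" t] t by (metis not_less)
    have "R / 2 < \<rho>" using \<open>0 < R\<close> \<open>R < \<rho>\<close> by simp
    have "F (g t1) - F (g 0) \<le> - (c * 0) * (t1 - 0)"
      by (rule trajectory_descent[OF F lip ip \<open>c > 0\<close> eq \<open>R / 2 < \<rho>\<close> g])
        (use t1 t ip_nonneg in auto)
    moreover have "r < F (g t1)" using t1(3) \<open>0 < R\<close> by (intro barrier) auto
    ultimately show False using g0(2) by simp
  qed
  have near: "norm (g u - a) \<le> R" if "0 \<le> u" "u \<le> t" for u using inside[of u] that t \<open>0 < R\<close> by simp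
  have decr: "F (g t) \<le> F (g u)" if "0 \<le> u" "u \<le> t" for u
  proof -
    have "F (g t) - F (g u) \<le> - (c * 0) * (t - u)"
      by (rule trajectory_descent[OF F lip ip \<open>c > 0\<close> eq \<open>R < \<rho>\<close> g])
        (use that t near ip_nonneg in auto)
    then show ?thesis by simp
  qed
  have decr0: "F (g u) \<le> r" if "0 \<le> u" "u \<le> t" for u
  proof -
    have "F (g u) - F (g 0) \<le> - (c * 0) * (u - 0)"
      by (rule trajectory_descent[OF F lip ip \<open>c > 0\<close> eq \<open>R < \<rho>\<close> g])
        (use that t near ip_nonneg in auto)
    then show ?thesis using g0(2) by simp
  qed
  have "F (g t) \<le> r - min \<eta> (c * \<eta> * t)"
  proof (cases "F (g t) \<le> r - \<eta>")
    case False
    have "F (g t) - F (g 0) \<le> - (c * \<eta>) * (t - 0)"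
    proof (rule trajectory_descent[OF F lip ip \<open>c > 0\<close> eq \<open>R < \<rho>\<close> g])
      fix u w assume u: "0 \<le> u" "u \<le> t" and w: "\<And>d. clarke_ge F (g u) d (ip w d)"
      have "\<bar>F (g u) - r\<bar> \<le> \<eta>" using decr[OF u] decr0[OF u] False by (simp add: abs_le_iff)
      then show "\<eta> \<le> ip w w" using near[OF u] w by (intro \<eta>(2))
    qed (use t near in auto)
    then show ?thesis using g0(2) by (simp add: min_def)
  qed simp
  then show ?thesis using inside[OF t] by simp
qed

lemma stable_point_if_strict_local_min:
  fixes f :: "real^'n::finite \<Rightarrow> real" and ip :: "real^'n \<Rightarrow> real^'n \<Rightarrow> real"
  assumes idx: "distinct idx" "set idx = UNIV"
    and ip: "is_inner_product ip" and ipg: "is_inner_product ipg"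
    and f_lip: "locally_lipschitz f" and tame: "tame_fun S idx ipg f"
    and strict: "strict_local_min ip f a"
  shows "stable_point ip f a"
  unfolding stable_point_def method_stable_point_def
proof (intro allI impI)
  fix \<M> :: "(real^'n) method_map" and \<epsilon> :: real
  assume \<M>: "iterative_method \<M> \<and> approximated_by_subgradient_trajectories ip \<M> f" and "\<epsilon> > 0"
  obtain F L \<rho> where F: "definable_fun F" and lip: "L-lipschitz_on UNIV F"
    and "\<rho> > 0" and eq: "\<And>x. norm (x - a) < \<rho> \<Longrightarrow> F x = f x"
    using definable_extension[OF idx ipg f_lip tame, of a] by metis
  have L: "L \<ge> 0" using lip by (rule lipschitz_on_nonneg)
  have F_diff: "\<bar>F x - F y\<bar> \<le> L * norm (x - y)" for x y
    using lipschitz_onD[OF lip, of x y] by (simp add: dist_norm)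
  obtain m M where mM: "m > 0" "M > 0" "\<And>x. m * norm x \<le> ip_norm ip x" "\<And>x. ip_norm ip x \<le> M * norm x"
    using ip_norm_equiv[OF ip] by metis
  obtain e where e: "e > 0" "\<And>x. ip_norm ip (x - a) \<le> e \<Longrightarrow> x \<noteq> a \<Longrightarrow> f a < f x"
    using strict unfolding strict_local_min_def ip_cball_def by auto
  define R where "R = min (\<rho> / 2) (min \<epsilon> e / M)"
  have R: "0 < R" "R < \<rho>" using \<open>\<rho> > 0\<close> \<open>\<epsilon> > 0\<close> e(1) mM(2) by (auto simp: R_def)
  have RM: "ip_norm ip (x - a) \<le> min \<epsilon> e" if "norm (x - a) \<le> R" for x
  proof -
    have "M * norm (x - a) \<le> M * (min \<epsilon> e / M)"
      using that mM(2) by (intro mult_left_mono) (auto simp: R_def)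
    then show ?thesis using mM(2) mM(4)[of "x - a"] by simp
  qed
  have F_min: "F a < F x" if "norm (x - a) \<le> R" "x \<noteq> a" for x
    using e(2)[of x] RM[OF that(1)] that eq[of x] eq[of a] R \<open>\<rho> > 0\<close> by auto
  have cont: "continuous_on X F" for X
    using lipschitz_on_continuous_on[OF lip] continuous_on_subset by blast
  define Y where "Y = cball a R - ball a (R / 2)"
  have "compact Y" unfolding Y_def by (intro compact_diff) auto
  obtain h where h: "F a < h" "\<And>x. x \<in> Y \<Longrightarrow> h \<le> F x"
  proof (cases "Y = {}")
    case True
    then show thesis by (intro that[of "F a + 1"]) auto
  next
    case False
    then obtain y where "y \<in> Y" "\<And>x. x \<in> Y \<Longrightarrow> F y \<le> F x"
      using continuous_attains_inf[OF \<open>compact Y\<close> _ cont] by metis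
    moreover have "F a < F y"
      using \<open>y \<in> Y\<close> R by (intro F_min) (auto simp: Y_def dist_norm norm_minus_commute)
    ultimately show thesis using that by blast
  qed
  \<comment> \<open>The level must lie below the minimum \<open>h\<close> over the shell and be
    noncritical in the ball around \<open>a\<close>, which is enclosed in a ball around 0 to match
    \<open>finite_critical_values\<close>.\<close>
  have "infinite ({F a<..<h} - {F x | x. norm x \<le> norm a + R \<and> (\<forall>d. clarke_ge F x d 0)})"
    using finite_critical_values[OF F lip] h(1) by (intro Diff_infinite_finite) auto
  then have "{F a<..<h} - {F x | x. norm x \<le> norm a + R \<and> (\<forall>d. clarke_ge F x d 0)} \<noteq> {}"
    by (rule infinite_imp_nonempty)
  then obtain r where r: "F a < r" "r < h" "r \<notin> {F x | x. norm x \<le> norm a + R \<and> (\<forall>d. clarke_ge F x d 0)}"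
    by fastforce
  have "\<exists>d. \<not> clarke_ge F x d 0" if "x \<in> cball a R" "F x = r" for x
  proof -
    have "norm x \<le> norm a + R"
      using that(1) norm_triangle_ineq[of a "x - a"] by (simp add: dist_norm norm_minus_commute)
    then show ?thesis using r(3) that(2) by blast
  qed
  then obtain \<eta> where \<eta>: "\<eta> > 0" "\<And>x w. x \<in> cball a R \<Longrightarrow> \<bar>F x - r\<bar> \<le> \<eta> \<Longrightarrow>
      (\<And>d. clarke_ge F x d (ip w d)) \<Longrightarrow> \<eta> \<le> ip w w"
    using uniformly_noncritical[OF ip compact_cball cont, of a R r] by blast
  define K where "K = {x \<in> cball a R. F x \<le> r}"
  have "closed K" unfolding K_def by (intro continuous_on_closed_Collect_le cont continuous_intros) auto
  then have "compact K"
    by (auto simp: compact_eq_bounded_closed K_def intro: bounded_subset[OF bounded_cball])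
  from \<M> have "approximated_by_subgradient_trajectories ip \<M> f" by simp
  then obtain c where c: "c > 0" "\<forall>X0 X1 \<epsilon> T. compact X0 \<and> compact X1 \<and> \<epsilon> > 0 \<and> T > 0 \<longrightarrow>
        (\<exists>\<alpha>'>0. \<forall>\<alpha> \<in> {0<..\<alpha>'}. \<forall>k0. \<forall>x \<in> \<M> f \<alpha> X0 k0. (\<forall>k\<le>k0. x k \<in> X1) \<longrightarrow>
           (\<exists>g. subgradient_trajectory ip f c T g \<and> g 0 \<in> X0 \<and>
              (\<forall>k \<in> {k0..k0 + nat \<lfloor>T / \<alpha>\<rfloor>}. ip_norm ip (x k - g (real (k - k0) * \<alpha>)) \<le> \<epsilon>)))"
    unfolding approximated_by_subgradient_trajectories_def by (elim exE conjE)
  \<comment> \<open>Periods will last between \<open>1 / 2\<close> and 1, so \<open>\<eta>'\<close>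
    is the drop guaranteed per period. The error \<open>\<epsilon>'\<close> is small enough that the
    iterates stay within \<open>R\<close> of \<open>a\<close> and that
    \<open>L * \<epsilon>'\<close> does not exceed this drop.\<close>
  define \<eta>' where "\<eta>' = min \<eta> (c * \<eta> / 2)"
  define \<epsilon>' where "\<epsilon>' = min (R / 2) (\<eta>' / (L + 1))"
  have "\<eta>' > 0" using \<eta>(1) c(1) by (simp add: \<eta>'_def)
  then have "\<epsilon>' > 0" using R L by (simp add: \<epsilon>'_def)
  have "\<epsilon>' \<le> \<eta>' / (L + 1)" by (simp add: \<epsilon>'_def)
  then have "L * \<epsilon>' + \<epsilon>' \<le> \<eta>'" using L by (simp add: field_simps)
  then have L\<epsilon>: "L * \<epsilon>' \<le> \<eta>'" using \<open>\<epsilon>' > 0\<close> by simp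
  have "m * \<epsilon>' > 0" using mM(1) \<open>\<epsilon>' > 0\<close> by simp
  then have "compact K \<and> compact (cball a R) \<and> m * \<epsilon>' > 0 \<and> (1 :: real) > 0"
    using \<open>compact K\<close> by simp
  from c(2)[THEN spec, THEN spec, THEN spec, THEN spec, THEN mp, OF this]
  obtain \<alpha>' where \<alpha>': "\<alpha>' > 0" "\<forall>\<alpha> \<in> {0<..\<alpha>'}. \<forall>k0. \<forall>x \<in> \<M> f \<alpha> K k0. (\<forall>k\<le>k0. x k \<in> cball a R) \<longrightarrow>
           (\<exists>g. subgradient_trajectory ip f c 1 g \<and> g 0 \<in> K \<and>
              (\<forall>k \<in> {k0..k0 + nat \<lfloor>1 / \<alpha>\<rfloor>}. ip_norm ip (x k - g (real (k - k0) * \<alpha>)) \<le> m * \<epsilon>'))"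
    by (elim exE conjE)
  define \<delta> where "\<delta> = m * min R ((r - F a) / (L + 1))"
  have "\<delta> > 0" using mM(1) R r(1) L by (simp add: \<delta>_def)
  have start: "x \<in> K" if "x \<in> ip_cball ip a \<delta>" for x
  proof -
    have "m * norm (x - a) \<le> m * min R ((r - F a) / (L + 1))"
      using that mM(3)[of "x - a"] by (simp add: ip_cball_def \<delta>_def)
    then have x: "norm (x - a) \<le> R" "norm (x - a) \<le> (r - F a) / (L + 1)" using mM(1) by auto
    have "F x - F a \<le> L * norm (x - a)" using F_diff[of x a] by simp
    also have "\<dots> \<le> (L + 1) * norm (x - a)" by (intro mult_right_mono) auto
    also have "\<dots> \<le> r - F a" using x(2) L by (simp add: field_simps)
    finally show ?thesis using x(1) by (simp add: K_def dist_norm norm_minus_commute)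
  qed
  obtain \<S> where \<S>: "\<And>f \<alpha> X0 k0. \<alpha> > 0 \<Longrightarrow> \<M> f \<alpha> X0 k0 = {x \<in> \<S> f \<alpha>. x k0 \<in> X0}"
    using \<M> unfolding iterative_method_def by blast
  have "range x \<subseteq> ip_cball ip a \<epsilon>"
    if \<alpha>: "\<alpha> \<in> {0<..min \<alpha>' (1 / 2)}" and x: "x \<in> \<M> f \<alpha> (ip_cball ip a \<delta>) 0" for \<alpha> x
  proof -
    \<comment> \<open>Number of steps per period. From \<open>\<alpha> \<le> 1 / 2\<close> and
      \<open>p > 1 / \<alpha> - 1\<close> it follows that rounding leaves a duration
      \<open>p * \<alpha>\<close> of at least \<open>1 / 2\<close>.\<close>
    define p where "p = nat \<lfloor>1 / \<alpha>\<rfloor>"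
    have \<alpha>0: "0 < \<alpha>" "\<alpha> \<le> 1 / 2" using \<alpha> by auto
    have "1 / \<alpha> \<ge> 2" using \<alpha>0 by (simp add: field_simps)
    have p: "real p \<le> 1 / \<alpha>" "1 / \<alpha> - 1 < real p"
      using \<open>1 / \<alpha> \<ge> 2\<close> floor_correct[of "1 / \<alpha>"] unfolding p_def by linarith+
    then have p\<alpha>: "real p * \<alpha> \<le> 1" "1 / 2 \<le> real p * \<alpha>"
      using \<alpha>0 by (auto simp: field_simps)
    have "p \<ge> 1" using p(2) \<open>1 / \<alpha> \<ge> 2\<close> by linarith
    have x\<S>: "x \<in> \<S> f \<alpha>" "x 0 \<in> K" using x \<S> \<alpha>0 start by auto
    \<comment> \<open>The approximation property at \<open>k0 = n * p\<close> asks for both parts: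
      the current iterate in \<open>K\<close>, and all iterates so far in a fixed compact set. The
      bound \<open>\<alpha>'\<close> does not depend on \<open>k0\<close>, so the same step size
      serves every period.\<close>
    have "x (n * p) \<in> K \<and> (\<forall>k\<le>n * p. x k \<in> cball a R)" for n
    proof (induction n)
      case 0
      then show ?case using x\<S>(2) by (simp add: K_def)
    next
      case (Suc n)
      have "x \<in> \<M> f \<alpha> K (n * p)" using x\<S>(1) \<S> \<alpha>0 Suc by auto
      moreover have "\<alpha> \<in> {0<..\<alpha>'}" "\<forall>k\<le>n * p. x k \<in> cball a R" using \<alpha> Suc by auto
      \<comment> \<open>The trajectory starts in \<open>K\<close>, but not necessarily at
        \<open>x (n * p)\<close>; only closeness at the sampled times is used.\<close>
      ultimately obtain g where g: "subgradient_trajectory ip f c 1 g" "g 0 \<in> K"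
        "\<forall>k \<in> {n * p..n * p + p}. ip_norm ip (x k - g (real (k - n * p) * \<alpha>)) \<le> m * \<epsilon>'"
        using \<alpha>'(2)[THEN bspec, THEN spec, THEN bspec, THEN mp, of \<alpha> x "n * p"] unfolding p_def by blast
      have gt: "norm (g t - a) < R / 2 \<and> F (g t) \<le> r - min \<eta> (c * \<eta> * t)" if "0 \<le> t" "t \<le> 1" for t
        using that g(2)
        by (intro sublevel_trajectory[OF F lip ip \<open>c > 0\<close> eq R _ \<eta>(1) \<eta>(2) g(1)])
          (auto simp: K_def dist_norm norm_minus_commute Y_def intro!: less_le_trans[OF r(2) h(2)])
      have close: "norm (x k - g (real (k - n * p) * \<alpha>)) \<le> \<epsilon>'" if "k \<in> {n * p..n * p + p}" for k
        using order_trans[OF mM(3) g(3)[THEN bspec, OF that]] mM(1) by simp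
      have time: "0 \<le> real (k - n * p) * \<alpha>" "real (k - n * p) * \<alpha> \<le> 1" if "k \<in> {n * p..n * p + p}" for k
      proof -
        have "k - n * p \<le> p" using that by auto
        then have "real (k - n * p) * \<alpha> \<le> real p * \<alpha>"
          using \<alpha>0 by (intro mult_right_mono of_nat_mono) auto
        then show "real (k - n * p) * \<alpha> \<le> 1" using p\<alpha> by simp
      qed (use \<alpha>0 in simp)
      have near: "x k \<in> cball a R" if "k \<in> {n * p..n * p + p}" for k
      proof -
        have "norm (x k - a) \<le> norm (x k - g (real (k - n * p) * \<alpha>)) + norm (g (real (k - n * p) * \<alpha>) - a)"
          using norm_triangle_ineq[of "x k - g (real (k - n * p) * \<alpha>)" "g (real (k - n * p) * \<alpha>) - a"] by simp
        also have "\<dots> \<le> R / 2 + R / 2"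
          using close[OF that] gt[OF time[OF that]] by (intro add_mono) (auto simp: \<epsilon>'_def)
        finally show ?thesis by (simp add: dist_norm norm_minus_commute)
      qed
      have "F (x (n * p + p)) \<le> r"
      proof -
        have "\<bar>F (x (n * p + p)) - F (g (real p * \<alpha>))\<bar> \<le> L * \<epsilon>'"
          using close[of "n * p + p"] L by (intro order_trans[OF F_diff] mult_left_mono) auto
        moreover have "F (g (real p * \<alpha>)) \<le> r - min \<eta> (c * \<eta> * (real p * \<alpha>))"
          using gt[of "real p * \<alpha>"] p\<alpha> by simp
        moreover have "c * \<eta> * (1 / 2) \<le> c * \<eta> * (real p * \<alpha>)"
          using p\<alpha>(2) c(1) \<eta>(1) by (intro mult_left_mono) auto
        then have "\<eta>' \<le> min \<eta> (c * \<eta> * (real p * \<alpha>))" by (auto simp: \<eta>'_def)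
        ultimately show ?thesis using L\<epsilon> by linarith
      qed
      moreover have "x k \<in> cball a R" if "k \<le> n * p + p" for k
        using Suc near[of k] that by (cases "k \<le> n * p") auto
      ultimately show ?case by (auto simp: K_def add.commute)
    qed
    \<comment> \<open>Taking \<open>n = k\<close> suffices, as \<open>k \<le> k * p\<close>.\<close>
    then have "x k \<in> cball a R" for k
      using \<open>p \<ge> 1\<close> by (metis le_refl mult_le_mono2 nat_mult_1_right)
    then show ?thesis
      using RM by (auto simp: ip_cball_def dist_norm norm_minus_commute)
  qed
  then show "\<exists>\<delta>>0. \<exists>\<alpha>'>0. \<forall>x \<in> (\<Union>\<alpha> \<in> {0<..\<alpha>'}. \<M> f \<alpha> (ip_cball ip a \<delta>) 0). range x \<subseteq> ip_cball ip a \<epsilon>"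
    using \<open>\<delta> > 0\<close> \<alpha>'(1) by (intro exI[of _ \<delta>] conjI exI[of _ "min \<alpha>' (1 / 2)"]) auto
qed

end

theorem theorem3p6:
  fixes S :: "nat \<Rightarrow> real list set set"
    and idx :: "'n::finite list"
    and ip :: "real^'n \<Rightarrow> real^'n \<Rightarrow> real"
    and ipg :: "(real^'n) \<times> real \<Rightarrow> (real^'n) \<times> real \<Rightarrow> real"
    and f :: "real^'n \<Rightarrow> real"
    and xstar :: "real^'n"
  assumes "o_minimal S"
    and "distinct idx" and "set idx = UNIV"
    and "is_inner_product ip" and "is_inner_product ipg"
    and "locally_lipschitz f"
    and "tame_fun S idx ipg f"
    and "strict_local_min ip f xstar"
  shows "stable_point ip f xstar"
proof -
  interpret o_minimal_structure S by standard fact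
  show ?thesis by (rule stable_point_if_strict_local_min) fact+
qed

end
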